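(* Let $t=(\mathcal{G},\sigma,\Omega)$ be a symplectic symmetric triple such that $\mathcal{G}$ is neither solvable nor semisimple and $t$ has no non-zero semisimple factor. Let $\mathcal{G}=\mathcal{K}\oplus\mathcal{P}$ be its canonical decomposition, $\mathcal{R}$ the radical of $\mathcal{G}$, and assume that $\mathcal{P}_{\mathcal{R}}=\mathcal{P}\cap\mathcal{R}$ is isotropic for $\Omega$. Let $\mathcal{S}$ be a $\sigma$-stable Levi factor of $\mathcal{G}$ and, in the decomposition of the semisimple symmetric couple $(\mathcal{S},\sigma|_{\mathcal{S}})$ into indecomposable symmetric couples, let $A$ be the number of components $\mathcal{S}^a=\mathcal{K}_s^a\oplus\mathcal{P}_s^a$ for which the centre of $\mathcal{K}_s^a$ is $\{0\}$, and $I$ the number of components $\mathcal{S}^i=\mathcal{K}_s^i\oplus\mathcal{P}_s^i$ for which the centre of $\mathcal{K}_s^i$ is non-zero. Then: (i) $\dim\mathcal{P}_{\mathcal{R}}\geq 2A+I$; (ii) $I\neq\dim\mathcal{P}_{\mathcal{R}}$.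
   Context: A symmetric couple is a couple $(\mathcal{G},\sigma)$ where $\mathcal{G}$ is a finite-dimensional real Lie algebra and $\sigma$ is an involutive automorphism of $\mathcal{G}$ such that, writing $\mathcal{G}=\mathcal{K}\oplus\mathcal{P}$ with $\sigma=\mathrm{id}_{\mathcal{K}}\oplus(-\mathrm{id}_{\mathcal{P}})$ (canonical decomposition), one has $[\mathcal{P},\mathcal{P}]=\mathcal{K}$ and $\mathcal{K}$ acts faithfully on $\mathcal{P}$. A symplectic symmetric triple $(\mathcal{G},\sigma,\Omega)$ is a symmetric couple together with a $\mathcal{K}$-invariant symplectic form $\Omega$ on $\mathcal{P}$. Direct sums of couples and triples are defined in the obvious way (for triples, with orthogonal direct sum of forms); indecomposable means not a direct sum of two non-trivial ones. A semisimple factor of $t$ is a triple $t_{\mathcal{L}}$ with semisimple Lie algebra such that $t=t_{\mathcal{L}}\oplus t_1$ for some triple $t_1$. If $\mathcal{S}$ is a $\sigma$-stable Levi factor of $\mathcal{G}$ (one always exists), $(\mathcal{S},\sigma|_{\mathcal{S}})$ is a semisimple symmetric couple. *)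

theory Defs
  imports Complex_Main
begin

text \<open>
  A Lie algebra is a carrier set \<open>g\<close> (a finite-dimensional subspace of an ambient real vector
  space) together with a bracket \<open>br\<close>; all axioms are relativised to the carrier, so that a
  subalgebra is just a smaller carrier with the same bracket, and direct sums are internal.
\<close>

definition bilinear_on :: "'a::real_vector set \<Rightarrow> ('a \<Rightarrow> 'a \<Rightarrow> 'b::real_vector) \<Rightarrow> bool" where
  "bilinear_on V f \<longleftrightarrow>
     (\<forall>x\<in>V. \<forall>y\<in>V. \<forall>z\<in>V. f (x + y) z = f x z + f y z \<and> f z (x + y) = f z x + f z y) \<and>
     (\<forall>c. \<forall>x\<in>V. \<forall>y\<in>V. f (c *\<^sub>R x) y = c *\<^sub>R f x y \<and> f x (c *\<^sub>R y) = c *\<^sub>R f x y)"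

definition lie_algebra :: "'a::real_vector set \<Rightarrow> ('a \<Rightarrow> 'a \<Rightarrow> 'a) \<Rightarrow> bool" where
  "lie_algebra g br \<longleftrightarrow>
     (\<exists>B. finite B \<and> span B = g) \<and>
     (\<forall>x\<in>g. \<forall>y\<in>g. br x y \<in> g) \<and>
     bilinear_on g br \<and>
     (\<forall>x\<in>g. br x x = 0) \<and>
     (\<forall>x\<in>g. \<forall>y\<in>g. \<forall>z\<in>g. br x (br y z) + br y (br z x) + br z (br x y) = 0)"

definition bracket_span :: "('a::real_vector \<Rightarrow> 'a \<Rightarrow> 'a) \<Rightarrow> 'a set \<Rightarrow> 'a set \<Rightarrow> 'a set" where
  "bracket_span br U V = span {br x y | x y. x \<in> U \<and> y \<in> V}"

definition lie_subalgebra :: "'a::real_vector set \<Rightarrow> 'a set \<Rightarrow> ('a \<Rightarrow> 'a \<Rightarrow> 'a) \<Rightarrow> bool" where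
  "lie_subalgebra h g br \<longleftrightarrow>
     subspace h \<and> h \<subseteq> g \<and> (\<forall>x\<in>h. \<forall>y\<in>h. br x y \<in> h)"

definition lie_ideal :: "'a::real_vector set \<Rightarrow> 'a set \<Rightarrow> ('a \<Rightarrow> 'a \<Rightarrow> 'a) \<Rightarrow> bool" where
  "lie_ideal h g br \<longleftrightarrow>
     subspace h \<and> h \<subseteq> g \<and> (\<forall>x\<in>g. \<forall>y\<in>h. br x y \<in> h)"

definition lie_centre :: "'a::real_vector set \<Rightarrow> ('a \<Rightarrow> 'a \<Rightarrow> 'a) \<Rightarrow> 'a set" where
  "lie_centre g br = {x \<in> g. \<forall>y\<in>g. br x y = 0}"

primrec derived_series ::
    "'a::real_vector set \<Rightarrow> ('a \<Rightarrow> 'a \<Rightarrow> 'a) \<Rightarrow> nat \<Rightarrow> 'a set" where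
  "derived_series g br 0 = g"
| "derived_series g br (Suc n) =
     bracket_span br (derived_series g br n) (derived_series g br n)"

definition lie_solvable :: "'a::real_vector set \<Rightarrow> ('a \<Rightarrow> 'a \<Rightarrow> 'a) \<Rightarrow> bool" where
  "lie_solvable g br \<longleftrightarrow> (\<exists>n. derived_series g br n = {0})"

text \<open>The sum of all solvable ideals, i.e. the largest solvable ideal.\<close>

definition lie_radical :: "'a::real_vector set \<Rightarrow> ('a \<Rightarrow> 'a \<Rightarrow> 'a) \<Rightarrow> 'a set" where
  "lie_radical g br = span (\<Union>{h. lie_ideal h g br \<and> lie_solvable h br})"

text \<open>With this convention the zero algebra is semisimple.\<close>

definition lie_semisimple :: "'a::real_vector set \<Rightarrow> ('a \<Rightarrow> 'a \<Rightarrow> 'a) \<Rightarrow> bool" where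
  "lie_semisimple g br \<longleftrightarrow> lie_radical g br = {0}"

definition levi_factor :: "'a::real_vector set \<Rightarrow> 'a set \<Rightarrow> ('a \<Rightarrow> 'a \<Rightarrow> 'a) \<Rightarrow> bool" where
  "levi_factor s g br \<longleftrightarrow>
     lie_subalgebra s g br \<and> lie_semisimple s br \<and>
     s \<inter> lie_radical g br = {0} \<and>
     g = {x + y | x y. x \<in> s \<and> y \<in> lie_radical g br}"

definition involutive_automorphism ::
    "'a::real_vector set \<Rightarrow> ('a \<Rightarrow> 'a \<Rightarrow> 'a) \<Rightarrow> ('a \<Rightarrow> 'a) \<Rightarrow> bool" where
  "involutive_automorphism g br \<sigma> \<longleftrightarrow>
     (\<forall>x\<in>g. \<sigma> x \<in> g) \<and>
     (\<forall>x\<in>g. \<forall>y\<in>g. \<sigma> (x + y) = \<sigma> x + \<sigma> y) \<and>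
     (\<forall>c. \<forall>x\<in>g. \<sigma> (c *\<^sub>R x) = c *\<^sub>R \<sigma> x) \<and>
     (\<forall>x\<in>g. \<forall>y\<in>g. \<sigma> (br x y) = br (\<sigma> x) (\<sigma> y)) \<and>
     (\<forall>x\<in>g. \<sigma> (\<sigma> x) = x)"

text \<open>The two summands of the canonical decomposition of \<open>g\<close>.\<close>

definition K_part :: "'a::real_vector set \<Rightarrow> ('a \<Rightarrow> 'a) \<Rightarrow> 'a set" where
  "K_part g \<sigma> = {x \<in> g. \<sigma> x = x}"

definition P_part :: "'a::real_vector set \<Rightarrow> ('a \<Rightarrow> 'a) \<Rightarrow> 'a set" where
  "P_part g \<sigma> = {x \<in> g. \<sigma> x = - x}"

definition symmetric_couple ::
    "'a::real_vector set \<Rightarrow> ('a \<Rightarrow> 'a \<Rightarrow> 'a) \<Rightarrow> ('a \<Rightarrow> 'a) \<Rightarrow> bool" where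
  "symmetric_couple g br \<sigma> \<longleftrightarrow>
     lie_algebra g br \<and> involutive_automorphism g br \<sigma> \<and>
     bracket_span br (P_part g \<sigma>) (P_part g \<sigma>) = K_part g \<sigma> \<and>
     (\<forall>k\<in>K_part g \<sigma>. (\<forall>p\<in>P_part g \<sigma>. br k p = 0) \<longrightarrow> k = 0)"

definition symplectic_form_on ::
    "'a::real_vector set \<Rightarrow> ('a \<Rightarrow> 'a \<Rightarrow> real) \<Rightarrow> bool" where
  "symplectic_form_on V \<Omega> \<longleftrightarrow>
     bilinear_on V \<Omega> \<and>
     (\<forall>x\<in>V. \<Omega> x x = 0) \<and>
     (\<forall>x\<in>V. (\<forall>y\<in>V. \<Omega> x y = 0) \<longrightarrow> x = 0)"

definition symplectic_symmetric_triple ::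
    "'a::real_vector set \<Rightarrow> ('a \<Rightarrow> 'a \<Rightarrow> 'a) \<Rightarrow> ('a \<Rightarrow> 'a) \<Rightarrow> ('a \<Rightarrow> 'a \<Rightarrow> real) \<Rightarrow> bool" where
  "symplectic_symmetric_triple g br \<sigma> \<Omega> \<longleftrightarrow>
     symmetric_couple g br \<sigma> \<and>
     symplectic_form_on (P_part g \<sigma>) \<Omega> \<and>
     (\<forall>k\<in>K_part g \<sigma>. \<forall>x\<in>P_part g \<sigma>. \<forall>y\<in>P_part g \<sigma>. \<Omega> (br k x) y + \<Omega> x (br k y) = 0)"

definition lie_direct_sum ::
    "'a::real_vector set \<Rightarrow> ('a \<Rightarrow> 'a \<Rightarrow> 'a) \<Rightarrow> 'a set \<Rightarrow> 'a set \<Rightarrow> bool" where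
  "lie_direct_sum g br g1 g2 \<longleftrightarrow>
     lie_subalgebra g1 g br \<and> lie_subalgebra g2 g br \<and>
     g1 \<inter> g2 = {0} \<and> g = {x + y | x y. x \<in> g1 \<and> y \<in> g2} \<and>
     (\<forall>x\<in>g1. \<forall>y\<in>g2. br x y = 0)"

definition couple_direct_sum ::
    "'a::real_vector set \<Rightarrow> ('a \<Rightarrow> 'a \<Rightarrow> 'a) \<Rightarrow> ('a \<Rightarrow> 'a) \<Rightarrow> 'a set \<Rightarrow> 'a set \<Rightarrow> bool" where
  "couple_direct_sum g br \<sigma> g1 g2 \<longleftrightarrow>
     lie_direct_sum g br g1 g2 \<and> symmetric_couple g1 br \<sigma> \<and> symmetric_couple g2 br \<sigma>"

definition triple_direct_sum ::
    "'a::real_vector set \<Rightarrow> ('a \<Rightarrow> 'a \<Rightarrow> 'a) \<Rightarrow> ('a \<Rightarrow> 'a) \<Rightarrow> ('a \<Rightarrow> 'a \<Rightarrow> real) \<Rightarrow>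
     'a set \<Rightarrow> 'a set \<Rightarrow> bool" where
  "triple_direct_sum g br \<sigma> \<Omega> g1 g2 \<longleftrightarrow>
     lie_direct_sum g br g1 g2 \<and>
     symplectic_symmetric_triple g1 br \<sigma> \<Omega> \<and> symplectic_symmetric_triple g2 br \<sigma> \<Omega> \<and>
     (\<forall>x\<in>P_part g1 \<sigma>. \<forall>y\<in>P_part g2 \<sigma>. \<Omega> x y = 0)"

definition semisimple_factor ::
    "'a::real_vector set \<Rightarrow> 'a set \<Rightarrow> ('a \<Rightarrow> 'a \<Rightarrow> 'a) \<Rightarrow> ('a \<Rightarrow> 'a) \<Rightarrow> ('a \<Rightarrow> 'a \<Rightarrow> real) \<Rightarrow> bool" where
  "semisimple_factor l g br \<sigma> \<Omega> \<longleftrightarrow>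
     lie_semisimple l br \<and> (\<exists>g1. triple_direct_sum g br \<sigma> \<Omega> l g1)"

definition indecomposable_couple ::
    "'a::real_vector set \<Rightarrow> ('a \<Rightarrow> 'a \<Rightarrow> 'a) \<Rightarrow> ('a \<Rightarrow> 'a) \<Rightarrow> bool" where
  "indecomposable_couple g br \<sigma> \<longleftrightarrow>
     symmetric_couple g br \<sigma> \<and>
     \<not> (\<exists>g1 g2. g1 \<noteq> {0} \<and> g2 \<noteq> {0} \<and> couple_direct_sum g br \<sigma> g1 g2)"

text \<open>
  The components of a decomposition are required to be non-zero, since otherwise the zero couple
  could be counted as an additional component. Being non-zero, the summands of a direct sum are
  pairwise distinct, so a set of carriers (rather than an indexed family) suffices.
\<close>

definition couple_decomposition ::
    "'a::real_vector set \<Rightarrow> ('a \<Rightarrow> 'a \<Rightarrow> 'a) \<Rightarrow> ('a \<Rightarrow> 'a) \<Rightarrow> 'a set set \<Rightarrow> bool" where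
  "couple_decomposition g br \<sigma> \<C> \<longleftrightarrow>
     finite \<C> \<and>
     (\<forall>c\<in>\<C>. c \<noteq> {0} \<and> indecomposable_couple c br \<sigma>) \<and>
     g = {\<Sum>c\<in>\<C>. f c | f. \<forall>c\<in>\<C>. f c \<in> c} \<and>
     (\<forall>f. (\<forall>c\<in>\<C>. f c \<in> c) \<longrightarrow> (\<Sum>c\<in>\<C>. f c) = 0 \<longrightarrow> (\<forall>c\<in>\<C>. f c = 0)) \<and>
     (\<forall>c\<in>\<C>. \<forall>d\<in>\<C>. c \<noteq> d \<longrightarrow> (\<forall>x\<in>c. \<forall>y\<in>d. br x y = 0))"

definition isotropic_for :: "('a \<Rightarrow> 'a \<Rightarrow> real) \<Rightarrow> 'a set \<Rightarrow> bool" where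
  "isotropic_for \<Omega> W \<longleftrightarrow> (\<forall>x\<in>W. \<forall>y\<in>W. \<Omega> x y = 0)"

end

theory Submission
  imports Defs "HOL-Analysis.Product_Vector" "HOL-Computational_Algebra.Fundamental_Theorem_Algebra"
begin

text \<open>Write \<open>K\<^sub>R\<close>, \<open>P\<^sub>R\<close> for the two parts of the radical \<open>R\<close> and \<open>c = K\<^sup>c + P\<^sup>c\<close> for a component of
the Levi factor. The radical is an ideal, so a bracket of \<open>K\<^sub>R\<close> with \<open>P\<close> lies in \<open>P\<^sub>R\<close>, and
\<open>\<Omega>([a,\<rho>],y) = - \<Omega>(\<rho>,[a,y]) = 0\<close> for \<open>a \<in> K\<^sub>R\<close>, \<open>\<rho> \<in> P\<^sub>R\<close> because \<open>P\<^sub>R\<close> is isotropic: \<open>K\<^sub>R\<close>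
annihilates \<open>P\<^sub>R\<close>. If moreover \<open>P\<^sup>c\<close> is orthogonal to \<open>P\<^sub>R\<close>, the same kind of computation, together
with the faithfulness of \<open>K\<close> on \<open>P\<close>, shows that \<open>c\<close> commutes with \<open>R\<close>
(\<open>orthogonal_component_commutes_with_radical\<close>); then \<open>c\<close> and its centraliser are the two summands of a
splitting of the triple (\<open>orthogonal_component_is_factor\<close>). As there is no semisimple factor, every
\<open>P\<^sup>c\<close> pairs non-trivially with \<open>P\<^sub>R\<close>.

Part (i). The form embeds \<open>P\<^sub>R\<close> into the dual of the sum of the \<open>P\<^sup>c\<close>, and the subspace \<open>[K\<^sup>c,P\<^sub>R]\<close>
of \<open>P\<^sub>R\<close> (called \<open>moved c\<close>) is orthogonal to every \<open>P\<^sup>d\<close> with \<open>d \<noteq> c\<close>; so these subspaces are independent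
(\<open>independent_choice\<close>). They are non-zero because \<open>P\<^sup>c = [K\<^sup>c,P\<^sup>c]\<close>. If \<open>[K\<^sup>c,P\<^sub>R]\<close> is a line,
\<open>K\<^sup>c\<close> acts on it by a non-zero character, and the element of \<open>K\<^sup>c\<close> that represents this character for
the Killing form is a non-zero central element. So a component with centreless \<open>K\<^sup>c\<close> contributes at
least two dimensions.

Part (ii). Equality would make all the \<open>[K\<^sup>c,P\<^sub>R]\<close> lines that together span \<open>P\<^sub>R\<close>. Choose \<open>z\<close> in one
\<open>K\<^sup>c\<close> with eigenvalue \<open>1\<close> on its own line; it acts by \<open>0\<close> on the others. The elements of \<open>K\<^sub>R\<close> act
on \<open>P\<close> as symmetric tensors over \<open>P\<^sub>R\<close>, so \<open>ad z\<close> is diagonalisable on \<open>K\<^sub>R\<close> with eigenvalues among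
\<open>0, 1, 2\<close>. Hence the trace of \<open>ad z\<close> on \<open>R\<close> is positive; but \<open>z\<close> lies in the perfect Lie algebra \<open>c\<close>,
so this trace is \<open>0\<close> (\<open>moved_lines_impossible\<close>).

All that enters about semisimple Lie algebras is that vanishing of the radical makes the Killing form
non-degenerate (\<open>killing_nondegenerate\<close>). The last term of the derived series of the kernel of the
Killing form is a perfect ideal \<open>D\<close>. For \<open>x \<in> D\<close> let \<open>y\<close> be the derivation that multiplies the
generalised eigenspace of \<open>ad x\<close> for \<open>\<lambda>\<close> by the complex conjugate of \<open>\<lambda>\<close>
(\<open>conjugate_derivation\<close>). Invariance gives \<open>tr (ad x \<circ> y) = 0\<close>, whereas this trace is the sum of all
\<open>|\<lambda>|\<^sup>2\<close>; so \<open>ad x\<close> is nilpotent, and by Engel's theorem a perfect algebra of ad-nilpotent elements is zero.\<close>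

section \<open>Finite-dimensional subspaces and traces\<close>

text \<open>The ambient type carries no dimension bound, so finite dimension is a property of subspaces.\<close>
definition fin_dim_subspace :: "'a::real_vector set \<Rightarrow> bool" where
  "fin_dim_subspace V \<longleftrightarrow> subspace V \<and> (\<exists>B. finite B \<and> V \<subseteq> span B)"

lemma fin_dim_subspaceD: "fin_dim_subspace V \<Longrightarrow> subspace V"
  by (simp add: fin_dim_subspace_def)

lemma fin_dim_subspace_subset:
  "fin_dim_subspace V \<Longrightarrow> subspace W \<Longrightarrow> W \<subseteq> V \<Longrightarrow> fin_dim_subspace W"
  unfolding fin_dim_subspace_def by blast

lemma independent_imp_finite_card_le_dim:
  assumes "fin_dim_subspace V" "B \<subseteq> V" "independent B"
  shows "finite B \<and> card B \<le> dim V"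
proof -
  obtain C where C: "finite C" "V \<subseteq> span C" using assms by (auto simp: fin_dim_subspace_def)
  obtain D where D: "D \<subseteq> V" "independent D" "V \<subseteq> span D" "card D = dim V"
    using basis_exists by blast
  have "finite D" using independent_span_bound[OF C(1) D(2)] D C by blast
  with independent_span_bound[OF this assms(3)] D assms show ?thesis by auto
qed

text \<open>The basis is chosen inside a prescribed spanning set, so that it can later be taken to consist of
eigenvectors.\<close>
lemma basis_within:
  assumes "fin_dim_subspace V" "X \<subseteq> V" "V \<subseteq> span X"
  obtains B where "B \<subseteq> X" "finite B" "independent B" "span B = V" "card B = dim V"
proof -
  obtain B where B: "B \<subseteq> X" "independent B" "X \<subseteq> span B"
    using maximal_independent_subset[of X] by blast
  have 1: "span B \<subseteq> V"
    by (rule span_minimal) (use assms B fin_dim_subspaceD in auto)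
  have 2: "V \<subseteq> span B"
    using assms(3) span_minimal[OF B(3)] by auto
  show thesis
    by (rule that[of B])
      (use B 1 2 assms independent_imp_finite_card_le_dim[OF assms(1), of B] basis_card_eq_dim[of B V] in auto)
qed

lemma finite_basis:
  assumes "fin_dim_subspace V"
  obtains B where "finite B" "independent B" "span B = V" "card B = dim V"
  using basis_within[OF assms subset_refl span_superset] by metis

lemma dim_mono_fin:
  assumes "fin_dim_subspace V" "subspace W" "W \<subseteq> V"
  shows "dim W \<le> dim V"
  using finite_basis[OF fin_dim_subspace_subset[OF assms]]
    independent_imp_finite_card_le_dim[OF assms(1)] assms(3)
  by (metis span_superset subset_trans)

lemma subspace_eq_of_dim_le:
  assumes "fin_dim_subspace V" "subspace W" "W \<subseteq> V" "dim V \<le> dim W"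
  shows "W = V"
proof (rule ccontr)
  assume "W \<noteq> V"
  then obtain v where v: "v \<in> V" "v \<notin> W" using assms(3) by blast
  obtain B where B: "finite B" "independent B" "span B = W" "card B = dim W"
    using finite_basis[OF fin_dim_subspace_subset[OF assms(1-3)]] by metis
  have "independent (insert v B)" using B v by (simp add: independent_insertI)
  moreover have "insert v B \<subseteq> V" using v B assms(3) span_superset[of B] by auto
  ultimately have "card (insert v B) \<le> dim V"
    using independent_imp_finite_card_le_dim[OF assms(1)] by blast
  moreover have "v \<notin> B" using v B span_superset[of B] by auto
  ultimately show False using B assms(4) by simp
qed

lemma fin_dim_subspace_Times:
  assumes "fin_dim_subspace V" "fin_dim_subspace W"
  shows "fin_dim_subspace (V \<times> W)"
proof -
  obtain B C where B: "finite B" "V = span B" and C: "finite C" "W = span C"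
    using finite_basis assms by metis
  let ?X = "(\<lambda>b. (b, 0)) ` B \<union> (\<lambda>c. (0, c)) ` C"
  have l1: "linear (\<lambda>b. (b, 0::'b))" and l2: "linear (\<lambda>c. (0::'a, c))"
    by (auto intro!: linearI)
  have "(v, w) \<in> span ?X" if "v \<in> V" "w \<in> W" for v w
  proof -
    have "(v, 0) \<in> span ((\<lambda>b. (b, 0::'b)) ` B)"
      using that B linear_span_image[OF l1, of B] by auto
    moreover have "(0, w) \<in> span ((\<lambda>c. (0::'a, c)) ` C)"
      using that C linear_span_image[OF l2, of C] by auto
    ultimately have "(v, 0) + (0, w) \<in> span ?X"
      by (intro span_add) (meson in_mono span_mono sup_ge1 sup_ge2)+
    then show ?thesis by simp
  qed
  moreover have "subspace (V \<times> W)"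
    using assms[THEN fin_dim_subspaceD] by (auto simp: subspace_def zero_prod_def)
  ultimately show ?thesis unfolding fin_dim_subspace_def using B C
    by (intro conjI exI[of _ ?X]) auto
qed

text \<open>Coordinates are extended to linear functionals on the whole space; in this form they commute with
sums without any membership conditions.\<close>
definition coord :: "'a::real_vector set \<Rightarrow> 'a \<Rightarrow> 'a \<Rightarrow> real" where
  "coord B b = construct B (\<lambda>x. if x = b then 1 else 0)"

lemma linear_coord: "independent B \<Longrightarrow> linear (coord B b)"
  unfolding coord_def by (rule linear_construct)

lemma coord_basis: "independent B \<Longrightarrow> x \<in> B \<Longrightarrow> coord B b x = (if x = b then 1 else 0)"
  unfolding coord_def by (rule construct_basis)

lemma coord_expand:
  assumes "finite B" "independent B" "v \<in> span B"
  shows "(\<Sum>b\<in>B. coord B b v *\<^sub>R b) = v"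
proof -
  have "linear (\<lambda>v. \<Sum>b\<in>B. coord B b v *\<^sub>R b)"
    by (auto intro!: linearI simp: linear_add[OF linear_coord[OF assms(2)]]
        linear_scale[OF linear_coord[OF assms(2)]] scaleR_add_left sum.distrib scaleR_sum_right)
  from linear_eq_on[OF this linear_id assms(3)] show ?thesis
    using assms by (simp add: coord_basis if_distrib[of "\<lambda>x. x *\<^sub>R _"] cong: if_cong)
qed

text \<open>For endomorphisms of \<open>V\<close> every basis gives the same value (\<open>trace_on_basis\<close>). Fixing one basis for all functions
makes the trace additive and homogeneous on arbitrary functions.\<close>
definition trace_on :: "'a::real_vector set \<Rightarrow> ('a \<Rightarrow> 'a) \<Rightarrow> real" where
  "trace_on V f = (let B = (SOME B. finite B \<and> independent B \<and> span B = V)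
                   in \<Sum>b\<in>B. coord B b (f b))"

text \<open>Both sides expand to the double sum of the products of the matrix entries of \<open>f\<close> and \<open>g\<close>. Taking \<open>g\<close> to be the
identity gives independence of the basis, and taking it to be an inclusion reduces a trace to a subspace
that contains the image.\<close>
lemma trace_exchange:
  fixes f :: "'a::real_vector \<Rightarrow> 'b::real_vector"
  assumes B: "finite B" "independent B" and C: "finite C" "independent C"
    and f: "\<And>b. b \<in> B \<Longrightarrow> f b \<in> span C" and g: "\<And>c. c \<in> C \<Longrightarrow> g c \<in> span B"
    and lf: "linear f" and lg: "linear g"
  shows "(\<Sum>b\<in>B. coord B b (g (f b))) = (\<Sum>c\<in>C. coord C c (f (g c)))"
proof -
  have 1: "coord B b (g (f b)) = (\<Sum>c\<in>C. coord C c (f b) * coord B b (g c))" if "b \<in> B" for b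
  proof -
    have "g (f b) = g (\<Sum>c\<in>C. coord C c (f b) *\<^sub>R c)"
      using coord_expand[OF C f[OF that]] by simp
    then show ?thesis
      by (simp add: linear_sum[OF lg] linear_scale[OF lg] linear_sum[OF linear_coord[OF B(2)]]
          linear_scale[OF linear_coord[OF B(2)]])
  qed
  have 2: "coord C c (f (g c)) = (\<Sum>b\<in>B. coord C c (f b) * coord B b (g c))" if "c \<in> C" for c
  proof -
    have "f (g c) = f (\<Sum>b\<in>B. coord B b (g c) *\<^sub>R b)"
      using coord_expand[OF B g[OF that]] by simp
    then show ?thesis
      by (simp add: linear_sum[OF lf] linear_scale[OF lf] linear_sum[OF linear_coord[OF C(2)]]
          linear_scale[OF linear_coord[OF C(2)]] mult.commute)
  qed
  show ?thesis by (simp add: 1 2) (rule sum.swap)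
qed

lemma trace_on_basis:
  assumes B: "finite B" "independent B" "span B = V" and f: "linear f" "\<And>v. v \<in> V \<Longrightarrow> f v \<in> V"
  shows "trace_on V f = (\<Sum>b\<in>B. coord B b (f b))"
proof -
  define C where "C = (SOME B. finite B \<and> independent B \<and> span B = V)"
  have C: "finite C \<and> independent C \<and> span C = V"
    unfolding C_def by (rule someI[of _ B]) (use B in auto)
  have "trace_on V f = (\<Sum>c\<in>C. coord C c (f c))"
    unfolding trace_on_def C_def[symmetric] by simp
  also have "\<dots> = (\<Sum>b\<in>B. coord B b (f b))"
  proof -
    have "(\<Sum>c\<in>C. coord C c (id (f c))) = (\<Sum>b\<in>B. coord B b (f (id b)))"
      by (rule trace_exchange[OF _ _ _ _ _ _ f(1) linear_id])
        (use B C f(2) span_superset[of B] span_superset[of C] in auto)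
    then show ?thesis by simp
  qed
  finally show ?thesis .
qed

lemma trace_on_formula:
  assumes "fin_dim_subspace V"
  obtains B where "finite B" "independent B" "span B = V" "\<And>f. trace_on V f = (\<Sum>b\<in>B. coord B b (f b))"
proof -
  define C where "C = (SOME B. finite B \<and> independent B \<and> span B = V)"
  have "finite C \<and> independent C \<and> span C = V"
    unfolding C_def by (rule someI_ex) (metis finite_basis[OF assms(1)])
  moreover have "trace_on V f = (\<Sum>b\<in>C. coord C b (f b))" for f
    unfolding trace_on_def C_def[symmetric] Let_def ..
  ultimately show thesis using that by blast
qed

lemma trace_on_cong:
  assumes "fin_dim_subspace V" "\<And>v. v \<in> V \<Longrightarrow> f v = g v"
  shows "trace_on V f = trace_on V g"
proof -
  obtain B where B: "span B = V" "\<And>f. trace_on V f = (\<Sum>b\<in>B. coord B b (f b))"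
    using trace_on_formula[OF assms(1)] by metis
  show ?thesis unfolding B(2)
    by (rule sum.cong) (use B(1) assms(2) span_superset[of B] in auto)
qed

lemma trace_on_add:
  assumes "fin_dim_subspace V"
  shows "trace_on V (\<lambda>v. f v + g v) = trace_on V f + trace_on V g"
  by (rule trace_on_formula[OF assms]) (simp add: linear_add[OF linear_coord] sum.distrib)

lemma trace_on_scale:
  assumes "fin_dim_subspace V"
  shows "trace_on V (\<lambda>v. c *\<^sub>R f v) = c * trace_on V f"
  by (rule trace_on_formula[OF assms]) (simp add: linear_scale[OF linear_coord] sum_distrib_left)

lemma trace_on_minus: "fin_dim_subspace V \<Longrightarrow> trace_on V (\<lambda>v. - f v) = - trace_on V f"
  using trace_on_scale[of V "- 1"] by simp

lemma trace_on_diff: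
  "fin_dim_subspace V \<Longrightarrow> trace_on V (\<lambda>v. f v - g v) = trace_on V f - trace_on V g"
  using trace_on_add[of V f "\<lambda>v. - g v"] by (simp add: trace_on_minus)

lemma trace_on_zero: "fin_dim_subspace V \<Longrightarrow> trace_on V (\<lambda>v. 0) = 0"
  using trace_on_scale[of V 0 "\<lambda>v. 0"] by simp

lemma trace_on_cyclic:
  assumes V: "fin_dim_subspace V" and W: "fin_dim_subspace W"
    and f: "linear f" "\<And>v. v \<in> V \<Longrightarrow> f v \<in> W" and g: "linear g" "\<And>w. w \<in> W \<Longrightarrow> g w \<in> V"
  shows "trace_on V (\<lambda>v. g (f v)) = trace_on W (\<lambda>w. f (g w))"
proof -
  obtain B where B: "finite B" "independent B" "span B = V" using finite_basis[OF V] by metis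
  obtain C where C: "finite C" "independent C" "span C = W" using finite_basis[OF W] by metis
  have l: "linear (\<lambda>v. g (f v))" "linear (\<lambda>v. f (g v))"
    using linear_compose[OF f(1) g(1)] linear_compose[OF g(1) f(1)] by (simp_all add: o_def)
  have "trace_on V (\<lambda>v. g (f v)) = (\<Sum>b\<in>B. coord B b (g (f b)))"
    by (rule trace_on_basis[OF B l(1)]) (use f g in auto)
  also have "\<dots> = (\<Sum>c\<in>C. coord C c (f (g c)))"
    by (rule trace_exchange) (use B C f g in \<open>auto intro: span_base\<close>)
  also have "\<dots> = trace_on W (\<lambda>w. f (g w))"
    by (rule trace_on_basis[OF C l(2), symmetric]) (use f g in auto)
  finally show ?thesis .
qed

lemma trace_on_range:
  assumes V: "fin_dim_subspace V" and W: "subspace W" "W \<subseteq> V"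
    and f: "linear f" "\<And>v. v \<in> V \<Longrightarrow> f v \<in> W"
  shows "trace_on V f = trace_on W f"
  using trace_on_cyclic[OF V fin_dim_subspace_subset[OF V W] f linear_id] subsetD[OF W(2)]
  unfolding id_apply by blast

lemma trace_on_eigenbasis:
  assumes B: "finite B" "independent B" "span B = V" and f: "linear f"
    and ev: "\<And>b. b \<in> B \<Longrightarrow> f b = ev b *\<^sub>R b"
  shows "trace_on V f = (\<Sum>b\<in>B. ev b)"
proof -
  have "f v \<in> V" if "v \<in> V" for v
  proof -
    have "f ` B \<subseteq> span B" using ev by (auto intro: span_scale span_base)
    then have "span (f ` B) \<subseteq> V" using B(3) span_minimal subspace_span by blast
    then show ?thesis using that B(3) linear_span_image[OF f, of B] by auto
  qed
  then show ?thesis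
    by (simp add: trace_on_basis[OF B f] ev linear_scale[OF linear_coord[OF B(2)]] coord_basis[OF B(2)])
qed

text \<open>A nilpotent endomorphism has a proper image, and its trace is the trace of its restriction to this image;
so induction on the dimension applies.\<close>
lemma trace_on_locally_nilpotent:
  assumes "fin_dim_subspace V" "linear f" "\<And>v. v \<in> V \<Longrightarrow> f v \<in> V"
    and "\<And>v. v \<in> V \<Longrightarrow> \<exists>m. (f ^^ m) v = 0"
  shows "trace_on V f = 0"
  using assms
proof (induction "dim V" arbitrary: V rule: less_induct)
  case less
  note fd = less.prems(1) and f = less.prems(2,3) and nil = less.prems(4)
  show ?case
  proof (cases "V \<subseteq> {0}")
    case True
    then have "trace_on V f = trace_on V (\<lambda>v. 0 *\<^sub>R f v)"
      using linear_0[OF f(1)] by (intro trace_on_cong[OF fd]) auto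
    then show ?thesis using trace_on_zero[OF fd] by simp
  next
    case False
    let ?W = "f ` V"
    have W: "subspace ?W" "?W \<subseteq> V"
      using f linear_subspace_image[OF f(1) fin_dim_subspaceD[OF fd]] by auto
    have fdW: "fin_dim_subspace ?W" using fin_dim_subspace_subset[OF fd W] .
    \<comment> \<open>If the image were everything, all powers would be onto, but some power vanishes on a finite basis.\<close>
    have "?W \<noteq> V"
    proof
      assume "?W = V"
      obtain v where v: "v \<in> V" "v \<noteq> 0" using False by blast
      have surj: "(f ^^ m) ` V = V" for m
        by (induction m) (use \<open>f ` V = V\<close> in \<open>simp_all flip: image_image\<close>)
      obtain B where B: "finite B" "span B = V" using finite_basis[OF fd] by metis
      define m where "m b = (SOME m. (f ^^ m) b = 0)" for b
      have m: "(f ^^ m b) b = 0" if "b \<in> B" for b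
        unfolding m_def by (rule someI_ex) (use nil[of b] that B span_superset[of B] in auto)
      have lp: "linear (f ^^ n)" for n
      proof (induction n)
        case (Suc n)
        then show ?case using linear_compose[OF Suc f(1)] by (simp add: o_def)
      qed (use linear_id in \<open>simp add: id_def\<close>)
      define M where "M = Max (m ` B)"
      have "(f ^^ M) b = 0" if "b \<in> B" for b
      proof -
        have "m b \<le> M" unfolding M_def using that B by auto
        then have "f ^^ M = f ^^ (M - m b) \<circ> f ^^ m b" by (simp flip: funpow_add)
        then show ?thesis using m[OF that] linear_0[OF lp] by simp
      qed
      then have "(f ^^ M) u = 0" if "u \<in> V" for u
        using linear_eq_0_on_span[OF lp, of B M u] that B(2) by simp
      then have "(f ^^ M) ` V \<subseteq> {0}" by auto
      then show False using surj[of M] v by auto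
    qed
    then have "dim ?W < dim V"
      using subspace_eq_of_dim_le[OF fd W] by force
    then have "trace_on ?W f = 0"
      by (rule less.hyps[OF _ fdW f(1)]) (use f nil in auto)
    then show ?thesis using trace_on_range[OF fd W f(1)] by auto
  qed
qed

section \<open>Generalised eigenspaces in the complexification\<close>

text \<open>The complexification of a real vector space is the space of pairs \<open>(u, v)\<close>, read as \<open>u + iv\<close>. It is treated as a
real vector space with the operator \<open>rot\<close> as multiplication by \<open>i\<close>; so real traces and real spans
remain the only notions of linear algebra in play.\<close>
definition rot :: "'a::real_vector \<times> 'a \<Rightarrow> 'a \<times> 'a" where
  "rot w = (- snd w, fst w)"

definition cscale :: "complex \<Rightarrow> 'a::real_vector \<times> 'a \<Rightarrow> 'a \<times> 'a" where
  "cscale c w = Re c *\<^sub>R w + Im c *\<^sub>R rot w"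

lemma cscale_fst [simp]: "fst (cscale c w) = Re c *\<^sub>R fst w - Im c *\<^sub>R snd w"
  and cscale_snd [simp]: "snd (cscale c w) = Re c *\<^sub>R snd w + Im c *\<^sub>R fst w"
  by (simp_all add: cscale_def rot_def)

lemma cscale_0 [simp]: "cscale 0 w = 0"
  and cscale_1 [simp]: "cscale 1 w = w"
  and cscale_mult: "cscale c (cscale d w) = cscale (c * d) w"
  and cscale_add_left: "cscale (c + d) w = cscale c w + cscale d w"
  and cscale_diff_left: "cscale (c - d) w = cscale c w - cscale d w"
  and cscale_add_right: "cscale c (w + w') = cscale c w + cscale c w'"
  and cscale_diff_right: "cscale c (w - w') = cscale c w - cscale c w'"
  and cscale_scaleR: "cscale c (r *\<^sub>R w) = r *\<^sub>R cscale c w"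
  and cscale_zero_right [simp]: "cscale c 0 = 0"
  and cscale_of_real: "cscale (complex_of_real r) w = r *\<^sub>R w"
  by (simp_all add: prod_eq_iff algebra_simps)

lemma rot_eq_cscale: "rot w = cscale \<i> w"
  by (simp add: cscale_def)

lemma linear_cscale: "linear (cscale c)"
  by (rule linearI) (simp_all add: cscale_add_right cscale_scaleR)

lemma cscale_eq_0_iff: "cscale c w = 0 \<longleftrightarrow> c = 0 \<or> w = 0"
proof
  assume a: "cscale c w = 0"
  show "c = 0 \<or> w = 0"
  proof (rule disjCI)
    assume "w \<noteq> 0"
    have "c \<noteq> 0 \<Longrightarrow> w = cscale (inverse c) (cscale c w)" by (simp add: cscale_mult)
    then show "c = 0" using a \<open>w \<noteq> 0\<close> by auto
  qed
qed auto

definition complex_linear :: "('a::real_vector \<times> 'a \<Rightarrow> 'a \<times> 'a) \<Rightarrow> bool" where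
  "complex_linear F \<longleftrightarrow> linear F \<and> (\<forall>w. F (rot w) = rot (F w))"

lemma complex_linearD: "complex_linear F \<Longrightarrow> linear F"
  by (simp add: complex_linear_def)

lemma complex_linear_rot: "complex_linear F \<Longrightarrow> F (rot w) = rot (F w)"
  by (simp add: complex_linear_def del: split_paired_All)

lemma complex_linear_cscale: "complex_linear F \<Longrightarrow> F (cscale c w) = cscale c (F w)"
  unfolding complex_linear_def cscale_def by (simp add: linear_add linear_scale del: split_paired_All)

definition shift :: "('a::real_vector \<times> 'a \<Rightarrow> 'a \<times> 'a) \<Rightarrow> complex \<Rightarrow> 'a \<times> 'a \<Rightarrow> 'a \<times> 'a" where
  "shift F l w = F w - cscale l w"

definition gen_eigenspace :: "('a::real_vector \<times> 'a \<Rightarrow> 'a \<times> 'a) \<Rightarrow> complex \<Rightarrow> ('a \<times> 'a) set" where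
  "gen_eigenspace F l = {w. \<exists>m. (shift F l ^^ m) w = 0}"

lemma linear_funpow: "linear f \<Longrightarrow> linear (f ^^ n)" for f :: "'b::real_vector \<Rightarrow> 'b"
proof (induction n)
  case (Suc n)
  then show ?case using linear_compose[OF Suc.IH[OF Suc.prems] Suc.prems] by (simp add: o_def)
qed (use linear_id in \<open>simp add: id_def\<close>)

lemma funpow_zero_mono:
  fixes f :: "'b::real_vector \<Rightarrow> 'b"
  assumes "linear f" "(f ^^ m) w = 0" "m \<le> n"
  shows "(f ^^ n) w = 0"
proof -
  have "f ^^ n = f ^^ (n - m) \<circ> f ^^ m" using assms(3) by (simp flip: funpow_add)
  then show ?thesis using assms linear_0[OF linear_funpow] by simp
qed

text \<open>Generalised eigenspaces are instances of this, and so is the set on which a nilpotency claim has to be verified: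
it suffices to check a spanning set.\<close>
lemma subspace_locally_nilpotent:
  fixes f :: "'b::real_vector \<Rightarrow> 'b"
  assumes "linear f"
  shows "subspace {w. \<exists>m. (f ^^ m) w = 0}"
proof -
  note l = linear_funpow[OF assms]
  have "\<exists>m. (f ^^ m) (x + y) = 0" if "(f ^^ a) x = 0" "(f ^^ b) y = 0" for x y a b
    using funpow_zero_mono[OF assms that(1), of "max a b"] funpow_zero_mono[OF assms that(2), of "max a b"]
    by (intro exI[of _ "max a b"]) (simp add: linear_add[OF l])
  then show ?thesis
    unfolding subspace_def using linear_0[OF l] linear_scale[OF l] by (auto intro: exI[of _ 0]) 
qed

context
  fixes F :: "'a::real_vector \<times> 'a \<Rightarrow> 'a \<times> 'a"
  assumes F: "complex_linear F"
begin

lemma linear_shift: "linear (shift F l)"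
  unfolding shift_def [abs_def] by (intro linear_compose_sub complex_linearD[OF F] linear_cscale)

lemma subspace_gen_eigenspace: "subspace (gen_eigenspace F l)"
  unfolding gen_eigenspace_def by (rule subspace_locally_nilpotent[OF linear_shift])

lemma shift_cscale: "shift F l (cscale c w) = cscale c (shift F l w)"
  by (simp add: shift_def complex_linear_cscale[OF F] cscale_mult cscale_diff_right mult.commute)

lemma funpow_shift_cscale: "(shift F l ^^ n) (cscale c w) = cscale c ((shift F l ^^ n) w)"
  by (induction n) (simp_all add: shift_cscale)

lemma cscale_gen_eigenspace: "w \<in> gen_eigenspace F l \<Longrightarrow> cscale c w \<in> gen_eigenspace F l"
  by (auto simp: gen_eigenspace_def funpow_shift_cscale) (metis cscale_zero_right)

lemma shift_commute: "shift F l (shift F m w) = shift F m (shift F l w)"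
  by (simp add: shift_def linear_diff[OF complex_linearD[OF F]] complex_linear_cscale[OF F]
      cscale_diff_right cscale_mult mult.commute)

lemma funpow_shift_commute: "(shift F l ^^ n) (shift F m w) = shift F m ((shift F l ^^ n) w)"
  by (induction n) (simp_all add: shift_commute)

lemma shift_gen_eigenspace: "w \<in> gen_eigenspace F l \<Longrightarrow> shift F m w \<in> gen_eigenspace F l"
  unfolding gen_eigenspace_def
  by clarify (metis funpow_shift_commute linear_0[OF linear_shift])

lemma funpow_shift_gen_eigenspace:
  "w \<in> gen_eigenspace F l \<Longrightarrow> (shift F m ^^ n) w \<in> gen_eigenspace F l"
  by (induction n) (simp_all add: shift_gen_eigenspace)

lemma gen_eigenspace_shiftD: "shift F l w \<in> gen_eigenspace F l \<Longrightarrow> w \<in> gen_eigenspace F l"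
  unfolding gen_eigenspace_def by (auto simp: funpow_swap1) (metis funpow_simps_right(2) o_apply)

text \<open>A non-zero common element would, after applying a power of \<open>F - l\<close>, give an eigenvector for \<open>l\<close>, on which
\<open>F - m\<close> acts as the invertible scalar \<open>l - m\<close>.\<close>
lemma gen_eigenspace_disjoint:
  assumes "w \<in> gen_eigenspace F l" "w \<in> gen_eigenspace F m" "l \<noteq> m"
  shows "w = 0"
proof -
  obtain k where "(shift F l ^^ k) w = 0" using assms by (auto simp: gen_eigenspace_def)
  then show ?thesis using assms(2)
  proof (induction k arbitrary: w)
    case (Suc k)
    have "shift F l w = 0"
      using Suc.IH[of "shift F l w"] Suc.prems shift_gen_eigenspace
      by (simp add: funpow_swap1)
    then have ev: "shift F m w = cscale (l - m) w"
      by (simp add: shift_def cscale_diff_left)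
    have pow: "(shift F m ^^ n) w = cscale ((l - m) ^ n) w" for n
      by (induction n) (simp_all add: shift_cscale ev cscale_mult mult.commute)
    obtain n where "(shift F m ^^ n) w = 0" using Suc.prems by (auto simp: gen_eigenspace_def)
    then show ?case using pow assms(3) by (simp add: cscale_eq_0_iff)
  qed simp
qed

text \<open>A power of \<open>F - m\<close> removes the summand of one eigenvalue and keeps the others in their eigenspaces, so
induction on the number of eigenvalues applies.\<close>
lemma gen_eigenspace_independent:
  assumes "finite L" "\<And>l. l \<in> L \<Longrightarrow> w l \<in> gen_eigenspace F l" "(\<Sum>l\<in>L. w l) = 0"
  shows "\<forall>l\<in>L. w l = 0"
  using assms
proof (induction L arbitrary: w rule: finite_induct)
  case (insert m L)
  obtain k where k: "(shift F m ^^ k) (w m) = 0"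
    using insert.prems(1)[of m] by (auto simp: gen_eigenspace_def)
  note l = linear_funpow[OF linear_shift]
  have "(\<Sum>l\<in>L. (shift F m ^^ k) (w l)) = 0"
    using arg_cong[OF insert.prems(2), of "shift F m ^^ k"] insert.hyps k
    by (simp add: linear_add[OF l] linear_sum[OF l] linear_0[OF l])
  then have "\<forall>l\<in>L. (shift F m ^^ k) (w l) = 0"
    by (intro insert.IH) (use insert.prems funpow_shift_gen_eigenspace in auto)
  then have "\<forall>l\<in>L. w l = 0"
    using gen_eigenspace_disjoint insert.prems(1) insert.hyps(2)
    by (smt (verit, best) gen_eigenspace_def insertCI mem_Collect_eq)
  then show ?case using insert.prems(2) insert.hyps by simp
qed simp

definition poly_apply :: "complex poly \<Rightarrow> 'a \<times> 'a \<Rightarrow> 'a \<times> 'a" where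
  "poly_apply p w = (\<Sum>i\<le>degree p. cscale (coeff p i) ((F ^^ i) w))"

lemma poly_apply_bound:
  "degree p \<le> N \<Longrightarrow> poly_apply p w = (\<Sum>i\<le>N. cscale (coeff p i) ((F ^^ i) w))"
  unfolding poly_apply_def by (rule sum.mono_neutral_left) (auto simp: coeff_eq_0)

lemma poly_apply_linear_factor:
  "poly_apply ([:- r, 1:] * q) w = poly_apply q (shift F r w)"
proof -
  let ?N = "degree q"
  note l = linear_funpow[OF complex_linearD[OF F]]
  have c: "complex_linear (F ^^ i)" for i
  proof -
    have "(F ^^ i) (rot w) = rot ((F ^^ i) w)" for w
      by (induction i) (simp_all add: complex_linear_rot[OF F])
    then show ?thesis using l by (simp add: complex_linear_def)
  qed
  have "degree ([:- r, 1:] * q) \<le> Suc ?N"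
    by (rule order_trans[OF degree_mult_le]) simp
  then have "poly_apply ([:- r, 1:] * q) w
      = (\<Sum>i\<le>Suc ?N. cscale (coeff (pCons 0 q - smult r q) i) ((F ^^ i) w))"
    by (subst poly_apply_bound) (simp_all add: add.commute del: sum.atMost_Suc)
  also have "\<dots> = (\<Sum>i\<le>Suc ?N. cscale (coeff (pCons 0 q) i) ((F ^^ i) w))
      - (\<Sum>i\<le>Suc ?N. cscale (r * coeff q i) ((F ^^ i) w))"
    by (simp add: cscale_diff_left sum_subtractf del: sum.atMost_Suc)
  also have "(\<Sum>i\<le>Suc ?N. cscale (coeff (pCons 0 q) i) ((F ^^ i) w))
      = (\<Sum>i\<le>?N. cscale (coeff q i) ((F ^^ Suc i) w))"
    by (subst sum.atMost_Suc_shift) simp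
  also have "(\<Sum>i\<le>Suc ?N. cscale (r * coeff q i) ((F ^^ i) w))
      = (\<Sum>i\<le>?N. cscale (r * coeff q i) ((F ^^ i) w))"
    by (simp add: coeff_eq_0)
  finally show ?thesis
    by (simp add: poly_apply_def shift_def linear_diff[OF l] complex_linear_cscale[OF c]
        cscale_diff_right sum_subtractf cscale_mult mult.commute funpow_swap1)
qed

context
  fixes E :: "('a \<times> 'a) set"
  assumes E: "subspace E" and FE: "\<And>w. w \<in> E \<Longrightarrow> F w \<in> E" and rotE: "\<And>w. w \<in> E \<Longrightarrow> rot w \<in> E"
begin

lemma cscale_closed: "w \<in> E \<Longrightarrow> cscale c w \<in> E"
  unfolding cscale_def by (intro subspace_add[OF E] subspace_scale[OF E] rotE)

lemma shift_closed: "w \<in> E \<Longrightarrow> shift F l w \<in> E"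
  unfolding shift_def by (intro subspace_diff[OF E] FE cscale_closed)

text \<open>On the generalised eigenspace for \<open>l\<close> the operator \<open>F - m\<close> is the non-zero scalar \<open>l - m\<close> plus a nilpotent
operator. The preimage is the geometric series, summed by induction on the nilpotency exponent.\<close>
lemma shift_surj_on_gen_eigenspace:
  assumes "l \<noteq> m" "u \<in> gen_eigenspace F l" "u \<in> E"
  shows "\<exists>u'\<in>gen_eigenspace F l \<inter> E. shift F m u' = u"
proof -
  obtain k where "(shift F l ^^ k) u = 0" using assms by (auto simp: gen_eigenspace_def)
  then show ?thesis using assms(2,3)
  proof (induction k arbitrary: u)
    case 0
    then show ?case using linear_0[OF linear_shift] subspace_0[OF E] subspace_0[OF subspace_gen_eigenspace]
      by (intro bexI[of _ 0]) auto
  next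
    case (Suc k)
    let ?c = "inverse (l - m)"
    define r where "r = - cscale ?c (shift F l u)"
    have "(shift F l ^^ k) r = 0"
      using Suc.prems(1)
      by (simp add: r_def linear_neg[OF linear_funpow[OF linear_shift]] funpow_shift_cscale funpow_swap1)
    moreover have "r \<in> gen_eigenspace F l" "r \<in> E"
      unfolding r_def using Suc.prems
      by (auto intro!: subspace_neg[OF E] subspace_neg[OF subspace_gen_eigenspace] cscale_gen_eigenspace
          cscale_closed shift_closed shift_gen_eigenspace)
    ultimately obtain r' where r': "r' \<in> gen_eigenspace F l \<inter> E" "shift F m r' = r"
      using Suc.IH by blast
    have "shift F m (cscale ?c u) = cscale ?c (shift F l u + cscale (l - m) u)"
      by (simp add: shift_cscale) (simp add: shift_def cscale_diff_left)
    also have "\<dots> = u - r"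
      using assms(1) by (simp add: r_def cscale_add_right cscale_mult)
    finally have "shift F m (cscale ?c u + r') = u"
      using r' by (simp add: linear_add[OF linear_shift])
    moreover have "cscale ?c u + r' \<in> gen_eigenspace F l \<inter> E"
      using Suc.prems r' by (auto intro!: subspace_add[OF E] subspace_add[OF subspace_gen_eigenspace]
          cscale_gen_eigenspace cscale_closed)
    ultimately show ?case by blast
  qed
qed

text \<open>This is the step that strips one linear factor off an annihilating polynomial. Up to an element of the
generalised eigenspace for \<open>m\<close>, every vector of the span is of the form \<open>(F - m) u'\<close> with \<open>u'\<close> in the span.
Applied to \<open>(F - m) w\<close>, this puts \<open>w - u'\<close> into the generalised eigenspace for \<open>m\<close>.\<close>
lemma span_gen_eigenspaces_shiftD:
  assumes w: "w \<in> E" and s: "shift F m w \<in> span (\<Union>l. gen_eigenspace F l \<inter> E)" (is "_ \<in> span ?X")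
  shows "w \<in> span ?X"
proof -
  have "\<exists>u'\<in>span ?X. v - shift F m u' \<in> gen_eigenspace F m \<inter> E" if "v \<in> span ?X" for v
    using that
  proof (induction rule: span_induct_alt)
    case base
    then show ?case using linear_0[OF linear_shift] subspace_0[OF E] subspace_0[OF subspace_gen_eigenspace]
      by (intro bexI[of _ 0]) (auto intro: span_zero)
  next
    case (step c x y)
    obtain u' where u': "u' \<in> span ?X" "y - shift F m u' \<in> gen_eigenspace F m \<inter> E"
      using step by blast
    obtain l where l: "x \<in> gen_eigenspace F l \<inter> E" using step by blast
    obtain x' where x': "x' \<in> span ?X" "x - shift F m x' \<in> gen_eigenspace F m \<inter> E"
    proof (cases "l = m")
      case True
      then show thesis using that[of 0] l by (auto simp: linear_0[OF linear_shift] intro: span_zero)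
    next
      case False
      then obtain x' where "x' \<in> gen_eigenspace F l \<inter> E" "shift F m x' = x"
        using shift_surj_on_gen_eigenspace l by blast
      then show thesis using that[of x'] subspace_0[OF E] subspace_0[OF subspace_gen_eigenspace]
        by (auto intro: span_base)
    qed
    have "c *\<^sub>R x + y - shift F m (c *\<^sub>R x' + u') = c *\<^sub>R (x - shift F m x') + (y - shift F m u')"
      by (simp add: linear_add[OF linear_shift] linear_scale[OF linear_shift] algebra_simps)
    also have "\<dots> \<in> gen_eigenspace F m \<inter> E"
      using x' u' by (auto intro!: subspace_add subspace_scale E subspace_gen_eigenspace)
    finally show ?case using x' u' by (intro bexI[of _ "c *\<^sub>R x' + u'"]) (auto intro: span_add span_scale)
  qed
  from this[OF s] obtain u' where u': "u' \<in> span ?X" "shift F m w - shift F m u' \<in> gen_eigenspace F m \<inter> E"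
    by blast
  have "u' \<in> E" using u'(1) span_minimal[OF _ E, of ?X] by auto
  then have "w - u' \<in> ?X"
    using gen_eigenspace_shiftD[of m "w - u'"] u' w subspace_diff[OF E]
    by (auto simp: linear_diff[OF linear_shift])
  then have "(w - u') + u' \<in> span ?X" using u' by (intro span_add) (auto intro: span_base)
  then show ?thesis by simp
qed

lemma annihilated_in_span_gen_eigenspaces:
  assumes "p \<noteq> 0" "w \<in> E" "poly_apply p w = 0"
  shows "w \<in> span (\<Union>l. gen_eigenspace F l \<inter> E)"
  using assms
proof (induction "degree p" arbitrary: p w)
  case 0
  then obtain c where "p = [:c:]" "c \<noteq> 0" by (metis degree_eq_zeroE pCons_0_0)
  then have "w = 0" using 0 by (simp add: poly_apply_def cscale_eq_0_iff)
  then show ?case by (simp add: span_zero)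
next
  case (Suc n)
  have "\<not> constant (poly p)"
    using Suc.hyps(2) by (simp add: constant_degree)
  then obtain r where "poly p r = 0" using fundamental_theorem_of_algebra by blast
  then obtain q where q: "p = [:- r, 1:] * q" by (metis poly_eq_0_iff_dvd dvdE)
  have "q \<noteq> 0" using q Suc.prems by auto
  then have "degree p = Suc (degree q)" unfolding q by (subst degree_mult_eq) auto
  then have "shift F r w \<in> span (\<Union>l. gen_eigenspace F l \<inter> E)"
    using Suc \<open>q \<noteq> 0\<close> shift_closed poly_apply_linear_factor q by auto
  then show ?case using span_gen_eigenspaces_shiftD Suc.prems by blast
qed

text \<open>Every vector is annihilated by a non-zero polynomial in \<open>F\<close>, which splits over the complex numbers.\<close>
lemma span_gen_eigenspaces:
  assumes fd: "fin_dim_subspace E"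
  shows "E = span (\<Union>l. gen_eigenspace F l \<inter> E)"
proof
  show "span (\<Union>l. gen_eigenspace F l \<inter> E) \<subseteq> E" by (rule span_minimal[OF _ E]) auto
  show "E \<subseteq> span (\<Union>l. gen_eigenspace F l \<inter> E)"
  proof
    fix w assume w: "w \<in> E"
    have pE: "(F ^^ i) w \<in> E" for i by (induction i) (use w FE in auto)
    let ?n = "dim E"
    \<comment> \<open>More iterates than the dimension allows: either two of them coincide or they are linearly dependent.\<close>
    obtain c :: "nat \<Rightarrow> real" and j where c: "(\<Sum>i\<le>?n. c i *\<^sub>R (F ^^ i) w) = 0" and j: "j \<le> ?n" "c j \<noteq> 0"
    proof (cases "inj_on (\<lambda>i. (F ^^ i) w) {..?n}")
      case True
      let ?A = "(\<lambda>i. (F ^^ i) w) ` {..?n}"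
      have "\<not> independent ?A"
        using independent_imp_finite_card_le_dim[OF fd, of ?A] pE card_image[OF True] by auto
      then obtain u v where u: "v \<in> ?A" "u v \<noteq> 0" "(\<Sum>v\<in>?A. u v *\<^sub>R v) = 0"
        using dependent_finite[of ?A] by blast
      then have "(\<Sum>i\<le>?n. u ((F ^^ i) w) *\<^sub>R (F ^^ i) w) = 0"
        by (simp add: sum.reindex[OF True])
      then show thesis using that[of "\<lambda>i. u ((F ^^ i) w)"] u by auto
    next
      case False
      then obtain i k where ik: "i \<le> ?n" "k \<le> ?n" "i \<noteq> k" "(F ^^ i) w = (F ^^ k) w"
        by (auto simp: inj_on_def)
      define c where "c j = (if j = i then 1 else if j = k then - 1 else 0 :: real)" for j
      have "(\<Sum>j\<le>?n. c j *\<^sub>R (F ^^ j) w) = (\<Sum>j\<in>{i, k}. c j *\<^sub>R (F ^^ j) w)"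
        by (rule sum.mono_neutral_right) (use ik in \<open>auto simp: c_def\<close>)
      also have "\<dots> = 0" using ik by (simp add: c_def)
      finally show thesis using that[of c i] ik by (simp add: c_def)
    qed
    define p where "p = (\<Sum>i\<le>?n. monom (complex_of_real (c i)) i)"
    have co: "coeff p i = (if i \<le> ?n then complex_of_real (c i) else 0)" for i
      by (simp add: p_def coeff_sum)
    have "p \<noteq> 0" using co[of j] j by auto
    moreover have "poly_apply p w = 0"
      using c by (subst poly_apply_bound[of _ ?n]) (auto simp: co cscale_of_real intro!: degree_le)
    ultimately show "w \<in> span (\<Union>l. gen_eigenspace F l \<inter> E)"
      using annihilated_in_span_gen_eigenspaces w by blast
  qed
qed

text \<open>For any function \<open>g\<close> on the eigenvalues this is the operator that is the scalar \<open>g l\<close> on the generalised eigenspace for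
\<open>l\<close>. It is defined on a basis of generalised eigenvectors; independence of the eigenspaces makes it a scalar
on each of them.\<close>
lemma eigenvalue_function_of_operator:
  assumes fd: "fin_dim_subspace E"
  obtains Y where "linear Y" "\<And>l w. w \<in> gen_eigenspace F l \<Longrightarrow> w \<in> E \<Longrightarrow> Y w = cscale (g l) w"
proof -
  let ?X = "\<Union>l. gen_eigenspace F l \<inter> E"
  obtain B where B: "B \<subseteq> ?X" "finite B" "independent B" "span B = E"
    using basis_within[OF fd, of ?X] span_gen_eigenspaces[OF fd] by (metis UN_least inf_le2 order_refl)
  define ev where "ev b = (SOME l. b \<in> gen_eigenspace F l)" for b
  have ev: "b \<in> gen_eigenspace F (ev b)" if "b \<in> B" for b
    unfolding ev_def by (rule someI_ex) (use B that in auto)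
  define Y where "Y = construct B (\<lambda>b. cscale (g (ev b)) b)"
  have lY: "linear Y" unfolding Y_def by (rule linear_construct[OF B(3)])
  have "Y w = cscale (g l) w" if w: "w \<in> gen_eigenspace F l" "w \<in> E" for l w
  proof -
    let ?L = "insert l (ev ` B)"
    define G where "G m = (\<Sum>b | b \<in> B \<and> ev b = m. coord B b w *\<^sub>R b)" for m
    \<comment> \<open>\<open>G m\<close> is the component of \<open>w\<close> for the eigenvalue \<open>m\<close>.\<close>
    have sumG: "(\<Sum>m\<in>?L. G m) = w"
      unfolding G_def using sum.group[of B ?L ev "\<lambda>b. coord B b w *\<^sub>R b"] B(2) coord_expand[OF B(2,3)] B(4) w
      by auto
    have "G m \<in> gen_eigenspace F m" for m
      unfolding G_def by (rule subspace_sum[OF subspace_gen_eigenspace])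
        (use ev subspace_scale[OF subspace_gen_eigenspace] in auto)
    then have "\<forall>m\<in>?L. G m - (if m = l then w else 0) = 0"
      using w subspace_0[OF subspace_gen_eigenspace] B(2) sumG
      by (intro gen_eigenspace_independent)
        (auto intro!: subspace_diff[OF subspace_gen_eigenspace] simp: sum_subtractf simp del: sum.insert)
    then have G: "m \<in> ?L \<Longrightarrow> G m = (if m = l then w else 0)" for m by auto
    have "Y w = (\<Sum>b\<in>B. coord B b w *\<^sub>R cscale (g (ev b)) b)"
      using coord_expand[OF B(2,3), of w] B(4) w(2)
        linear_sum[OF lY, of "\<lambda>b. coord B b w *\<^sub>R b" B]
      by (simp add: linear_scale[OF lY]) (simp add: Y_def construct_basis[OF B(3)])
    also have "\<dots> = (\<Sum>m\<in>?L. \<Sum>b | b \<in> B \<and> ev b = m. coord B b w *\<^sub>R cscale (g (ev b)) b)"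
      by (rule sum.group[symmetric]) (use B(2) in auto)
    also have "\<dots> = (\<Sum>m\<in>?L. cscale (g m) (G m))"
      by (rule sum.cong) (auto simp: G_def linear_sum[OF linear_cscale] cscale_scaleR intro!: sum.cong)
    also have "\<dots> = (\<Sum>m\<in>?L. if m = l then cscale (g l) w else 0)"
      by (rule sum.cong) (auto simp: G)
    also have "\<dots> = cscale (g l) w"
      using B(2) by (simp del: sum.insert)
    finally show ?thesis .
  qed
  then show thesis using that lY by blast
qed

end

end

section \<open>The derivation of conjugate eigenvalues\<close>

text \<open>The two real summands of the complexification contribute equally, because \<open>H\<close> commutes with \<open>rot\<close>, which
interchanges them.\<close>
lemma trace_complexification:
  assumes V: "fin_dim_subspace V" and H: "linear H" "\<And>w. w \<in> V \<times> V \<Longrightarrow> H w \<in> V \<times> V"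
    and rot: "\<And>w. w \<in> V \<times> V \<Longrightarrow> H (rot w) = rot (H w)"
  shows "trace_on (V \<times> V) H = 2 * trace_on V (\<lambda>v. fst (H (v, 0)))"
proof -
  let ?E = "V \<times> V"
  have E: "fin_dim_subspace ?E" by (rule fin_dim_subspace_Times[OF V V])
  have 0: "0 \<in> V" using V fin_dim_subspaceD subspace_0 by blast
  have l: "linear (\<lambda>v. H (v, 0))" "linear (\<lambda>v. H (0, v))"
    by (rule linearI; simp flip: linear_add[OF H(1)] linear_scale[OF H(1)])+
  have fl: "linear (fst :: 'a \<times> 'a \<Rightarrow> 'a)" "linear (snd :: 'a \<times> 'a \<Rightarrow> 'a)"
    by (rule linearI; simp)+
  have 1: "trace_on ?E (\<lambda>w. H (fst w, 0)) = trace_on V (\<lambda>v. fst (H (v, 0)))"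
    by (rule trace_on_cyclic[OF E V fl(1) _ l(1)]) (use H 0 in auto)
  have "trace_on ?E (\<lambda>w. H (0, snd w)) = trace_on V (\<lambda>v. snd (H (0, v)))"
    by (rule trace_on_cyclic[OF E V fl(2) _ l(2)]) (use H 0 in auto)
  also have "\<dots> = trace_on V (\<lambda>v. fst (H (v, 0)))"
    by (rule trace_on_cong[OF V]) (use 0 rot[of "(_, 0)"] in \<open>auto simp: rot_def\<close>)
  finally have 2: "trace_on ?E (\<lambda>w. H (0, snd w)) = trace_on V (\<lambda>v. fst (H (v, 0)))" .
  have "trace_on ?E H = trace_on ?E (\<lambda>w. H (fst w, 0) + H (0, snd w))"
    by (rule trace_on_cong[OF E]) (simp flip: linear_add[OF H(1)])
  also have "\<dots> = trace_on ?E (\<lambda>w. H (fst w, 0)) + trace_on ?E (\<lambda>w. H (0, snd w))"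
    by (rule trace_on_add[OF E])
  finally show ?thesis using 1 2 by simp
qed

text \<open>Bilinearity, antisymmetry and the Jacobi identity are required on the whole type. A bracket given only on a
carrier extends to such a bracket by composition with a projection (\<open>lie_bracket_extension\<close>), and computations are
then free of membership conditions.\<close>
locale lie_bracket =
  fixes br :: "'a::real_vector \<Rightarrow> 'a \<Rightarrow> 'a"
  assumes br_add_left: "br (x + y) z = br x z + br y z"
    and br_add_right: "br z (x + y) = br z x + br z y"
    and br_scale_left: "br (c *\<^sub>R x) y = c *\<^sub>R br x y"
    and br_scale_right: "br x (c *\<^sub>R y) = c *\<^sub>R br x y"
    and br_self [simp]: "br x x = 0"
    and jacobi: "br x (br y z) + br y (br z x) + br z (br x y) = 0"
begin

lemma linear_br: "linear (br x)"
  by (rule linearI) (simp_all add: br_add_right br_scale_right)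

lemma linear_br_left: "linear (\<lambda>x. br x y)"
  by (rule linearI) (simp_all add: br_add_left br_scale_left)

lemmas br_simps = br_add_left br_add_right br_scale_left br_scale_right
  linear_0[OF linear_br] linear_0[OF linear_br_left] linear_neg[OF linear_br] linear_neg[OF linear_br_left]
  linear_diff[OF linear_br] linear_diff[OF linear_br_left]

lemma br_antisym: "br x y = - br y x"
proof -
  have "br (x + y) (x + y) = br x x + br x y + (br y x + br y y)"
    by (simp only: br_add_left br_add_right add_ac)
  then show ?thesis by (simp add: eq_neg_iff_add_eq_0)
qed

lemma br_br: "br x (br y z) = br (br x y) z + br y (br x z)"
proof -
  have "br y (br z x) = - br y (br x z)"
    by (subst br_antisym[of z x]) (rule linear_neg[OF linear_br])
  moreover have "br z (br x y) = - br (br x y) z" by (rule br_antisym)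
  ultimately show ?thesis using jacobi[of x y z] by (simp add: algebra_simps)
qed

lemma br_commutator: "br (br x y) z = br x (br y z) - br y (br x z)"
  using br_br[of x y z] by simp

definition complex_br :: "'a \<times> 'a \<Rightarrow> 'a \<times> 'a \<Rightarrow> 'a \<times> 'a" where
  "complex_br w w' = (br (fst w) (fst w') - br (snd w) (snd w'),
                      br (fst w) (snd w') + br (snd w) (fst w'))"

lemma complex_br_cscale:
  "complex_br (cscale c w) w' = cscale c (complex_br w w')"
  "complex_br w (cscale c w') = cscale c (complex_br w w')"
  by (simp_all add: complex_br_def prod_eq_iff br_simps algebra_simps)

lemma linear_complex_br: "linear (complex_br w)" "linear (\<lambda>w. complex_br w w')"
  by (rule linearI; simp add: complex_br_def prod_eq_iff br_simps algebra_simps)+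

definition derivation :: "('a \<Rightarrow> 'a) \<Rightarrow> bool" where
  "derivation T \<longleftrightarrow> linear T \<and> (\<forall>x y. T (br x y) = br (T x) y + br x (T y))"

lemma derivation_br: "derivation (br x)"
  unfolding derivation_def using linear_br br_br by blast

definition complexify :: "('a \<Rightarrow> 'a) \<Rightarrow> 'a \<times> 'a \<Rightarrow> 'a \<times> 'a" where
  "complexify T w = (T (fst w), T (snd w))"

lemma complex_linear_complexify:
  assumes "linear T" shows "complex_linear (complexify T)"
  unfolding complex_linear_def
  by (auto intro!: linearI simp: complexify_def rot_def linear_add[OF assms] linear_scale[OF assms]
      linear_neg[OF assms])

lemma funpow_complexify: "(complexify T ^^ n) (v, w) = ((T ^^ n) v, (T ^^ n) w)"
  by (induction n) (auto simp: complexify_def)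

context
  fixes T :: "'a \<Rightarrow> 'a"
  assumes T: "derivation T"
begin

lemma linear_derivation: "linear T" using T by (simp add: derivation_def)

lemma derivation_mult: "T (br x y) = br (T x) y + br x (T y)" using T by (simp add: derivation_def)

lemmas complex_linear_T = complex_linear_complexify[OF linear_derivation]

lemma shift_complex_br:
  "shift (complexify T) (l + m) (complex_br w w')
    = complex_br (shift (complexify T) l w) w' + complex_br w (shift (complexify T) m w')"
proof -
  have "complexify T (complex_br w w') = complex_br (complexify T w) w' + complex_br w (complexify T w')"
    by (simp add: complexify_def complex_br_def derivation_mult linear_diff[OF linear_derivation]
        linear_add[OF linear_derivation])
  then show ?thesis
    by (simp add: shift_def linear_diff[OF linear_complex_br(1)] linear_diff[OF linear_complex_br(2)]
        complex_br_cscale cscale_add_left)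
qed

text \<open>The Leibniz rule for the shifted operators distributes the powers of \<open>T - (l + m)\<close> over the two arguments.\<close>
lemma complex_br_gen_eigenspace:
  assumes "w \<in> gen_eigenspace (complexify T) l" "w' \<in> gen_eigenspace (complexify T) m"
  shows "complex_br w w' \<in> gen_eigenspace (complexify T) (l + m)"
proof -
  have "(shift (complexify T) (l + m) ^^ N) (complex_br w w') = 0"
    if "(shift (complexify T) l ^^ i) w = 0" "(shift (complexify T) m ^^ j) w' = 0" "i + j = N"
    for i j N using that
  proof (induction N arbitrary: i j w w')
    case 0
    then show ?case by (simp add: linear_0[OF linear_complex_br(1)])
  next
    case (Suc N)
    let ?s = "shift (complexify T)"
    note l = linear_funpow[OF linear_shift[OF complex_linear_T]]
    have "(?s (l + m) ^^ N) (complex_br (?s l w) w') = 0"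
    proof (cases i)
      case 0
      then show ?thesis using Suc.prems
        by (simp add: linear_0[OF linear_complex_br(2)] linear_0[OF linear_shift[OF complex_linear_T]] linear_0[OF l])
    next
      case (Suc k)
      then show ?thesis using Suc.prems Suc.IH[of k "?s l w" j w'] by (simp add: funpow_swap1)
    qed
    moreover have "(?s (l + m) ^^ N) (complex_br w (?s m w')) = 0"
    proof (cases j)
      case 0
      then show ?thesis using Suc.prems
        by (simp add: linear_0[OF linear_complex_br(1)] linear_0[OF linear_shift[OF complex_linear_T]] linear_0[OF l])
    next
      case (Suc k)
      then show ?thesis using Suc.prems Suc.IH[of i w k "?s m w'"] by (simp add: funpow_swap1)
    qed
    ultimately show ?case by (simp add: funpow_swap1 shift_complex_br linear_add[OF l])
  qed
  then show ?thesis using assms unfolding gen_eigenspace_def by blast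
qed

text \<open>Multiplication of the generalised eigenspace for \<open>\<lambda>\<close> by its complex conjugate is a derivation of the complexification because
conjugation is additive and the eigenspaces of a derivation multiply like a grading; it
preserves \<open>D\<close> because \<open>D\<close> has its own eigenspace decomposition. It detects nilpotency: the trace of its product
with \<open>T\<close> is the sum of the squared moduli of the eigenvalues.\<close>
lemma conjugate_derivation:
  assumes V: "fin_dim_subspace V" and TV: "\<And>v. v \<in> V \<Longrightarrow> T v \<in> V"
    and brV: "\<And>x y. x \<in> V \<Longrightarrow> y \<in> V \<Longrightarrow> br x y \<in> V"
    and D: "subspace D" "D \<subseteq> V" and TD: "\<And>v. v \<in> D \<Longrightarrow> T v \<in> D"
  shows "\<exists>y. linear y \<and> (\<forall>v\<in>V. y v \<in> V) \<and> (\<forall>v\<in>D. y v \<in> D) \<and>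
    (\<forall>u\<in>V. \<forall>v\<in>V. y (br u v) = br (y u) v + br u (y v)) \<and>
    (trace_on V (\<lambda>v. T (y v)) = 0 \<longrightarrow> (\<forall>v\<in>V. \<exists>m. (T ^^ m) v = 0))"
proof -
  let ?F = "complexify T" and ?E = "V \<times> V"
  let ?G = "gen_eigenspace ?F"
  note F = complex_linear_T
  have E: "fin_dim_subspace ?E" by (rule fin_dim_subspace_Times[OF V V])
  note sE = fin_dim_subspaceD[OF E]
  have sV: "subspace V" by (rule fin_dim_subspaceD[OF V])
  have FE: "w \<in> ?E \<Longrightarrow> ?F w \<in> ?E" for w using TV by (auto simp: complexify_def)
  have rotE: "w \<in> ?E \<Longrightarrow> rot w \<in> ?E" for w by (cases w) (simp add: rot_def subspace_neg[OF sV])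
  have csE: "w \<in> ?E \<Longrightarrow> cscale c w \<in> ?E" for c w by (rule cscale_closed[OF F sE FE rotE])
  have shE: "w \<in> ?E \<Longrightarrow> shift ?F l w \<in> ?E" for l w by (rule shift_closed[OF F sE FE rotE])
  let ?X = "\<Union>l. ?G l \<inter> ?E"
  have spanX: "?E = span ?X" by (rule span_gen_eigenspaces[OF F sE FE rotE E])
  obtain Y where Y: "linear Y" "\<And>l w. w \<in> ?G l \<Longrightarrow> w \<in> ?E \<Longrightarrow> Y w = cscale (cnj l) w"
    using eigenvalue_function_of_operator[OF F sE FE rotE E, of cnj] by blast
  have onE: "P w" if "w \<in> ?E" "subspace (Collect P)" "\<And>l w. w \<in> ?G l \<Longrightarrow> w \<in> ?E \<Longrightarrow> P w" for P w
  proof -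
    have "span ?X \<subseteq> Collect P" by (rule span_minimal) (use that in auto)
    then show ?thesis using that(1) spanX by auto
  qed
  have eqE: "f w = g w" if "w \<in> ?E" "linear f" "linear g" "\<And>l w. w \<in> ?G l \<Longrightarrow> w \<in> ?E \<Longrightarrow> f w = g w"
    for w and f g :: "'a \<times> 'a \<Rightarrow> 'a \<times> 'a"
    by (rule linear_eq_on[OF that(2,3), of w ?X]) (use that spanX in auto)
  have linvY: "linear Y \<Longrightarrow> subspace {w. Y w \<in> S}" if "subspace S" for S
    using linear_subspace_vimage[of Y S] that by (simp add: vimage_def)
  have YE: "Y w \<in> ?E" if "w \<in> ?E" for w
    using that by (rule onE) (use linvY[OF sE] Y csE in \<open>simp_all del: split_paired_All mem_Times_iff\<close>)
  have lrot: "linear rot"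
    using linear_cscale[of \<i>] by (simp add: rot_eq_cscale[abs_def])
  have Yrot: "Y (rot w) = rot (Y w)" if "w \<in> ?E" for w
    using that
  proof (rule eqE[where f = "\<lambda>w. Y (rot w)" and g = "\<lambda>w. rot (Y w)"])
    show "linear (\<lambda>w. Y (rot w))" "linear (\<lambda>w. rot (Y w))"
      using linear_compose[OF lrot Y(1)] linear_compose[OF Y(1) lrot] by (simp_all add: o_def)
    fix l w assume "w \<in> ?G l" "w \<in> ?E"
    then show "Y (rot w) = rot (Y w)"
      using Y(2)[OF cscale_gen_eigenspace[OF F] csE] Y(2)
      by (simp add: rot_eq_cscale cscale_mult mult.commute del: split_paired_All)
  qed
  have YD: "Y w \<in> D \<times> D" if "w \<in> D \<times> D" for w
  proof -
    have fdD: "fin_dim_subspace (D \<times> D)"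
      using fin_dim_subspace_subset[OF V D] by (intro fin_dim_subspace_Times)
    note sD = fin_dim_subspaceD[OF fdD]
    have FD: "w \<in> D \<times> D \<Longrightarrow> ?F w \<in> D \<times> D" for w using TD by (auto simp: complexify_def)
    have rotD: "w \<in> D \<times> D \<Longrightarrow> rot w \<in> D \<times> D" for w by (cases w) (simp add: rot_def subspace_neg[OF D(1)])
    have sp: "D \<times> D = span (\<Union>l. ?G l \<inter> D \<times> D)"
      by (rule span_gen_eigenspaces[OF F sD FD rotD fdD])
    have "span (\<Union>l. ?G l \<inter> D \<times> D) \<subseteq> {w. Y w \<in> D \<times> D}"
    proof (rule span_minimal[OF _ linvY[OF sD Y(1)]])
      show "(\<Union>l. ?G l \<inter> D \<times> D) \<subseteq> {w. Y w \<in> D \<times> D}"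
      proof clarify
        fix l a b assume ab: "(a, b) \<in> ?G l" "a \<in> D" "b \<in> D"
        then have "Y (a, b) = cscale (cnj l) (a, b)" using Y(2)[of "(a, b)" l] D(2) by auto
        then show "Y (a, b) \<in> D \<times> D" using cscale_closed[OF F sD FD rotD, of "(a, b)"] ab by auto
      qed
    qed
    then show ?thesis using that sp by auto
  qed
  have Yder: "Y (complex_br w w') = complex_br (Y w) w' + complex_br w (Y w')" if "w \<in> ?E" "w' \<in> ?E" for w w'
  proof (rule eqE[OF that(1)])
    show "linear (\<lambda>w. Y (complex_br w w'))"
      using linear_compose[OF linear_complex_br(2) Y(1)] by (simp add: o_def)
    show "linear (\<lambda>w. complex_br (Y w) w' + complex_br w (Y w'))"
      using linear_compose[OF Y(1) linear_complex_br(2)] linear_complex_br(2)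
      by (simp add: o_def linear_compose_add)
    fix l u assume u: "u \<in> ?G l" "u \<in> ?E"
    show "Y (complex_br u w') = complex_br (Y u) w' + complex_br u (Y w')"
    proof (rule eqE[OF that(2)])
      show "linear (\<lambda>w'. Y (complex_br u w'))"
        using linear_compose[OF linear_complex_br(1) Y(1)] by (simp add: o_def)
      show "linear (\<lambda>w'. complex_br (Y u) w' + complex_br u (Y w'))"
        using linear_compose[OF Y(1) linear_complex_br(1)] linear_complex_br(1)
        by (simp add: o_def linear_compose_add)
      fix m v assume v: "v \<in> ?G m" "v \<in> ?E"
      have "complex_br u v \<in> ?E"
        using u v brV subspace_add[OF sV] subspace_diff[OF sV] by (auto simp: complex_br_def)
      then show "Y (complex_br u v) = complex_br (Y u) v + complex_br u (Y v)"
        using Y(2)[OF complex_br_gen_eigenspace[OF u(1) v(1)]] Y(2)[OF u] Y(2)[OF v]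
        by (simp add: complex_br_cscale cscale_add_left)
    qed
  qed
  define y where "y v = fst (Y (v, 0))" for v
  have 0: "0 \<in> V" "0 \<in> D" using subspace_0 sV D by auto
  show ?thesis
  proof (intro exI[of _ y] conjI ballI impI)
    show "linear y"
      unfolding y_def by (rule linearI) (simp_all flip: fst_add fst_scaleR linear_add[OF Y(1)] linear_scale[OF Y(1)])
    show "v \<in> V \<Longrightarrow> y v \<in> V" for v using YE[of "(v, 0)"] 0 by (auto simp: y_def mem_Times_iff)
    show "v \<in> D \<Longrightarrow> y v \<in> D" for v using YD[of "(v, 0)"] 0 by (auto simp: y_def mem_Times_iff)
    show "y (br u v) = br (y u) v + br u (y v)" if "u \<in> V" "v \<in> V" for u v
      using Yder[of "(u, 0)" "(v, 0)"] that 0 by (simp add: y_def complex_br_def br_simps)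
    assume tr: "trace_on V (\<lambda>v. T (y v)) = 0"
    \<comment> \<open>\<open>H\<close> is compared with the operator \<open>M\<close> that is the scalar \<open>|l|\<^sup>2\<close> on each eigenspace: the difference is nilpotent, hence has trace \<open>0\<close>.\<close>
    define H where "H w = ?F (Y w)" for w
    have lH: "linear H"
      using linear_compose[OF Y(1) complex_linearD[OF F]] by (simp add: H_def[abs_def] o_def)
    have HE: "H w \<in> ?E" if "w \<in> ?E" for w unfolding H_def by (rule FE[OF YE[OF that]])
    have trH: "trace_on ?E H = 0"
    proof -
      have "trace_on ?E H = 2 * trace_on V (\<lambda>v. fst (H (v, 0)))"
        by (rule trace_complexification[OF V lH HE]) (auto simp: H_def Yrot complex_linear_rot[OF F])
      then show ?thesis using tr by (simp add: H_def y_def complexify_def)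
    qed
    obtain M where M: "linear M"
      "\<And>l w. w \<in> ?G l \<Longrightarrow> w \<in> ?E \<Longrightarrow> M w = cscale (complex_of_real ((cmod l)\<^sup>2)) w"
      using eigenvalue_function_of_operator[OF F sE FE rotE E, of "\<lambda>l. complex_of_real ((cmod l)\<^sup>2)"] by blast
    have ME: "M w \<in> ?E" if "w \<in> ?E" for w
      using that by (rule onE) (use linear_subspace_vimage[OF M(1) sE] M(2) csE in \<open>auto simp: vimage_def\<close>)
    have "trace_on ?E (\<lambda>w. H w - M w) = 0"
    proof (rule trace_on_locally_nilpotent[OF E])
      show lN: "linear (\<lambda>w. H w - M w)" by (rule linear_compose_sub[OF lH M(1)])
      show "H w - M w \<in> ?E" if "w \<in> ?E" for w by (rule subspace_diff[OF sE HE[OF that] ME[OF that]])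
      fix w assume "w \<in> ?E"
      then show "\<exists>m. ((\<lambda>w. H w - M w) ^^ m) w = 0"
      proof (rule onE)
        show "subspace {w. \<exists>m. ((\<lambda>w. H w - M w) ^^ m) w = 0}"
          by (rule subspace_locally_nilpotent[OF lN])
        fix l w assume w: "w \<in> ?G l" "w \<in> ?E"
        have N: "H u - M u = cscale (cnj l) (shift ?F l u)" if "u \<in> ?G l" "u \<in> ?E" for u
          using that by (simp add: H_def Y(2) M(2) complex_linear_cscale[OF F] shift_def cscale_diff_right
              cscale_mult complex_norm_square mult.commute del: of_real_power)
        have sG: "(shift ?F l ^^ n) u \<in> ?G l \<inter> ?E" if "u \<in> ?G l" "u \<in> ?E" for u n
        proof (induction n)
          case (Suc n)
          then show ?case
            using shift_gen_eigenspace[OF F] shE by (simp del: mem_Times_iff)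
        qed (use that in simp)
        have pow: "((\<lambda>w. H w - M w) ^^ n) w = cscale (cnj l ^ n) ((shift ?F l ^^ n) w)" for n
        proof (induction n)
          case (Suc n)
          have *: "cscale (cnj l ^ n) ((shift ?F l ^^ n) w) \<in> ?G l" "cscale (cnj l ^ n) ((shift ?F l ^^ n) w) \<in> ?E"
            using cscale_gen_eigenspace[OF F IntD1[OF sG[OF w]]] csE[OF IntD2[OF sG[OF w]]] by blast+
          show ?case using N[OF *] Suc by (simp add: shift_cscale[OF F] cscale_mult)
        qed simp
        obtain m where "(shift ?F l ^^ m) w = 0" using w(1) by (auto simp: gen_eigenspace_def)
        then show "\<exists>m. ((\<lambda>w. H w - M w) ^^ m) w = 0"
          by (intro exI[of _ m]) (simp add: pow)
      qed
    qed
    then have trM: "trace_on ?E M = 0"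
      using trace_on_diff[OF E, of H M] trH by simp
    obtain B where B: "B \<subseteq> ?X" "finite B" "independent B" "span B = ?E"
      using basis_within[OF E, of ?X] spanX by (metis UN_least inf_le2 order_refl)
    define ev where "ev b = (SOME l. b \<in> ?G l)" for b
    have ev: "b \<in> ?G (ev b)" if "b \<in> B" for b
      unfolding ev_def by (rule someI_ex) (use B that in auto)
    \<comment> \<open>A basis of generalised eigenvectors of \<open>T\<close> diagonalises \<open>M\<close>.\<close>
    have "trace_on ?E M = (\<Sum>b\<in>B. (cmod (ev b))\<^sup>2)"
    proof (rule trace_on_eigenbasis[OF B(2-4) M(1)])
      fix b assume "b \<in> B"
      moreover have "b \<in> ?E" using B(4) \<open>b \<in> B\<close> span_base by blast
      ultimately show "M b = (cmod (ev b))\<^sup>2 *\<^sub>R b" using M(2)[OF ev] cscale_of_real by metis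
    qed
    then have "\<forall>b\<in>B. ev b = 0"
      using trM sum_nonneg_eq_0_iff[OF B(2), of "\<lambda>b. (cmod (ev b))\<^sup>2"] by simp
    then have "B \<subseteq> ?G 0" using ev by auto
    then have "?E \<subseteq> ?G 0" using B(4) span_minimal[OF _ subspace_gen_eigenspace[OF F]] by blast
    fix v assume "v \<in> V"
    then have "(v, 0) \<in> ?G 0" using \<open>?E \<subseteq> ?G 0\<close> 0 by auto
    moreover have "shift ?F 0 = ?F" by (simp add: shift_def fun_eq_iff)
    ultimately show "\<exists>m. (T ^^ m) v = 0"
      by (auto simp: gen_eigenspace_def funpow_complexify zero_prod_def)
  qed
qed

end

end

section \<open>Engel's theorem and the Killing form\<close>

text \<open>The map sending \<open>p\<close> to the vector with coordinates \<open>f p b\<close> is injective by non-degeneracy, hence onto.\<close>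
lemma form_represents_functional:
  fixes f :: "'a::real_vector \<Rightarrow> 'a \<Rightarrow> real"
  assumes V: "fin_dim_subspace V" and lin: "\<And>y. linear (\<lambda>x. f x y)" "\<And>x. linear (f x)"
    and nondeg: "\<And>x. x \<in> V \<Longrightarrow> (\<And>y. y \<in> V \<Longrightarrow> f x y = 0) \<Longrightarrow> x = 0"
    and phi: "linear \<phi>"
  shows "\<exists>p\<in>V. \<forall>y\<in>V. \<phi> y = f p y"
proof -
  obtain B where B: "finite B" "independent B" "span B = V" "card B = dim V"
    using finite_basis[OF V] by metis
  define \<Phi> where "\<Phi> p = (\<Sum>b\<in>B. f p b *\<^sub>R b)" for p
  have l: "linear \<Phi>"
    unfolding \<Phi>_def by (rule linearI)
      (simp_all add: linear_add[OF lin(1)] linear_scale[OF lin(1)] scaleR_add_left sum.distrib scaleR_sum_right)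
  have eq: "f p y = \<psi> y" if "\<And>b. b \<in> B \<Longrightarrow> f p b = \<psi> b" "linear \<psi>" "y \<in> V" for p y \<psi>
    by (rule linear_eq_on[OF lin(2) that(2), of y B]) (use that B(3) in auto)
  have coeff: "\<forall>b\<in>B. a b = c b" if "(\<Sum>b\<in>B. a b *\<^sub>R b) = (\<Sum>b\<in>B. c b *\<^sub>R b)" for a c
  proof -
    have "(\<Sum>b\<in>B. (a b - c b) *\<^sub>R b) = 0" using that by (simp add: scaleR_diff_left sum_subtractf)
    from independentD[OF B(2,1) subset_refl this] show ?thesis by simp
  qed
  have inj: "inj_on \<Phi> V"
  proof (subst linear_inj_on_iff_eq_0[OF l fin_dim_subspaceD[OF V]], intro ballI impI)
    fix x assume x: "x \<in> V" "\<Phi> x = 0"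
    have "\<forall>b\<in>B. f x b = 0" using coeff[of "f x" "\<lambda>_. 0"] x(2) by (simp add: \<Phi>_def)
    then show "x = 0" using nondeg[OF x(1)] eq[of x "\<lambda>_. 0"] by (auto simp: linear_zero)
  qed
  have "independent (\<Phi> ` B)" using linear_independent_injective_image[OF l B(2)] inj B(3) by simp
  moreover have "card (\<Phi> ` B) = card B" using inj B(3) span_superset by (metis card_image inj_on_subset)
  ultimately have "dim (\<Phi> ` V) = dim V"
    using B linear_span_image[OF l, of B] dim_span_eq_card_independent by metis
  moreover have "\<Phi> ` V \<subseteq> V"
    unfolding \<Phi>_def B(3)[symmetric] by (auto intro: span_sum span_scale span_base)
  ultimately have "\<Phi> ` V = V"
    by (intro subspace_eq_of_dim_le[OF V linear_subspace_image[OF l fin_dim_subspaceD[OF V]]]) auto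
  moreover have "(\<Sum>b\<in>B. \<phi> b *\<^sub>R b) \<in> V"
    unfolding B(3)[symmetric] by (intro span_sum span_scale span_base)
  ultimately obtain p where p: "p \<in> V" "\<Phi> p = (\<Sum>b\<in>B. \<phi> b *\<^sub>R b)" by (metis imageE)
  have "\<forall>b\<in>B. f p b = \<phi> b" using coeff[of "f p" \<phi>] p(2) by (simp add: \<Phi>_def)
  then show ?thesis using p(1) eq[of p \<phi>] phi by (intro bexI[of _ p]) auto
qed

lemma subspace_of_greatest_dim:
  assumes V: "fin_dim_subspace V" and Q: "Q H0" "\<And>H. Q H \<Longrightarrow> subspace H \<and> H \<subseteq> V"
  shows "\<exists>H. Q H \<and> (\<forall>H'. Q H' \<longrightarrow> dim H' \<le> dim H)"
proof -
  have "\<forall>H. Q H \<longrightarrow> dim H < Suc (dim V)" using dim_mono_fin[OF V] Q(2) le_imp_less_Suc by blast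
  from ex_has_greatest_nat[OF Q(1) this] show ?thesis .
qed

lemma subspace_span_insert:
  assumes "subspace H" shows "span (insert l H) = {h + c *\<^sub>R l | h c. h \<in> H}"
proof -
  have "x \<in> span (insert l H) \<longleftrightarrow> (\<exists>c. x - c *\<^sub>R l \<in> H)" for x
    using assms by (simp add: span_breakdown_eq span_eq_iff[THEN iffD2])
  moreover have "(\<exists>c. x - c *\<^sub>R l \<in> H) \<longleftrightarrow> (\<exists>h c. x = h + c *\<^sub>R l \<and> h \<in> H)" for x
    by (metis add_diff_cancel_right' diff_add_cancel)
  ultimately show ?thesis by blast
qed

context lie_bracket
begin

lemma subspace_br_in: "subspace W \<Longrightarrow> subspace {v. br l v \<in> W}"
  using linear_subspace_vimage[OF linear_br] by (simp add: vimage_def)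

lemma linear_br_comp: "linear f \<Longrightarrow> linear (\<lambda>v. br x (f v))"
  using linear_compose[OF _ linear_br] by (simp add: o_def)

text \<open>Engel's theorem for subquotients \<open>U / W\<close> of the adjoint representation. The induction on the dimension of \<open>L\<close> needs
this generality, because it is applied to a proper subalgebra \<open>H\<close> acting both on \<open>L / H\<close>, which exhibits \<open>H\<close> as an
ideal of codimension one, and on \<open>U / W\<close>.\<close>
lemma engel:
  assumes D: "fin_dim_subspace D"
    and nil: "\<And>x v. x \<in> D \<Longrightarrow> v \<in> D \<Longrightarrow> \<exists>m. (br x ^^ m) v = 0"
    and L: "subspace L" "L \<subseteq> D" "\<And>x y. x \<in> L \<Longrightarrow> y \<in> L \<Longrightarrow> br x y \<in> L"
    and U: "subspace U" "U \<subseteq> D" "\<And>x u. x \<in> L \<Longrightarrow> u \<in> U \<Longrightarrow> br x u \<in> U"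
    and W: "subspace W" "W \<subset> U" "\<And>x w. x \<in> L \<Longrightarrow> w \<in> W \<Longrightarrow> br x w \<in> W"
  shows "\<exists>v\<in>U - W. \<forall>x\<in>L. br x v \<in> W"
  using L U W
proof (induction "dim L" arbitrary: L U W rule: less_induct)
  case less
  note L = less.prems(1-3) and U = less.prems(4-6) and W = less.prems(7-9)
  have fL: "fin_dim_subspace L" by (rule fin_dim_subspace_subset[OF D L(1,2)])
  show ?case
  proof (cases "L = {0}")
    case True
    then show ?thesis using W(2) subspace_0[OF W(1)] by (auto simp: br_simps)
  next
    case False
    define Q where "Q H \<longleftrightarrow> subspace H \<and> H \<subset> L \<and> (\<forall>x\<in>H. \<forall>y\<in>H. br x y \<in> H)" for H
    have "Q {0}" using False subspace_0[OF L(1)] by (auto simp: Q_def br_simps subspace_single_0)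
    moreover have "subspace H \<and> H \<subseteq> L" if "Q H" for H using that by (auto simp: Q_def)
    ultimately obtain H where H: "Q H" and max: "\<And>H'. Q H' \<Longrightarrow> dim H' \<le> dim H"
      using subspace_of_greatest_dim[OF fL, of Q] by blast
    have sH: "subspace H" "H \<subset> L" "\<And>x y. x \<in> H \<Longrightarrow> y \<in> H \<Longrightarrow> br x y \<in> H"
      using H by (auto simp: Q_def)
    have "dim H < dim L" using subspace_eq_of_dim_le[OF fL sH(1)] sH(2) by force
    note IH = less.hyps[OF this sH(1) _ sH(3)]
    \<comment> \<open>A proper subalgebra \<open>H\<close> of greatest dimension has a normalising vector outside it, so it is an ideal of codimension one.\<close>
    obtain l where l: "l \<in> L" "l \<notin> H" "\<forall>h\<in>H. br h l \<in> H"
      using IH[of L H] sH L by blast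
    let ?H' = "span (insert l H)"
    note H' = subspace_span_insert[OF sH(1), of l]
    have H'L: "?H' \<subseteq> L" by (rule span_minimal[OF _ L(1)]) (use l sH in auto)
    have "?H' = L"
    proof (rule ccontr)
      assume "?H' \<noteq> L"
      moreover have "br x y \<in> ?H'" if xy: "x \<in> ?H'" "y \<in> ?H'" for x y
      proof -
        obtain h c h' c' where x: "x = h + c *\<^sub>R l" "h \<in> H" and y: "y = h' + c' *\<^sub>R l" "h' \<in> H"
          using xy unfolding H' by blast
        have "br x y = br h h' + c' *\<^sub>R br h l - c *\<^sub>R br h' l"
          using br_antisym[of l h'] by (simp add: x y br_simps)
        also have "\<dots> \<in> H" using x y l sH(3)
          by (intro subspace_diff[OF sH(1)] subspace_add[OF sH(1)] subspace_scale[OF sH(1)]) auto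
        finally show ?thesis by (meson span_base insertCI)
      qed
      ultimately have "dim ?H' \<le> dim H" using max[of ?H'] H'L by (auto simp: Q_def)
      then have "H = ?H'"
        by (intro subspace_eq_of_dim_le[OF fin_dim_subspace_subset[OF fL subspace_span H'L] sH(1)])
          (auto intro: span_base)
      then show False using l(2) span_base[of l "insert l H"] by auto
    qed
    \<comment> \<open>The vectors that \<open>H\<close> annihilates modulo \<open>W\<close> are stable under \<open>l\<close>; the last iterate outside \<open>W\<close> is the desired one.\<close>
    define U' where "U' = {v \<in> U. \<forall>h\<in>H. br h v \<in> W}"
    have "\<exists>v\<in>U - W. \<forall>x\<in>H. br x v \<in> W"
    proof (rule IH)
      show "br x u \<in> U" if "x \<in> H" "u \<in> U" for x u using U(3) that sH(2) by auto
      show "br x w \<in> W" if "x \<in> H" "w \<in> W" for x w using W(3) that sH(2) by auto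
    qed (use sH(2) L U W in auto)
    then obtain v0 where v0: "v0 \<in> U'" "v0 \<notin> W" unfolding U'_def by blast
    have lU': "br l v \<in> U'" if "v \<in> U'" for v
    proof -
      have "br h (br l v) \<in> W" if h: "h \<in> H" for h
      proof -
        have "br h (br l v) = br (br h l) v + br l (br h v)" by (rule br_br)
        also have "\<dots> \<in> W"
          using \<open>v \<in> U'\<close> l h W(3) unfolding U'_def by (intro subspace_add[OF W(1)]) auto
        finally show ?thesis .
      qed
      then show ?thesis using that U(3) l(1) by (simp add: U'_def)
    qed
    have pU': "(br l ^^ n) v0 \<in> U'" for n by (induction n) (use v0 lU' in auto)
    obtain m where "(br l ^^ m) v0 = 0" using nil[of l v0] l L U v0 unfolding U'_def by blast
    then have ex: "\<exists>m. (br l ^^ m) v0 \<in> W" using subspace_0[OF W(1)] by metis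
    define k where "k = (LEAST m. (br l ^^ m) v0 \<in> W)"
    have k: "(br l ^^ k) v0 \<in> W" unfolding k_def by (rule LeastI_ex[OF ex])
    then obtain j where j: "k = Suc j" using v0 by (cases k) auto
    have "(br l ^^ j) v0 \<notin> W" using not_less_Least[of j "\<lambda>m. (br l ^^ m) v0 \<in> W"] j k_def by simp
    moreover have "br x ((br l ^^ j) v0) \<in> W" if "x \<in> L" for x
    proof -
      obtain h c where x: "x = h + c *\<^sub>R l" "h \<in> H" using \<open>x \<in> L\<close> \<open>?H' = L\<close> H' by blast
      have "br h ((br l ^^ j) v0) \<in> W" using pU'[of j] x(2) by (simp add: U'_def)
      then show ?thesis using k j
        by (simp add: x(1) br_simps subspace_add[OF W(1)] subspace_scale[OF W(1)])
    qed
    ultimately show ?thesis using pU'[of j] by (auto simp: U'_def)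
  qed
qed

text \<open>Engel's theorem enlarges a proper ideal \<open>W\<close> by one dimension, so that a proper ideal of greatest dimension satisfies
\<open>D = W + \<real>v\<close> with \<open>[D, v] \<subseteq> W\<close>; but then \<open>[D, D] \<subseteq> W\<close>.\<close>
lemma ad_nilpotent_not_perfect:
  assumes D: "fin_dim_subspace D" and closed: "\<And>x y. x \<in> D \<Longrightarrow> y \<in> D \<Longrightarrow> br x y \<in> D"
    and nil: "\<And>x v. x \<in> D \<Longrightarrow> v \<in> D \<Longrightarrow> \<exists>m. (br x ^^ m) v = 0"
    and perfect: "bracket_span br D D = D"
  shows "D = {0}"
proof (rule ccontr)
  assume "D \<noteq> {0}"
  note sD = fin_dim_subspaceD[OF D]
  define Q where "Q W \<longleftrightarrow> subspace W \<and> W \<subset> D \<and> (\<forall>x\<in>D. \<forall>y\<in>W. br x y \<in> W)" for W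
  have "Q {0}" using \<open>D \<noteq> {0}\<close> subspace_0[OF sD] by (auto simp: Q_def br_simps subspace_single_0)
  moreover have "subspace W \<and> W \<subseteq> D" if "Q W" for W using that by (auto simp: Q_def)
  ultimately obtain W where QW: "Q W" and max: "\<And>W'. Q W' \<Longrightarrow> dim W' \<le> dim W"
    using subspace_of_greatest_dim[OF D, of Q] by blast
  then have W: "subspace W \<and> W \<subset> D \<and> (\<forall>x\<in>D. \<forall>y\<in>W. br x y \<in> W)" by (simp add: Q_def)
  then have sW: "subspace W" by blast
  obtain v where v: "v \<in> D - W" "\<forall>x\<in>D. br x v \<in> W"
    using engel[OF D nil sD subset_refl closed sD subset_refl closed, of W] W by blast
  let ?W' = "span (insert v W)"
  note W' = subspace_span_insert[OF sW, of v]
  have W'D: "?W' \<subseteq> D" by (rule span_minimal[OF _ sD]) (use v W in auto)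
  have brW: "br x y \<in> W" if "x \<in> D" "y \<in> ?W'" for x y
    using that v W unfolding W' by (auto simp: br_simps intro!: subspace_add[OF sW] subspace_scale[OF sW])
  have "?W' = D"
  proof (rule ccontr)
    assume "?W' \<noteq> D"
    then have "dim ?W' \<le> dim W" using max[of ?W'] W'D brW by (auto simp: Q_def intro: span_base)
    then have "W = ?W'"
      by (intro subspace_eq_of_dim_le[OF fin_dim_subspace_subset[OF D subspace_span W'D] sW])
        (auto intro: span_base)
    then show False using v span_base[of v "insert v W"] by auto
  qed
  then have "bracket_span br D D \<subseteq> W"
    unfolding bracket_span_def by (intro span_minimal[OF _ sW]) (use brW in auto)
  then show False using perfect W by auto
qed

definition killing :: "'a set \<Rightarrow> 'a \<Rightarrow> 'a \<Rightarrow> real" where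
  "killing V x y = trace_on V (\<lambda>v. br x (br y v))"

context
  fixes V :: "'a set"
  assumes V: "fin_dim_subspace V" and closed: "\<And>x y. x \<in> V \<Longrightarrow> y \<in> V \<Longrightarrow> br x y \<in> V"
begin

lemma linear_killing: "linear (killing V x)" "linear (\<lambda>x. killing V x y)"
  unfolding killing_def by (rule linearI; simp add: br_simps trace_on_add[OF V] trace_on_scale[OF V])+

lemma killing_invariant:
  assumes "x \<in> V" "y \<in> V" "z \<in> V"
  shows "killing V (br x y) z = killing V x (br y z)"
proof -
  have "trace_on V (\<lambda>v. br y (br x (br z v))) = trace_on V (\<lambda>v. br x (br z (br y v)))"
    using trace_on_cyclic[OF V V linear_br_comp[OF linear_br, of x z] _ linear_br, of y] assms closed by auto
  then show ?thesis
    by (simp add: killing_def br_commutator linear_diff[OF linear_br] trace_on_diff[OF V])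
qed

text \<open>Cartan's criterion for a perfect ideal. With \<open>y\<close> the conjugate derivation of \<open>ad x\<close>, the linear functional
\<open>x' \<mapsto> tr (ad x' \<circ> y)\<close> takes on a bracket \<open>[u, w]\<close> the value \<open>- tr (ad u \<circ> ad (y w))\<close>, since
\<open>[y, ad w] = ad (y w)\<close>. This is a value of the Killing form on \<open>D\<close>, and brackets span \<open>D\<close>. So every
\<open>ad x\<close> is nilpotent.\<close>
lemma perfect_isotropic_ideal_trivial:
  assumes D: "subspace D" "D \<subseteq> V" and ideal: "\<And>x y. x \<in> V \<Longrightarrow> y \<in> D \<Longrightarrow> br x y \<in> D"
    and perfect: "bracket_span br D D = D"
    and iso: "\<And>x y. x \<in> D \<Longrightarrow> y \<in> D \<Longrightarrow> killing V x y = 0"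
  shows "D = {0}"
proof (rule ad_nilpotent_not_perfect[OF fin_dim_subspace_subset[OF V D] _ _ perfect])
  show "br x y \<in> D" if "x \<in> D" "y \<in> D" for x y using ideal that D by blast
  fix x v assume x: "x \<in> D" and v: "v \<in> D"
  have "br x v \<in> V" if "v \<in> V" for v using closed that x D(2) by auto
  moreover have "br x v \<in> D" if "v \<in> D" for v using ideal that x D(2) by auto
  ultimately obtain y where y: "linear y" "\<forall>v\<in>V. y v \<in> V" "\<forall>v\<in>D. y v \<in> D"
    "\<forall>u\<in>V. \<forall>v\<in>V. y (br u v) = br (y u) v + br u (y v)"
    "trace_on V (\<lambda>v. br x (y v)) = 0 \<longrightarrow> (\<forall>v\<in>V. \<exists>m. (br x ^^ m) v = 0)"
    using conjugate_derivation[OF derivation_br[of x] V _ closed D] by blast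
  have "bracket_span br D D \<subseteq> {x. trace_on V (\<lambda>v. br x (y v)) = 0}"
    unfolding bracket_span_def
  proof (rule span_minimal)
    show "subspace {x. trace_on V (\<lambda>v. br x (y v)) = 0}"
      by (auto simp: subspace_def br_simps trace_on_zero[OF V] trace_on_add[OF V] trace_on_scale[OF V])
    show "{br x y |x y. x \<in> D \<and> y \<in> D} \<subseteq> {x. trace_on V (\<lambda>v. br x (y v)) = 0}"
    proof clarify
      fix u w assume uw: "u \<in> D" "w \<in> D"
      then have uwV: "u \<in> V" "w \<in> V" using D by auto
      have "trace_on V (\<lambda>v. br w (br u (y v))) = trace_on V (\<lambda>v. br u (y (br w v)))"
        using trace_on_cyclic[OF V V linear_br_comp[OF y(1), of u] _ linear_br, of w] uwV closed y(2) by auto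
      also have "\<dots> = trace_on V (\<lambda>v. br u (br (y w) v) + br u (br w (y v)))"
        by (rule trace_on_cong[OF V]) (simp add: y(4) uwV br_add_right)
      finally have "trace_on V (\<lambda>v. br (br u w) (y v)) = - killing V u (y w)"
        by (simp add: br_commutator trace_on_diff[OF V] trace_on_add[OF V] killing_def)
      then show "trace_on V (\<lambda>v. br (br u w) (y v)) = 0" using iso[OF uw(1) y(3)[rule_format, OF uw(2)]] by simp
    qed
  qed
  then show "\<exists>m. (br x ^^ m) v = 0" using perfect x v D y(5) by auto
qed

text \<open>The kernel \<open>J\<close> of the Killing form is an ideal. Its derived series becomes stationary at a perfect ideal, which is
zero; so \<open>J\<close> is solvable and lies in the radical.\<close>
lemma killing_nondegenerate:
  assumes ss: "lie_semisimple V br" and x: "x \<in> V" "\<And>y. y \<in> V \<Longrightarrow> killing V x y = 0"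
  shows "x = 0"
proof -
  note sV = fin_dim_subspaceD[OF V]
  define J where "J = {x \<in> V. \<forall>y\<in>V. killing V x y = 0}"
  have J: "subspace J" "J \<subseteq> V"
    using sV by (auto simp: J_def subspace_def linear_0[OF linear_killing(2)] linear_add[OF linear_killing(2)]
        linear_scale[OF linear_killing(2)])
  have Jideal: "br x y \<in> J" if "x \<in> V" "y \<in> J" for x y
  proof -
    have "killing V (br x y) z = 0" if "z \<in> V" for z
    proof -
      have "killing V (br x y) z = - killing V (br y x) z"
        by (subst br_antisym) (simp add: linear_neg[OF linear_killing(2)])
      also have "\<dots> = 0"
        using killing_invariant[of y x z] that \<open>x \<in> V\<close> \<open>y \<in> J\<close> closed by (simp add: J_def)
      finally show ?thesis .
    qed
    then show ?thesis using that closed by (simp add: J_def)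
  qed
  let ?D = "derived_series J br"
  have D: "subspace (?D n) \<and> ?D n \<subseteq> J \<and> (\<forall>x\<in>V. \<forall>y\<in>?D n. br x y \<in> ?D n)" for n
  proof (induction n)
    case 0
    then show ?case using J Jideal by simp
  next
    case (Suc n)
    let ?X = "{br x y |x y. x \<in> ?D n \<and> y \<in> ?D n}"
    have sub: "?D (Suc n) \<subseteq> ?D n"
      unfolding derived_series.simps bracket_span_def
      by (rule span_minimal) (use Suc J in blast)+
    have "span ?X \<subseteq> {y. br x y \<in> span ?X}" if x: "x \<in> V" for x
    proof (rule span_minimal[OF _ subspace_br_in[OF subspace_span]], clarify)
      fix a b assume ab: "a \<in> ?D n" "b \<in> ?D n"
      have "br (br x a) b \<in> ?X" "br a (br x b) \<in> ?X" using ab x Suc by blast+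
      then show "br x (br a b) \<in> span ?X" unfolding br_br[of x a b] by (intro span_add span_base)
    qed
    then show ?case using sub Suc by (auto simp: bracket_span_def)
  qed
  \<comment> \<open>The series is stationary where the dimension is minimal.\<close>
  define n where "n = arg_min (\<lambda>n. dim (?D n)) (\<lambda>_. True)"
  have "dim (?D n) \<le> dim (?D (Suc n))"
    unfolding n_def by (rule arg_min_nat_le) simp
  moreover have "?D (Suc n) \<subseteq> ?D n"
    unfolding derived_series.simps bracket_span_def
    by (rule span_minimal) (use D[of n] J in blast)+
  ultimately have eq: "?D (Suc n) = ?D n"
    using subspace_eq_of_dim_le[OF fin_dim_subspace_subset[OF V, of "?D n"]] D J by (meson order_trans)
  have "?D n = {0}"
  proof (rule perfect_isotropic_ideal_trivial)
    show "bracket_span br (?D n) (?D n) = ?D n" using eq by simp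
    show "killing V x y = 0" if "x \<in> ?D n" "y \<in> ?D n" for x y
    proof -
      have "x \<in> J" "y \<in> V" using that D[of n] J(2) by auto
      then show ?thesis by (simp add: J_def)
    qed
  qed (use D[of n] J in blast)+
  then have "lie_solvable J br" unfolding lie_solvable_def by blast
  moreover have "lie_ideal J V br" using J Jideal by (simp add: lie_ideal_def)
  ultimately have "J \<subseteq> lie_radical V br" unfolding lie_radical_def by (intro subset_trans[OF _ span_superset]) auto
  then show ?thesis using ss x unfolding lie_semisimple_def J_def by auto
qed

lemma semisimple_centre_trivial:
  assumes ss: "lie_semisimple V br" and p: "p \<in> V" "\<And>y. y \<in> V \<Longrightarrow> br p y = 0"
  shows "p = 0"
proof (rule killing_nondegenerate[OF ss p(1)])
  fix y assume "y \<in> V"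
  then show "killing V p y = 0"
    unfolding killing_def using trace_on_cong[OF V, of "\<lambda>v. br p (br y v)" "\<lambda>_. 0"] closed p(2) trace_on_zero[OF V]
    by simp
qed

text \<open>This says that a semisimple Lie algebra is perfect. The functional is represented by some \<open>p\<close> for the Killing form, and
invariance makes \<open>p\<close> central.\<close>
lemma semisimple_functional_vanishes:
  assumes ss: "lie_semisimple V br" and "linear \<phi>" "\<And>x y. x \<in> V \<Longrightarrow> y \<in> V \<Longrightarrow> \<phi> (br x y) = 0" "x \<in> V"
  shows "\<phi> x = (0::real)"
proof -
  obtain p where p: "p \<in> V" "\<And>y. y \<in> V \<Longrightarrow> \<phi> y = killing V p y"
    using form_represents_functional[OF V linear_killing(2,1) killing_nondegenerate[OF ss] assms(2)] by blast
  have "br p y = 0" if "y \<in> V" for y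
    using killing_nondegenerate[OF ss closed[OF p(1) that]] killing_invariant[OF p(1) that]
      p(2) assms(3) closed that by metis
  then have "p = 0" by (rule semisimple_centre_trivial[OF ss p(1)])
  then show ?thesis using p(2) assms(4) linear_0[OF linear_killing(2)] by simp
qed

end

end

section \<open>Semisimple symmetric couples\<close>

locale semisimple_couple = lie_bracket br for br :: "'a::real_vector \<Rightarrow> 'a \<Rightarrow> 'a" +
  fixes V K P :: "'a set" and s :: "'a \<Rightarrow> 'a"
  assumes V: "fin_dim_subspace V"
    and ss: "lie_semisimple V br"
    and s: "linear s"
    and K: "K = {x \<in> V. s x = x}" and P: "P = {x \<in> V. s x = - x}"
    and sV: "x \<in> V \<Longrightarrow> s x \<in> V" and s_s: "x \<in> V \<Longrightarrow> s (s x) = x"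
    and closed: "x \<in> V \<Longrightarrow> y \<in> V \<Longrightarrow> br x y \<in> V"
    and s_br: "x \<in> V \<Longrightarrow> y \<in> V \<Longrightarrow> s (br x y) = br (s x) (s y)"
begin

lemma K_subspace: "subspace K" and P_subspace: "subspace P"
  using fin_dim_subspaceD[OF V]
  by (auto simp: K P subspace_def linear_0[OF s] linear_add[OF s] linear_scale[OF s])

lemma K_P_split: assumes "x \<in> V" obtains k p where "k \<in> K" "p \<in> P" "x = k + p"
proof -
  note sV' = fin_dim_subspaceD[OF V]
  have "(1/2) *\<^sub>R (x + s x) \<in> K" "(1/2) *\<^sub>R (x - s x) \<in> P"
    using assms sV s_s subspace_add[OF sV'] subspace_diff[OF sV'] subspace_scale[OF sV']
    by (auto simp: K P linear_add[OF s] linear_diff[OF s] linear_scale[OF s] algebra_simps simp flip: scaleR_minus_right)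
  moreover have "x = (1/2) *\<^sub>R (x + s x) + (1/2) *\<^sub>R (x - s x)"
    by (simp flip: scaleR_add_right scaleR_2)
  ultimately show thesis using that by blast
qed

text \<open>Conjugation by the involution \<open>s\<close> changes the sign of \<open>ad k \<circ> ad p\<close> and preserves its trace.\<close>
lemma killing_K_P:
  assumes "k \<in> K" "p \<in> P" shows "killing V k p = 0"
proof -
  define f where "f v = br k (br p v)" for v
  have kp: "k \<in> V" "s k = k" "p \<in> V" "s p = - p" using assms by (auto simp: K P)
  have f: "linear f" "\<And>v. v \<in> V \<Longrightarrow> f v \<in> V"
    unfolding f_def using linear_br_comp[OF linear_br] kp closed by auto
  have "trace_on V f = trace_on V (\<lambda>v. s (s (f v)))"
    by (rule trace_on_cong[OF V]) (simp add: s_s f)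
  also have "\<dots> = trace_on V (\<lambda>v. s (f (s v)))"
    using trace_on_cyclic[OF V V linear_compose[OF f(1) s] _ s] f sV by (simp add: o_def)
  also have "\<dots> = trace_on V (\<lambda>v. - f v)"
    by (rule trace_on_cong[OF V]) (use kp sV s_s closed in \<open>simp add: f_def s_br br_simps linear_neg[OF s]\<close>)
  also have "\<dots> = - trace_on V f" by (rule trace_on_minus[OF V])
  finally show ?thesis by (simp add: killing_def f_def[abs_def])
qed

text \<open>Perfectness of \<open>V\<close> restricted to \<open>P\<close>, that is \<open>P = [K, P]\<close> in dual form: the functional is extended by zero on \<open>K\<close>, and the
extension vanishes on all brackets because their \<open>P\<close>-parts are sums of brackets of \<open>K\<close> with \<open>P\<close>.\<close>
lemma functional_on_P_vanishes:
  assumes "linear \<phi>" "\<And>k p. k \<in> K \<Longrightarrow> p \<in> P \<Longrightarrow> \<phi> (br k p) = (0::real)" "p \<in> P"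
  shows "\<phi> p = 0"
proof -
  \<comment> \<open>Twice the extension of \<open>\<phi>\<close> by zero on \<open>K\<close>.\<close>
  define \<psi> where "\<psi> x = \<phi> (x - s x)" for x
  have "\<psi> p = 0"
  proof (rule semisimple_functional_vanishes[OF V closed ss])
    show "linear \<psi>"
      unfolding \<psi>_def by (rule linearI)
        (simp_all add: linear_add[OF s] linear_diff[OF assms(1)] linear_add[OF assms(1)]
          linear_scale[OF assms(1)] linear_scale[OF s] right_diff_distrib)
    show "p \<in> V" using assms(3) by (simp add: P)
    fix x y assume xy: "x \<in> V" "y \<in> V"
    obtain k p where x: "x = k + p" "k \<in> K" "p \<in> P" using K_P_split[OF xy(1)] by metis
    obtain k' p' where y: "y = k' + p'" "k' \<in> K" "p' \<in> P" using K_P_split[OF xy(2)] by metis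
    have s1: "s x = k - p" "s y = k' - p'" using x y by (auto simp: K P linear_add[OF s])
    have "s (br x y) = br (k - p) (k' - p')" using s_br[OF xy] s1 by simp
    then have "br x y - s (br x y) = 2 *\<^sub>R br k p' - 2 *\<^sub>R br k' p"
      using br_antisym[of p k'] by (simp add: x(1) y(1) br_simps scaleR_2)
    then show "\<psi> (br x y) = 0"
      using assms(2) x y by (simp add: \<psi>_def linear_diff[OF assms(1)] linear_scale[OF assms(1)])
  qed
  moreover have "p - s p = 2 *\<^sub>R p" using assms(3) by (simp add: P scaleR_2)
  ultimately show ?thesis by (simp add: \<psi>_def linear_scale[OF assms(1)])
qed

text \<open>The Killing form is non-degenerate on \<open>K\<close>, since \<open>K\<close> and \<open>P\<close> are orthogonal for it. The element that represents a
character of \<open>K\<close> is central by invariance.\<close>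
lemma centre_of_character:
  assumes "linear \<chi>" "\<And>k k'. k \<in> K \<Longrightarrow> k' \<in> K \<Longrightarrow> \<chi> (br k k') = (0::real)" "k0 \<in> K" "\<chi> k0 \<noteq> 0"
  obtains z where "z \<in> K" "z \<noteq> 0" "\<And>k. k \<in> K \<Longrightarrow> br z k = 0"
proof -
  have KV: "K \<subseteq> V" by (auto simp: K)
  have clK: "br x y \<in> K" if "x \<in> K" "y \<in> K" for x y
    using that s_br closed by (auto simp: K)
  have nd: "x = 0" if "x \<in> K" "\<And>y. y \<in> K \<Longrightarrow> killing V x y = 0" for x
  proof (rule killing_nondegenerate[OF V closed ss])
    show "x \<in> V" using that KV by auto
    fix y assume "y \<in> V"
    then obtain k p where "k \<in> K" "p \<in> P" "y = k + p" by (rule K_P_split)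
    then show "killing V x y = 0" using that killing_K_P
      by (simp add: linear_add[OF linear_killing(1)[OF V closed]])
  qed
  obtain z where z: "z \<in> K" "\<And>k. k \<in> K \<Longrightarrow> \<chi> k = killing V z k"
    using form_represents_functional[OF fin_dim_subspace_subset[OF V K_subspace KV]
        linear_killing(2,1)[OF V closed] nd assms(1)] by blast
  have "br z k = 0" if "k \<in> K" for k
  proof (rule nd[OF clK[OF z(1) that]])
    fix y assume "y \<in> K"
    then show "killing V (br z k) y = 0"
      using killing_invariant[OF V closed, of z k y] z(2)[OF clK, of k y] assms(2) z(1) that KV by auto
  qed
  moreover have "z \<noteq> 0" using z(2)[OF assms(3)] assms(4) linear_0[OF linear_killing(2)[OF V closed]] by auto
  ultimately show thesis using that z by blast
qed

end

section \<open>The part of the radical in P\<close>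

lemma independent_Un_of_span_Int:
  assumes A: "finite A" "independent A" and B: "finite B" "independent B"
    and Int: "span A \<inter> span B \<subseteq> {0}"
  shows "independent (A \<union> B)" "A \<inter> B = {}"
proof -
  show disj: "A \<inter> B = {}"
  proof (rule ccontr)
    assume "A \<inter> B \<noteq> {}"
    then obtain x where x: "x \<in> A" "x \<in> B" by blast
    then have "x = 0" using Int span_base[of x A] span_base[of x B] by blast
    then show False using x(1) A(2) dependent_zero[of A] by simp
  qed
  show "independent (A \<union> B)"
  proof (rule independent_if_scalars_zero)
    show "finite (A \<union> B)" using A B by simp
    fix u x assume u: "(\<Sum>x\<in>A \<union> B. u x *\<^sub>R x) = 0" and x: "x \<in> A \<union> B"
    let ?a = "\<Sum>x\<in>A. u x *\<^sub>R x" and ?b = "\<Sum>x\<in>B. u x *\<^sub>R x"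
    have ab: "?a + ?b = 0" using u by (simp add: sum.union_disjoint[OF A(1) B(1) disj])
    have "?a \<in> span A" "?b \<in> span B" by (intro span_sum span_scale span_base; simp)+
    moreover have "?a = - ?b" using ab by (simp add: eq_neg_iff_add_eq_0)
    ultimately have "?a = 0" using Int span_neg[of ?b B] by auto
    then have "?b = 0" using ab by simp
    show "u x = 0"
      using x independentD[OF A(2,1) subset_refl \<open>?a = 0\<close>] independentD[OF B(2,1) subset_refl \<open>?b = 0\<close>] by blast
  qed
qed

text \<open>In the application \<open>\<C>\<close> is the set of components of a Levi factor and \<open>R\<close> is the radical, which enters as an \<open>s\<close>-stable
ideal that spans \<open>G\<close> together with the components and has isotropic \<open>P\<close>-part.\<close>
locale symplectic_decomposition = lie_bracket br for br :: "'a::real_vector \<Rightarrow> 'a \<Rightarrow> 'a" +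
  fixes G K P R :: "'a set" and s :: "'a \<Rightarrow> 'a" and \<Omega> :: "'a \<Rightarrow> 'a \<Rightarrow> real" and \<C> :: "'a set set"
  assumes G: "fin_dim_subspace G"
    and closed: "x \<in> G \<Longrightarrow> y \<in> G \<Longrightarrow> br x y \<in> G"
    and s: "linear s" and s_in: "x \<in> G \<Longrightarrow> s x \<in> G" and s_s: "x \<in> G \<Longrightarrow> s (s x) = x"
    and s_br: "x \<in> G \<Longrightarrow> y \<in> G \<Longrightarrow> s (br x y) = br (s x) (s y)"
    and K: "K = {x \<in> G. s x = x}" and P: "P = {x \<in> G. s x = - x}"
    and faithful: "k \<in> K \<Longrightarrow> (\<And>p. p \<in> P \<Longrightarrow> br k p = 0) \<Longrightarrow> k = 0"
    and form_linear: "linear (\<Omega> x)" "linear (\<lambda>x. \<Omega> x y)"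
    and form_alt: "x \<in> P \<Longrightarrow> \<Omega> x x = 0"
    and form_nondeg: "x \<in> P \<Longrightarrow> (\<And>y. y \<in> P \<Longrightarrow> \<Omega> x y = 0) \<Longrightarrow> x = 0"
    and form_inv: "k \<in> K \<Longrightarrow> x \<in> P \<Longrightarrow> y \<in> P \<Longrightarrow> \<Omega> (br k x) y = - \<Omega> x (br k y)"
    and R: "subspace R" "R \<subseteq> G" "x \<in> G \<Longrightarrow> r \<in> R \<Longrightarrow> br x r \<in> R" "r \<in> R \<Longrightarrow> s r \<in> R"
    and isotropic: "x \<in> P \<inter> R \<Longrightarrow> y \<in> P \<inter> R \<Longrightarrow> \<Omega> x y = 0"
    and finite_components: "finite \<C>"
    and component: "c \<in> \<C> \<Longrightarrow> semisimple_couple br c (K \<inter> c) (P \<inter> c) s"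
    and component_subset: "c \<in> \<C> \<Longrightarrow> c \<subseteq> G"
    and components_commute: "c \<in> \<C> \<Longrightarrow> d \<in> \<C> \<Longrightarrow> c \<noteq> d \<Longrightarrow> x \<in> c \<Longrightarrow> y \<in> d \<Longrightarrow> br x y = 0"
    and G_sum: "x \<in> G \<Longrightarrow> \<exists>f r. (\<forall>c\<in>\<C>. f c \<in> c) \<and> r \<in> R \<and> x = (\<Sum>c\<in>\<C>. f c) + r"
begin

lemma K_sub: "k \<in> K \<Longrightarrow> k \<in> G" and P_sub: "p \<in> P \<Longrightarrow> p \<in> G"
  by (auto simp: K P)

lemma subspaces: "subspace K" "subspace P" "subspace (P \<inter> R)" "subspace (K \<inter> R)"
proof -
  show "subspace K" "subspace P" using fin_dim_subspaceD[OF G]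
    by (auto simp: K P subspace_def linear_0[OF s] linear_add[OF s] linear_scale[OF s])
  then show "subspace (P \<inter> R)" "subspace (K \<inter> R)" using R(1) by (auto intro: subspace_inter)
qed

lemma br_K_P: "k \<in> K \<Longrightarrow> p \<in> P \<Longrightarrow> br k p \<in> P"
  and br_K_K: "k \<in> K \<Longrightarrow> k' \<in> K \<Longrightarrow> br k k' \<in> K"
  and br_P_P: "p \<in> P \<Longrightarrow> p' \<in> P \<Longrightarrow> br p p' \<in> K"
  by (auto simp: K P closed s_br br_simps)

lemma br_R_left: "r \<in> R \<Longrightarrow> x \<in> G \<Longrightarrow> br r x \<in> R"
  using R(3)[of x r] subspace_neg[OF R(1)] br_antisym[of r x] by auto

lemma form_skew: "x \<in> P \<Longrightarrow> y \<in> P \<Longrightarrow> \<Omega> x y = - \<Omega> y x"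
  using form_alt[of "x + y"] form_alt[of x] form_alt[of y] subspace_add[OF subspaces(2)]
  by (simp add: linear_add[OF form_linear(1)] linear_add[OF form_linear(2)])

lemma R_split:
  assumes "r \<in> R" obtains a \<rho> where "a \<in> K \<inter> R" "\<rho> \<in> P \<inter> R" "r = a + \<rho>"
proof -
  have r: "r \<in> G" using assms R(2) by auto
  have "(1/2) *\<^sub>R (r + s r) \<in> K \<inter> R" "(1/2) *\<^sub>R (r - s r) \<in> P \<inter> R"
    using r assms R(4)[OF assms] R(2) s_s[OF r] subspace_add[OF R(1)] subspace_diff[OF R(1)] subspace_scale[OF R(1)]
    by (auto simp: K P linear_add[OF s] linear_diff[OF s] linear_scale[OF s] algebra_simps simp flip: scaleR_minus_right)
  moreover have "r = (1/2) *\<^sub>R (r + s r) + (1/2) *\<^sub>R (r - s r)"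
    by (simp flip: scaleR_add_right scaleR_2)
  ultimately show thesis using that by blast
qed

text \<open>\<open>P\<close> is the sum of the \<open>P\<close>-parts of the components and of \<open>R\<close>: apply the projection \<open>x \<mapsto> (x - s x) / 2\<close> to a decomposition in \<open>G\<close>.\<close>
lemma P_induct [consumes 1, case_names add component radical]:
  assumes "p \<in> P" and add: "\<And>x y. x \<in> P \<Longrightarrow> y \<in> P \<Longrightarrow> Q x \<Longrightarrow> Q y \<Longrightarrow> Q (x + y)"
    and comp: "\<And>c x. c \<in> \<C> \<Longrightarrow> x \<in> P \<Longrightarrow> x \<in> c \<Longrightarrow> Q x" and rad: "\<And>r. r \<in> P \<Longrightarrow> r \<in> R \<Longrightarrow> Q r"
  shows "Q p"
proof -
  have pG: "p \<in> G" using assms(1) by (rule P_sub)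
  obtain f r where fr: "\<forall>c\<in>\<C>. f c \<in> c" "r \<in> R" "p = (\<Sum>c\<in>\<C>. f c) + r" using G_sum[OF pG] by blast
  let ?h = "\<lambda>x. (1/2) *\<^sub>R (x - s x)"
  have hG: "?h x \<in> P" if "x \<in> G" for x
    using that s_in s_s fin_dim_subspaceD[OF G]
    by (auto simp: P linear_diff[OF s] linear_scale[OF s] subspace_diff subspace_scale algebra_simps simp flip: scaleR_minus_right)
  have lh: "linear ?h"
    by (rule linearI) (simp_all add: linear_add[OF s] linear_scale[OF s] algebra_simps)
  have hc: "?h x \<in> c" if "c \<in> \<C>" "x \<in> c" for c x
    using component[OF that(1)] that(2) fin_dim_subspaceD
    by (intro subspace_scale subspace_diff) (auto simp: semisimple_couple_def semisimple_couple_axioms_def)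
  have Qsum: "Q (\<Sum>c\<in>F. ?h (f c)) \<and> (\<Sum>c\<in>F. ?h (f c)) \<in> P" if "F \<subseteq> \<C>" for F
    using finite_subset[OF that finite_components] that
  proof (induction F rule: finite_induct)
    case empty
    then show ?case using rad[of 0] subspace_0[OF R(1)] subspace_0[OF subspaces(2)] by simp
  next
    case (insert c F)
    have "?h (f c) \<in> P" "?h (f c) \<in> c" using hG[of "f c"] hc[of c "f c"] fr(1) component_subset insert.prems by auto
    then show ?case using insert add comp[of c] subspace_add[OF subspaces(2)] by (simp del: scaleR_diff_right)
  qed
  have "?h r \<in> P" "?h r \<in> R" using hG[of r] R fr(2) subspace_diff[OF R(1)] subspace_scale[OF R(1)] by auto
  then have "Q ((\<Sum>c\<in>\<C>. ?h (f c)) + ?h r)" using Qsum[of \<C>] add rad by blast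
  also have "(\<Sum>c\<in>\<C>. ?h (f c)) + ?h r = ?h p"
    unfolding fr(3) linear_add[OF lh] linear_sum[OF lh] ..
  also have "?h p = p" using assms(1) by (simp add: P flip: scaleR_2)
  finally show ?thesis .
qed

text \<open>Invariance moves \<open>a\<close> to the other argument, and then \<open>\<Omega>\<close> pairs two elements of the isotropic subspace \<open>P \<inter> R\<close>.\<close>
lemma radical_K_annihilates_radical_P:
  assumes "a \<in> K \<inter> R" "\<rho> \<in> P \<inter> R"
  shows "br a \<rho> = 0"
proof (rule form_nondeg)
  show "br a \<rho> \<in> P" using assms br_K_P by blast
  fix y assume y: "y \<in> P"
  have "br a y \<in> P \<inter> R" using br_K_P br_R_left assms y P_sub by auto
  then show "\<Omega> (br a \<rho>) y = 0" using form_inv[of a \<rho> y] isotropic assms y by auto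
qed

lemma component_K_P: "c \<in> \<C> \<Longrightarrow> k \<in> K \<inter> c \<Longrightarrow> p \<in> P \<inter> c \<Longrightarrow> br k p \<in> P \<inter> c"
  using br_K_P semisimple_couple.closed[OF component] by blast

text \<open>By invariance, \<open>br k \<rho>\<close> pairs with \<open>y\<close> as \<open>\<rho>\<close> pairs with \<open>br k y\<close>, which is \<open>0\<close> for \<open>y\<close> in other components and lies in
\<open>P \<inter> c\<close> or in \<open>P \<inter> R\<close> otherwise.\<close>
lemma component_K_acts_by_form:
  assumes c: "c \<in> \<C>" and k: "k \<in> K \<inter> c" and \<rho>: "\<rho> \<in> P \<inter> R"
    and orth: "\<And>y. y \<in> P \<inter> c \<Longrightarrow> \<Omega> \<rho> y = 0"
  shows "br k \<rho> = 0"
proof (rule form_nondeg)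
  show "br k \<rho> \<in> P" using br_K_P k \<rho> by blast
  fix y assume "y \<in> P"
  then show "\<Omega> (br k \<rho>) y = 0"
  proof (induction rule: P_induct)
    case (add x y)
    then show ?case by (simp add: linear_add[OF form_linear(1)])
  next
    case (component d x)
    have "\<Omega> \<rho> (br k x) = 0"
    proof (cases "d = c")
      case True
      then show ?thesis using orth component_K_P[OF c k] component by blast
    next
      case False
      then have "br k x = 0" using components_commute[OF c component(1)] k component by blast
      then show ?thesis by (simp add: linear_0[OF form_linear(1)])
    qed
    then show ?case using form_inv[of k \<rho> x] k \<rho> component by simp
  next
    case (radical r)
    then have "br k r \<in> P \<inter> R" using br_K_P R(3) k K_sub by blast
    then show ?case using form_inv[of k \<rho> r] isotropic[OF \<rho>] k \<rho> radical by simp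
  qed
qed

text \<open>Orthogonality first makes \<open>K \<inter> c\<close> kill \<open>P \<inter> R\<close> and \<open>K \<inter> R\<close> kill \<open>P \<inter> c\<close>, by invariance of the form. The two remaining brackets
lie in \<open>K \<inter> R\<close>, where elements are determined by their action on \<open>P\<close>, and this action is zero on every summand of \<open>P\<close>.\<close>
lemma orthogonal_component_commutes_with_radical:
  assumes c: "c \<in> \<C>" and orth: "\<And>\<rho> y. \<rho> \<in> P \<inter> R \<Longrightarrow> y \<in> P \<inter> c \<Longrightarrow> \<Omega> \<rho> y = 0"
    and x: "x \<in> c" and r: "r \<in> R"
  shows "br x r = 0"
proof -
  have Kc: "br k \<rho> = 0" if "k \<in> K \<inter> c" "\<rho> \<in> P \<inter> R" for k \<rho>
    by (rule component_K_acts_by_form[OF c that]) (rule orth[OF that(2)])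
  have Ac: "br a p = 0" if a: "a \<in> K \<inter> R" and p: "p \<in> P \<inter> c" for a p
  proof (rule form_nondeg)
    show "br a p \<in> P" using br_K_P a p by blast
    fix y assume y: "y \<in> P"
    have ay: "br a y \<in> P \<inter> R" using br_K_P br_R_left a y P_sub by auto
    then have "\<Omega> p (br a y) = 0" using orth[OF ay p] form_skew[of p "br a y"] p by auto
    then show "\<Omega> (br a p) y = 0" using form_inv[of a p y] a p y by simp
  qed
  have vanish: "a = 0" if a: "a \<in> K \<inter> R" and *: "\<And>d y. d \<in> \<C> \<Longrightarrow> d \<noteq> c \<Longrightarrow> y \<in> P \<inter> d \<Longrightarrow> br a y = 0" for a
  proof (rule faithful)
    show "a \<in> K" using a by blast
    fix y assume "y \<in> P"
    then show "br a y = 0"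
    proof (induction rule: P_induct)
      case (component d y)
      then show ?case using * Ac[OF a, of y] by (cases "d = c") auto
    next
      case (radical r)
      then show ?case using radical_K_annihilates_radical_P[OF a] by blast
    qed (simp add: br_simps)
  qed
  have Pc: "br p \<rho> = 0" if p: "p \<in> P \<inter> c" and \<rho>: "\<rho> \<in> P \<inter> R" for p \<rho>
  proof (rule vanish)
    show "br p \<rho> \<in> K \<inter> R" using br_P_P R(3) p \<rho> P_sub by blast
    fix d y assume d: "d \<in> \<C>" "d \<noteq> c" and y: "y \<in> P \<inter> d"
    have "br \<rho> y \<in> K \<inter> R" using br_P_P br_R_left \<rho> y P_sub by blast
    then have "br p (br \<rho> y) = 0" using Ac[OF _ p] br_antisym[of p "br \<rho> y"] by simp
    moreover have "br p y = 0" using components_commute[OF c d(1)] d(2) p y by blast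
    ultimately show "br (br p \<rho>) y = 0" by (simp add: br_commutator br_simps)
  qed
  have KcA: "br k a = 0" if k: "k \<in> K \<inter> c" and a: "a \<in> K \<inter> R" for k a
  proof (rule vanish)
    show "br k a \<in> K \<inter> R" using br_K_K R(3) k a K_sub by blast
    fix d y assume d: "d \<in> \<C>" "d \<noteq> c" and y: "y \<in> P \<inter> d"
    have "br a y \<in> P \<inter> R" using br_K_P br_R_left a y P_sub by blast
    then have "br k (br a y) = 0" using Kc[OF k] by blast
    moreover have "br k y = 0" using components_commute[OF c d(1)] d(2) k y by blast
    ultimately show "br (br k a) y = 0" by (simp add: br_commutator br_simps)
  qed
  obtain k p where kp: "k \<in> K \<inter> c" "p \<in> P \<inter> c" "x = k + p"
    using semisimple_couple.K_P_split[OF component[OF c] x] by metis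
  obtain a \<rho> where ar: "a \<in> K \<inter> R" "\<rho> \<in> P \<inter> R" "r = a + \<rho>" using R_split[OF r] by metis
  have "br p a = 0" using Ac[OF ar(1) kp(2)] br_antisym[of p a] by simp
  then show ?thesis using Kc[OF kp(1) ar(2)] KcA[OF kp(1) ar(1)] Pc[OF kp(2) ar(2)]
    by (simp add: kp(3) ar(3) br_simps)
qed

end

text \<open>The additional assumption is what the absence of semisimple factors amounts to, by
\<open>orthogonal_component_is_factor\<close>.\<close>
locale symplectic_no_factor = symplectic_decomposition +
  assumes pairing: "c \<in> \<C> \<Longrightarrow> \<exists>\<rho>\<in>P \<inter> R. \<exists>y\<in>P \<inter> c. \<Omega> \<rho> y \<noteq> 0"
begin

definition moved :: "'a set \<Rightarrow> 'a set" where
  "moved c = bracket_span br (K \<inter> c) (P \<inter> R)"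

lemma br_in_moved: "k \<in> K \<inter> c \<Longrightarrow> \<rho> \<in> P \<inter> R \<Longrightarrow> br k \<rho> \<in> moved c"
  unfolding moved_def bracket_span_def by (rule span_base) blast

lemma moved_subset: "moved c \<subseteq> P \<inter> R"
  unfolding moved_def bracket_span_def
  by (rule span_minimal[OF _ subspaces(3)]) (use br_K_P R(3) K_sub in blast)

lemma subspace_moved: "subspace (moved c)"
  by (simp add: moved_def bracket_span_def)

lemma moved_orthogonal:
  assumes cd: "c \<in> \<C>" "d \<in> \<C>" "c \<noteq> d" and q: "q \<in> moved c" and y: "y \<in> P \<inter> d"
  shows "\<Omega> q y = 0"
proof -
  have "moved c \<subseteq> {q. \<Omega> q y = 0}"
    unfolding moved_def bracket_span_def
  proof (rule span_minimal)
    show "subspace {q. \<Omega> q y = 0}"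
      by (auto simp: subspace_def linear_0[OF form_linear(2)] linear_add[OF form_linear(2)] linear_scale[OF form_linear(2)])
    show "{br k \<rho> |k \<rho>. k \<in> K \<inter> c \<and> \<rho> \<in> P \<inter> R} \<subseteq> {q. \<Omega> q y = 0}"
    proof clarify
      fix k \<rho> assume k: "k \<in> K" "k \<in> c" and \<rho>: "\<rho> \<in> P" "\<rho> \<in> R"
      have "br k y = 0" using components_commute[OF cd] k y by blast
      then show "\<Omega> (br k \<rho>) y = 0" using form_inv[of k \<rho> y] k \<rho> y by (simp add: linear_0[OF form_linear(1)])
    qed
  qed
  then show ?thesis using q by blast
qed

lemma radical_P_eq_0:
  assumes q: "q \<in> P \<inter> R" and orth: "\<And>c y. c \<in> \<C> \<Longrightarrow> y \<in> P \<inter> c \<Longrightarrow> \<Omega> q y = 0"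
  shows "q = 0"
proof (rule form_nondeg)
  show "q \<in> P" using q by blast
  fix y assume "y \<in> P"
  then show "\<Omega> q y = 0"
    by (induction rule: P_induct) (use orth isotropic[OF q] in \<open>auto simp: linear_add[OF form_linear(1)]\<close>)
qed

lemma orthogonal_of_K_fixed:
  assumes c: "c \<in> \<C>" and \<rho>: "\<rho> \<in> P \<inter> R" and "\<And>k. k \<in> K \<inter> c \<Longrightarrow> br k \<rho> = 0" and y: "y \<in> P \<inter> c"
  shows "\<Omega> \<rho> y = 0"
proof (rule semisimple_couple.functional_on_P_vanishes[OF component[OF c] form_linear(1) _ y])
  fix k p assume "k \<in> K \<inter> c" "p \<in> P \<inter> c"
  then show "\<Omega> \<rho> (br k p) = 0" using form_inv[of k \<rho> p] assms by (simp add: linear_0[OF form_linear(2)])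
qed

lemma moved_nonzero: "c \<in> \<C> \<Longrightarrow> \<exists>q\<in>moved c. q \<noteq> 0"
  using orthogonal_of_K_fixed pairing br_in_moved by (metis (no_types, lifting))

lemma moved_other_component:
  assumes "c \<in> \<C>" "d \<in> \<C>" "c \<noteq> d" "k \<in> K \<inter> c" "q \<in> moved d"
  shows "br k q = 0"
  by (rule component_K_acts_by_form[OF assms(1,4)]) (use assms moved_subset moved_orthogonal in blast)+

text \<open>A zero character would make \<open>q\<close> invariant under \<open>K \<inter> c\<close>, hence orthogonal to \<open>P \<inter> c = [K \<inter> c, P \<inter> c]\<close>; as it is orthogonal to the
other summands of \<open>P\<close> anyway, it would vanish.\<close>
lemma line_character:
  assumes c: "c \<in> \<C>" and q: "q \<in> moved c" "q \<noteq> 0" and line: "moved c \<subseteq> span {q}"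
  obtains \<chi> k where "linear \<chi>" "\<And>k. k \<in> K \<inter> c \<Longrightarrow> br k q = \<chi> k *\<^sub>R q" "k \<in> K \<inter> c" "\<chi> k \<noteq> (0::real)"
proof -
  have qPR: "q \<in> P \<inter> R" using q moved_subset by blast
  have ind: "independent {q}" using q(2) by simp
  define \<chi> where "\<chi> k = coord {q} q (br k q)" for k
  have l: "linear \<chi>"
    using linear_compose[OF linear_br_left linear_coord[OF ind]] by (simp add: \<chi>_def[abs_def] o_def)
  have \<chi>: "br k q = \<chi> k *\<^sub>R q" if "k \<in> K \<inter> c" for k
    using coord_expand[OF _ ind, of "br k q"] br_in_moved[OF that qPR] line by (auto simp: \<chi>_def)
  have "\<exists>k\<in>K \<inter> c. \<chi> k \<noteq> 0"
  proof (rule ccontr)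
    assume "\<not> ?thesis"
    then have "\<Omega> q y = 0" if "d \<in> \<C>" "y \<in> P \<inter> d" for d y
      using that orthogonal_of_K_fixed[OF c qPR] moved_orthogonal[OF c _ _ q(1)] \<chi> by (cases "c = d") auto
    then show False using radical_P_eq_0[OF qPR] q(2) by blast
  qed
  then show thesis using that l \<chi> by blast
qed

lemma moved_not_line:
  assumes c: "c \<in> \<C>" and centre: "\<And>z. z \<in> K \<inter> c \<Longrightarrow> (\<And>k. k \<in> K \<inter> c \<Longrightarrow> br z k = 0) \<Longrightarrow> z = 0"
    and q: "q \<in> moved c" "q \<noteq> 0"
  shows "\<not> moved c \<subseteq> span {q}"
proof
  assume "moved c \<subseteq> span {q}"
  then obtain \<chi> k0 where \<chi>: "linear \<chi>" "\<And>k. k \<in> K \<inter> c \<Longrightarrow> br k q = \<chi> k *\<^sub>R q"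
    and k0: "k0 \<in> K \<inter> c" "\<chi> k0 \<noteq> 0"
    by (rule line_character[OF c q]) blast
  interpret semisimple_couple br c "K \<inter> c" "P \<inter> c" s by (rule component[OF c])
  have "\<chi> (br k k') = 0" if k: "k \<in> K \<inter> c" "k' \<in> K \<inter> c" for k k'
  proof -
    have "br k k' \<in> K \<inter> c" using br_K_K k closed by blast
    then have "\<chi> (br k k') *\<^sub>R q = br k (br k' q) - br k' (br k q)" using \<chi>(2) br_commutator by metis
    also have "\<dots> = 0"
      by (simp only: \<chi>(2)[OF k(1)] \<chi>(2)[OF k(2)] br_scale_right) (simp add: mult.commute)
    finally show ?thesis using q(2) by simp
  qed
  from centre_of_character[OF \<chi>(1) this k0] centre show False by metis
qed

text \<open>A vector that lies both in \<open>moved c\<close> and in the span of the other \<open>moved d\<close> is orthogonal to every component, hence zero. So bases of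
independent pieces can be put together one component at a time.\<close>
lemma independent_choice:
  assumes "F \<subseteq> \<C>" and "\<And>c. c \<in> F \<Longrightarrow> \<exists>B\<subseteq>moved c. independent B \<and> finite B \<and> card B = n c"
  shows "\<exists>B\<subseteq>(\<Union>c\<in>F. moved c). independent B \<and> finite B \<and> card B = (\<Sum>c\<in>F. n c)"
  using finite_subset[OF assms(1) finite_components] assms
proof (induction F rule: finite_induct)
  case empty
  then show ?case by (auto intro!: exI[of _ "{}"] simp: independent_empty)
next
  case (insert c F)
  then obtain B where B: "B \<subseteq> (\<Union>c\<in>F. moved c)" "independent B" "finite B" "card B = (\<Sum>c\<in>F. n c)" by auto
  obtain B' where B': "B' \<subseteq> moved c" "independent B'" "finite B'" "card B' = n c" using insert.prems(2)[of c] by auto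
  have cC: "c \<in> \<C>" using insert.prems by blast
  have 1: "span B' \<subseteq> moved c" by (rule span_minimal[OF B'(1) subspace_moved])
  have 2: "\<Omega> q y = 0" if q: "q \<in> span B" and y: "y \<in> P \<inter> c" for q y
  proof -
    have "span B \<subseteq> {q. \<Omega> q y = 0}"
    proof (rule span_minimal)
      show "subspace {q. \<Omega> q y = 0}"
        by (auto simp: subspace_def linear_0[OF form_linear(2)] linear_add[OF form_linear(2)] linear_scale[OF form_linear(2)])
      show "B \<subseteq> {q. \<Omega> q y = 0}"
        using B(1) moved_orthogonal[OF _ cC _ _ y] insert.prems(1) insert.hyps(2) by blast
    qed
    then show ?thesis using q by blast
  qed
  have "span B \<inter> span B' \<subseteq> {0}"
  proof clarify
    fix q assume q: "q \<in> span B" "q \<in> span B'"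
    have "\<Omega> q y = 0" if "d \<in> \<C>" "y \<in> P \<inter> d" for d y
    proof (cases "c = d")
      case True
      then show ?thesis using 2[OF q(1)] that by blast
    next
      case False
      then show ?thesis using moved_orthogonal[OF cC that(1)] 1 q(2) that by blast
    qed
    then show "q = 0" using radical_P_eq_0 1 q(2) moved_subset by blast
  qed
  note ind = independent_Un_of_span_Int[OF B(3,2) B'(3,2) this]
  then show ?case using B B' insert.hyps
    by (intro exI[of _ "B \<union> B'"]) (auto simp: card_Un_disjoint)
qed

section \<open>The dimension estimate\<close>

text \<open>The trace of \<open>ad x\<close> on the ideal \<open>R\<close> vanishes on brackets, and \<open>c\<close> is perfect.\<close>
lemma component_trace_on_radical:
  assumes c: "c \<in> \<C>" and z: "z \<in> c"
  shows "trace_on R (br z) = 0"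
proof -
  interpret semisimple_couple br c "K \<inter> c" "P \<inter> c" s by (rule component[OF c])
  have fR: "fin_dim_subspace R" by (rule fin_dim_subspace_subset[OF G R(1,2)])
  show ?thesis
  proof (rule semisimple_functional_vanishes[OF V closed ss _ _ z])
    show "linear (\<lambda>x. trace_on R (br x))"
      by (rule linearI)
        (simp_all add: br_add_left[abs_def] br_scale_left[abs_def] trace_on_add[OF fR] trace_on_scale[OF fR])
    fix x y assume xy: "x \<in> c" "y \<in> c"
    then have G: "x \<in> G" "y \<in> G" using component_subset[OF c] by auto
    have "trace_on R (\<lambda>v. br x (br y v)) = trace_on R (\<lambda>v. br y (br x v))"
      by (rule trace_on_cyclic[OF fR fR linear_br _ linear_br]) (use G R(3) in auto)
    then show "trace_on R (br (br x y)) = 0"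
      by (simp add: br_commutator[abs_def] trace_on_diff[OF fR])
  qed
qed

text \<open>The contradiction is between \<open>component_trace_on_radical\<close> and the eigenvalues of \<open>ad z\<close> on \<open>R\<close>, for an element \<open>z\<close> that acts on
\<open>P \<inter> R\<close> as the projection to one of the lines. On \<open>P \<inter> R\<close> they are \<open>0\<close> and \<open>1\<close>. An element \<open>a\<close> of \<open>K \<inter> R\<close> is known through
\<open>x \<mapsto> [a, x]\<close>, a map from \<open>P\<close> to \<open>P \<inter> R\<close>; there \<open>ad z\<close> acts as the sum of the two commuting operations
\<open>x \<mapsto> [z, [a, x]]\<close> and \<open>x \<mapsto> - [a, [z, x]]\<close>. The first is idempotent, and so is the second by symmetry of
\<open>\<Omega>([a, x], y)\<close> in \<open>x\<close> and \<open>y\<close>; hence \<open>T (T - 1) (T - 2) = 0\<close> for the operator \<open>T = ad z\<close> on \<open>K \<inter> R\<close>.\<close>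
lemma moved_lines_impossible:
  assumes ne: "\<C> \<noteq> {}"
    and q: "\<And>c. c \<in> \<C> \<Longrightarrow> q c \<in> moved c \<and> q c \<noteq> 0 \<and> moved c \<subseteq> span {q c}"
    and PR: "P \<inter> R \<subseteq> span (\<Union>c\<in>\<C>. moved c)"
  shows False
proof -
  obtain c where c: "c \<in> \<C>" using ne by blast
  obtain \<chi> k where \<chi>: "linear \<chi>" "\<And>k. k \<in> K \<inter> c \<Longrightarrow> br k (q c) = \<chi> k *\<^sub>R q c" "k \<in> K \<inter> c" "\<chi> k \<noteq> (0::real)"
    by (rule line_character[OF c, of "q c"]) (use q[OF c] in blast)+
  \<comment> \<open>Normalised to have eigenvalue \<open>1\<close> on the line of \<open>c\<close>.\<close>
  define z where "z = (1 / \<chi> k) *\<^sub>R k"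
  interpret couple: semisimple_couple br c "K \<inter> c" "P \<inter> c" s by (rule component[OF c])
  have z: "z \<in> K \<inter> c"
    unfolding z_def by (rule subspace_scale[OF couple.K_subspace \<chi>(3)])
  have zq: "br z (q c) = q c" using \<chi>(2)[OF \<chi>(3)] \<chi>(4) by (simp add: z_def br_scale_left)
  have zK: "z \<in> K" and zG: "z \<in> G" using z K_sub by auto
  have zPR: "br z \<rho> \<in> P \<inter> R" if "\<rho> \<in> P \<inter> R" for \<rho> using that br_K_P R(3) zK zG by blast
  have zz: "br z (br z \<rho>) = br z \<rho>" if "\<rho> \<in> P \<inter> R" for \<rho>
  proof -
    have "span (\<Union>c\<in>\<C>. moved c) \<subseteq> {\<rho>. br z (br z \<rho>) = br z \<rho>}"
    proof (rule span_minimal)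
      show "subspace {\<rho>. br z (br z \<rho>) = br z \<rho>}" by (auto simp: subspace_def br_simps)
      show "(\<Union>c\<in>\<C>. moved c) \<subseteq> {\<rho>. br z (br z \<rho>) = br z \<rho>}"
      proof clarify
        fix d u assume d: "d \<in> \<C>" and u: "u \<in> moved d"
        show "br z (br z u) = br z u"
        proof (cases "d = c")
          case True
          then obtain r where "u = r *\<^sub>R q c" using q[OF c] u span_singleton by blast
          then show ?thesis by (simp add: br_simps zq)
        next
          case False
          then have "br z u = 0" using moved_other_component[OF c d _ z u] by blast
          then show ?thesis by (simp add: br_simps)
        qed
      qed
    qed
    then show ?thesis using that PR by blast
  qed
  \<comment> \<open>Idempotency of \<open>x \<mapsto> - [a, [z, x]]\<close>, transported from \<open>zz\<close> by moving \<open>a\<close> and \<open>z\<close> across the form.\<close>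
  have azz: "br a (br z (br z x)) = - br a (br z x)" if a: "a \<in> K \<inter> R" and x: "x \<in> P" for a x
  proof -
    have in_P: "br z x \<in> P" "br z (br z x) \<in> P" "br a (br z x) \<in> P" "br a (br z (br z x)) \<in> P"
      using br_K_P zK x a by blast+
    have "br a (br z (br z x)) + br a (br z x) = 0"
    proof (rule form_nondeg)
      show "br a (br z (br z x)) + br a (br z x) \<in> P" by (rule subspace_add[OF subspaces(2) in_P(4,3)])
      fix y assume y: "y \<in> P"
      have ay: "br a y \<in> P \<inter> R" using br_K_P br_R_left a y P_sub by blast
      have zay: "br z (br a y) \<in> P" "br z (br z (br a y)) \<in> P" using ay zPR by blast+
      have aK: "a \<in> K" and ayP: "br a y \<in> P" using a ay by auto
      have "\<Omega> (br a (br z (br z x))) y = - \<Omega> (br z (br z x)) (br a y)"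
        by (rule form_inv[OF aK in_P(2) y])
      also have "\<dots> = \<Omega> (br z x) (br z (br a y))"
        using form_inv[OF zK in_P(1) ayP] by simp
      also have "\<dots> = - \<Omega> x (br z (br z (br a y)))"
        by (rule form_inv[OF zK x zay(1)])
      also have "\<dots> = - \<Omega> x (br z (br a y))" by (simp only: zz[OF ay])
      also have "\<dots> = \<Omega> (br z x) (br a y)" using form_inv[OF zK x ayP] by simp
      also have "\<dots> = - \<Omega> (br a (br z x)) y" using form_inv[OF aK in_P(1) y] by simp
      finally show "\<Omega> (br a (br z (br z x)) + br a (br z x)) y = 0"
        by (simp add: linear_add[OF form_linear(2)])
    qed
    then show ?thesis by (simp add: eq_neg_iff_add_eq_0)
  qed
  have three: "3 *\<^sub>R v = v + v + v" for v :: 'a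
    using scaleR_add_left[of 2 1 v] by (simp add: scaleR_2)
  \<comment> \<open>\<open>T (T - 1) (T - 2) = 0\<close> expanded, where \<open>T\<close> is the action of \<open>z\<close>.\<close>
  have cubic: "br z (br z (br z a)) = 3 *\<^sub>R br z (br z a) - 2 *\<^sub>R br z a" if a: "a \<in> K \<inter> R" for a
  proof -
    have zK': "br z b \<in> K" if "b \<in> K" for b using br_K_K zK that by blast
    have aK: "a \<in> K" using a by blast
    have "br z (br z (br z a)) - 3 *\<^sub>R br z (br z a) + 2 *\<^sub>R br z a = 0"
    proof (rule faithful)
      show "br z (br z (br z a)) - 3 *\<^sub>R br z (br z a) + 2 *\<^sub>R br z a \<in> K"
        using zK'[OF zK'[OF zK'[OF aK]]] zK'[OF zK'[OF aK]] zK'[OF aK]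
        by (intro subspace_add[OF subspaces(1)] subspace_diff[OF subspaces(1)] subspace_scale[OF subspaces(1)])
      fix x assume x: "x \<in> P"
      have 1: "br z (br z (br a x)) = br z (br a x)" if "x \<in> P" for x
        using zz[of "br a x"] br_K_P[OF aK that] br_R_left[of a x] a that P_sub by blast
      have zx: "br z x \<in> P" "br z (br z x) \<in> P" using br_K_P zK x by blast+
      have t1: "br (br z a) x = br z (br a x) - br a (br z x)" for x by (rule br_commutator)
      have t2: "br (br z (br z a)) x = br z (br a x) - 2 *\<^sub>R br z (br a (br z x)) - br a (br z x)" if "x \<in> P" for x
        by (simp add: br_commutator[of z "br z a"] t1 linear_diff[OF linear_br] 1[OF that] azz[OF a that] scaleR_2)
      have six: "6 *\<^sub>R v = v + v + v + v + v + v" for v :: 'a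
        using scaleR_add_left[of 3 3 v] scaleR_add_left[of 2 1 v] by (simp add: scaleR_2 add_ac)
      have t3: "br (br z (br z (br z a))) x = br z (br a x) - 6 *\<^sub>R br z (br a (br z x)) - br a (br z x)"
        unfolding br_commutator[of z "br z (br z a)"] t2[OF x] t2[OF zx(1)]
        by (simp add: linear_diff[OF linear_br] br_scale_right 1[OF x] 1[OF zx(1)] azz[OF a x] linear_neg[OF linear_br] algebra_simps)
          (simp add: six br_add_right 1[OF zx(1)] scaleR_2 add_ac)
      show "br (br z (br z (br z a)) - 3 *\<^sub>R br z (br z a) + 2 *\<^sub>R br z a) x = 0"
        by (simp add: br_add_left br_scale_left linear_diff[OF linear_br_left] t1 t2[OF x] t3 algebra_simps)
          (simp add: three scaleR_2)
    qed
    then show ?thesis by (simp add: algebra_simps)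
  qed
  \<comment> \<open>Eigenvectors with non-negative eigenvalues; they will be shown to span \<open>R\<close>.\<close>
  define X where "X = {v \<in> R. \<exists>n::nat. br z v = real n *\<^sub>R v}"
  have "P \<inter> R \<subseteq> span X"
  proof
    fix \<rho> assume \<rho>: "\<rho> \<in> P \<inter> R"
    have "br z \<rho> \<in> X" using zz[OF \<rho>] zPR[OF \<rho>] by (auto simp: X_def intro!: exI[of _ 1])
    moreover have "\<rho> - br z \<rho> \<in> X"
      using zz[OF \<rho>] zPR[OF \<rho>] \<rho> subspace_diff[OF R(1)] by (auto simp: X_def br_simps intro!: exI[of _ 0])
    ultimately have "br z \<rho> + (\<rho> - br z \<rho>) \<in> span X" by (intro span_add span_base)
    then show "\<rho> \<in> span X" by simp
  qed
  moreover have "K \<inter> R \<subseteq> span X"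
  proof
    fix a assume a: "a \<in> K \<inter> R"
    note cub = cubic[OF a]
    have zR: "br z v \<in> R" if "v \<in> R" for v using R(3) zG that by blast
    have aR: "a \<in> R" "br z a \<in> R" "br z (br z a) \<in> R" using a zR by blast+
    note sub = subspace_diff[OF R(1)] subspace_add[OF R(1)] subspace_scale[OF R(1)]
    \<comment> \<open>The vectors \<open>(T - 1) (T - 2) a\<close>, \<open>T (T - 2) a\<close> and \<open>T (T - 1) a\<close>, for the eigenvalues \<open>0\<close>, \<open>1\<close> and \<open>2\<close>; Lagrange interpolation recovers \<open>a\<close>.\<close>
    let ?a0 = "br z (br z a) - 3 *\<^sub>R br z a + 2 *\<^sub>R a"
    let ?a1 = "br z (br z a) - 2 *\<^sub>R br z a" and ?a2 = "br z (br z a) - br z a"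
    have "?a0 \<in> X" using aR sub
      by (auto simp: X_def br_simps cub algebra_simps intro!: exI[of _ 0])
    moreover have "?a1 \<in> X"
    proof -
      have "br z ?a1 = real 1 *\<^sub>R ?a1" by (simp add: br_simps cub) (simp add: algebra_simps three scaleR_2)
      then show ?thesis using aR sub unfolding X_def by blast
    qed
    moreover have "?a2 \<in> X"
    proof -
      have "br z ?a2 = real 2 *\<^sub>R ?a2" by (simp add: br_simps cub) (simp add: algebra_simps three scaleR_2)
      then show ?thesis using aR sub unfolding X_def by blast
    qed
    ultimately have "(1/2) *\<^sub>R ?a0 - ?a1 + (1/2) *\<^sub>R ?a2 \<in> span X"
      by (intro span_add span_diff span_scale span_base)
    also have "(1/2) *\<^sub>R ?a0 - ?a1 + (1/2) *\<^sub>R ?a2 = a"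
      by (simp add: algebra_simps) (simp flip: scaleR_add_left)
    finally show "a \<in> span X" .
  qed
  ultimately have RX: "R \<subseteq> span X"
  proof -
    have "r \<in> span X" if "r \<in> R" for r
    proof -
      obtain a \<rho> where "a \<in> K \<inter> R" "\<rho> \<in> P \<inter> R" "r = a + \<rho>" using R_split[OF \<open>r \<in> R\<close>] by metis
      then show ?thesis using \<open>P \<inter> R \<subseteq> span X\<close> \<open>K \<inter> R \<subseteq> span X\<close> by (auto intro: span_add)
    qed
    then show ?thesis by blast
  qed
  have fR: "fin_dim_subspace R" by (rule fin_dim_subspace_subset[OF G R(1,2)])
  obtain B where B: "B \<subseteq> X" "finite B" "independent B" "span B = R"
    using basis_within[OF fR _ RX] unfolding X_def by (metis (no_types, lifting) mem_Collect_eq subsetI)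
  define ev where "ev b = (SOME n. br z b = real n *\<^sub>R b)" for b
  have ev: "br z b = real (ev b) *\<^sub>R b" if "b \<in> B" for b
    unfolding ev_def by (rule someI_ex) (use B(1) that in \<open>auto simp: X_def\<close>)
  have "(\<Sum>b\<in>B. real (ev b)) = trace_on R (br z)"
    by (rule trace_on_eigenbasis[OF B(2-4) linear_br ev, symmetric])
  also have "\<dots> = 0" using component_trace_on_radical[OF c] z by blast
  finally have "\<forall>b\<in>B. real (ev b) = 0"
    using sum_nonneg_eq_0_iff[OF B(2), of "\<lambda>b. real (ev b)"] by simp
  then have "\<And>b. b \<in> B \<Longrightarrow> br z b = 0" using ev by simp
  moreover have "q c \<in> span B" using q[OF c] moved_subset B(4) by blast
  ultimately have "br z (q c) = 0" using linear_eq_0_on_span[OF linear_br] by blast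
  then show False using zq q[OF c] by simp
qed

lemma radical_trivial_of_P_part: "P \<inter> R = {0} \<Longrightarrow> R = {0}"
proof -
  assume PR: "P \<inter> R = {0}"
  have "r = 0" if "r \<in> R" for r
  proof -
    obtain a \<rho> where ar: "a \<in> K \<inter> R" "\<rho> \<in> P \<inter> R" "r = a + \<rho>" using R_split[OF \<open>r \<in> R\<close>] by metis
    have "a = 0"
    proof (rule faithful)
      fix p assume "p \<in> P"
      then have "br a p \<in> P \<inter> R" using br_K_P br_R_left ar P_sub by blast
      then show "br a p = 0" using PR by blast
    qed (use ar in blast)
    then show ?thesis using ar PR by auto
  qed
  then show ?thesis using subspace_0[OF R(1)] by blast
qed

definition centreless :: "'a set \<Rightarrow> bool" where
  "centreless c \<longleftrightarrow> (\<forall>z\<in>K \<inter> c. (\<forall>k\<in>K \<inter> c. br z k = 0) \<longrightarrow> z = 0)"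

text \<open>Both parts count dimensions with \<open>independent_choice\<close>. The first takes two vectors from each centreless component and one from
the others. For the second, equality leaves room for only one vector in each component, so that the \<open>moved c\<close> are lines whose span
is all of \<open>P \<inter> R\<close>. If there is no component at all, \<open>P \<inter> R\<close> is zero, and then so is \<open>R\<close>.\<close>
lemma dim_bounds:
  assumes R0: "R \<noteq> {0}"
  defines "A \<equiv> card {c \<in> \<C>. centreless c}" and "I \<equiv> card {c \<in> \<C>. \<not> centreless c}"
  shows "2 * A + I \<le> dim (P \<inter> R)" "I \<noteq> dim (P \<inter> R)"
proof -
  have fPR: "fin_dim_subspace (P \<inter> R)"
    by (rule fin_dim_subspace_subset[OF G subspaces(3)]) (use R(2) in auto)
  obtain q where q: "\<And>c. c \<in> \<C> \<Longrightarrow> q c \<in> moved c \<and> q c \<noteq> 0" using moved_nonzero by metis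
  have one: "\<exists>B\<subseteq>moved c. independent B \<and> finite B \<and> card B = 1" if "c \<in> \<C>" for c
    using q[OF that] by (intro exI[of _ "{q c}"]) simp
  have two: "\<exists>B\<subseteq>moved c. independent B \<and> finite B \<and> card B = 2" if c: "c \<in> \<C>" and nl: "\<not> moved c \<subseteq> span {q c}" for c
  proof -
    obtain v where v: "v \<in> moved c" "v \<notin> span {q c}" using nl by blast
    have "v \<noteq> q c" using v(2) span_base[of "q c" "{q c}"] by auto
    moreover have "independent {v, q c}" using v(2) q[OF c] by (simp add: independent_insertI)
    ultimately show ?thesis using v q[OF c] by (intro exI[of _ "{v, q c}"]) simp
  qed
  have sum_le: "(\<Sum>c\<in>\<C>. n c) \<le> dim (P \<inter> R)"
    if n: "\<And>c. c \<in> \<C> \<Longrightarrow> \<exists>B\<subseteq>moved c. independent B \<and> finite B \<and> card B = n c" for n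
  proof -
    obtain B where "B \<subseteq> (\<Union>c\<in>\<C>. moved c)" "independent B" "finite B" "card B = (\<Sum>c\<in>\<C>. n c)"
      using independent_choice[OF subset_refl n] by blast
    then show ?thesis using independent_imp_finite_card_le_dim[OF fPR, of B] moved_subset by fastforce
  qed
  have AI: "card \<C> = A + I"
  proof -
    have "\<C> = {c \<in> \<C>. centreless c} \<union> {c \<in> \<C>. \<not> centreless c}" by blast
    then show ?thesis unfolding A_def I_def using finite_components
      by (metis (no_types, lifting) card_Un_disjoint disjoint_iff finite_Un mem_Collect_eq)
  qed
  have "(\<Sum>c\<in>\<C>. if centreless c then 2 else 1) \<le> dim (P \<inter> R)"
  proof (rule sum_le)
    fix c assume c: "c \<in> \<C>"
    show "\<exists>B\<subseteq>moved c. independent B \<and> finite B \<and> card B = (if centreless c then 2 else 1)"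
    proof (cases "centreless c")
      case True
      then have "\<not> moved c \<subseteq> span {q c}"
        by (intro moved_not_line[OF c]) (use q[OF c] in \<open>auto simp: centreless_def\<close>)
      then show ?thesis using two[OF c] True by simp
    qed (use one[OF c] in simp)
  qed
  also have "(\<Sum>c\<in>\<C>. if centreless c then 2 else 1) = 2 * A + I"
    unfolding A_def I_def using finite_components
    by (subst sum.If_cases) (simp_all add: Int_def conj_commute)
  finally show le: "2 * A + I \<le> dim (P \<inter> R)" .
  show "I \<noteq> dim (P \<inter> R)"
  proof
    assume I: "I = dim (P \<inter> R)"
    then have card: "card \<C> = dim (P \<inter> R)" using le AI by simp
    have line: "moved c \<subseteq> span {q c}" if c: "c \<in> \<C>" for c
    proof (rule ccontr)
      assume nl: "\<not> moved c \<subseteq> span {q c}"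
      have "(\<Sum>d\<in>\<C>. if d = c then 2 else 1) \<le> dim (P \<inter> R)"
        by (rule sum_le) (use two[OF _ nl] one in auto)
      moreover have "(\<Sum>d\<in>\<C>. if d = c then 2 else 1) = card \<C> + (1::nat)"
      proof -
        have "(\<Sum>d\<in>\<C>. if d = c then 2 else 1) = (\<Sum>d\<in>\<C>. 1 + (if d = c then 1 else (0::nat)))"
          by (rule sum.cong) auto
        also have "\<dots> = card \<C> + 1" unfolding sum.distrib using finite_components c by simp
        finally show ?thesis .
      qed
      ultimately show False using card by simp
    qed
    obtain B where B: "B \<subseteq> (\<Union>c\<in>\<C>. moved c)" "independent B" "finite B" "card B = (\<Sum>c\<in>\<C>. 1)"
      using independent_choice[OF subset_refl one] by blast
    have BPR: "B \<subseteq> P \<inter> R" using B(1) moved_subset by blast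
    have "span B = P \<inter> R"
    proof (rule subspace_eq_of_dim_le[OF fPR subspace_span])
      show "span B \<subseteq> P \<inter> R" by (rule span_minimal[OF BPR subspaces(3)])
      show "dim (P \<inter> R) \<le> dim (span B)" using B card dim_span_eq_card_independent[OF B(2)] by simp
    qed
    then have "P \<inter> R \<subseteq> span (\<Union>c\<in>\<C>. moved c)" using span_mono[OF B(1)] by simp
    moreover have "\<C> \<noteq> {}"
    proof
      assume "\<C> = {}"
      then have "B = {}" using B(1) by simp
      then have "P \<inter> R = {0}" using \<open>span B = P \<inter> R\<close> by simp
      then show False using radical_trivial_of_P_part R0 by blast
    qed
    ultimately show False using moved_lines_impossible[of q] q line by blast
  qed
qed

end

section \<open>Changing the structure maps outside the carrier\<close>

lemma lie_algebra_fin_dim: "lie_algebra g br \<Longrightarrow> fin_dim_subspace g"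
  unfolding lie_algebra_def fin_dim_subspace_def by (metis subspace_span order_refl)

text \<open>The notions of the statement depend on the bracket, the involution and the form only through their values on the carrier. This
allows them to be replaced by globally linear extensions.\<close>
lemma lie_algebra_cong:
  assumes g: "lie_algebra g br'" and eq: "\<And>x y. x \<in> g \<Longrightarrow> y \<in> g \<Longrightarrow> br x y = br' x y"
  shows "lie_algebra g br"
proof -
  have s: "subspace g" using fin_dim_subspaceD[OF lie_algebra_fin_dim[OF g]] .
  show ?thesis
    using g subspace_add[OF s] subspace_scale[OF s]
    unfolding lie_algebra_def bilinear_on_def by (simp add: eq)
qed

lemma symmetric_couple_cong:
  assumes g: "symmetric_couple g br' \<sigma>'" and eq: "\<And>x y. x \<in> g \<Longrightarrow> y \<in> g \<Longrightarrow> br x y = br' x y"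
    and eq_s: "\<And>x. x \<in> g \<Longrightarrow> \<sigma> x = \<sigma>' x"
  shows "symmetric_couple g br \<sigma>"
proof -
  have la: "lie_algebra g br'" and inv: "involutive_automorphism g br' \<sigma>'"
    using g by (auto simp: symmetric_couple_def)
  have s: "subspace g" using fin_dim_subspaceD[OF lie_algebra_fin_dim[OF la]] .
  have KP: "K_part g \<sigma> = K_part g \<sigma>'" "P_part g \<sigma> = P_part g \<sigma>'"
    by (auto simp: K_part_def P_part_def eq_s)
  have sub: "K_part g \<sigma>' \<subseteq> g" "P_part g \<sigma>' \<subseteq> g" by (auto simp: K_part_def P_part_def)
  have "{br x y |x y. x \<in> P_part g \<sigma>' \<and> y \<in> P_part g \<sigma>'} = {br' x y |x y. x \<in> P_part g \<sigma>' \<and> y \<in> P_part g \<sigma>'}"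
    using sub(2) eq by (metis (no_types, lifting) subsetD)
  then have "bracket_span br (P_part g \<sigma>') (P_part g \<sigma>') = K_part g \<sigma>'"
    using g by (simp add: symmetric_couple_def bracket_span_def)
  moreover have "involutive_automorphism g br \<sigma>"
    using inv la subspace_add[OF s] subspace_scale[OF s]
    unfolding involutive_automorphism_def lie_algebra_def by (simp add: eq eq_s)
  moreover have "\<forall>k\<in>K_part g \<sigma>'. (\<forall>p\<in>P_part g \<sigma>'. br k p = 0) \<longrightarrow> k = 0"
    using g sub eq unfolding symmetric_couple_def by (metis subsetD)
  ultimately show ?thesis
    using lie_algebra_cong[OF la eq] by (simp add: symmetric_couple_def KP)
qed

lemma symplectic_symmetric_triple_cong:
  assumes g: "symplectic_symmetric_triple g br' \<sigma>' \<Omega>'"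
    and eq: "\<And>x y. x \<in> g \<Longrightarrow> y \<in> g \<Longrightarrow> br x y = br' x y"
    and eq_s: "\<And>x. x \<in> g \<Longrightarrow> \<sigma> x = \<sigma>' x"
    and eq_f: "\<And>x y. x \<in> P_part g \<sigma>' \<Longrightarrow> y \<in> P_part g \<sigma>' \<Longrightarrow> \<Omega> x y = \<Omega>' x y"
  shows "symplectic_symmetric_triple g br \<sigma> \<Omega>"
proof -
  have c: "symmetric_couple g br' \<sigma>'" using g by (simp add: symplectic_symmetric_triple_def)
  then have la: "lie_algebra g br'" and inv: "involutive_automorphism g br' \<sigma>'"
    by (auto simp: symmetric_couple_def)
  have s: "subspace g" using fin_dim_subspaceD[OF lie_algebra_fin_dim[OF la]] .
  have KP: "K_part g \<sigma> = K_part g \<sigma>'" "P_part g \<sigma> = P_part g \<sigma>'"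
    by (auto simp: K_part_def P_part_def eq_s)
  have sub: "K_part g \<sigma>' \<subseteq> g" "P_part g \<sigma>' \<subseteq> g" by (auto simp: K_part_def P_part_def)
  have add: "x + y \<in> P_part g \<sigma>'" if "x \<in> P_part g \<sigma>'" "y \<in> P_part g \<sigma>'" for x y
    using that inv subspace_add[OF s] by (auto simp: P_part_def involutive_automorphism_def)
  have scale: "a *\<^sub>R x \<in> P_part g \<sigma>'" if "x \<in> P_part g \<sigma>'" for x a
    using that inv subspace_scale[OF s] by (auto simp: P_part_def involutive_automorphism_def)
  have kp: "br' k x \<in> P_part g \<sigma>'" if "k \<in> K_part g \<sigma>'" "x \<in> P_part g \<sigma>'" for k x
  proof -
    have kx: "k \<in> g" "\<sigma>' k = k" "x \<in> g" "\<sigma>' x = - x" using that by (auto simp: K_part_def P_part_def)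
    have "br' k ((-1) *\<^sub>R x) = (-1) *\<^sub>R br' k x"
      using la kx unfolding lie_algebra_def bilinear_on_def by blast
    moreover have "\<sigma>' (br' k x) = br' k (- x)" using inv kx by (simp add: involutive_automorphism_def)
    ultimately show ?thesis using la kx by (simp add: P_part_def lie_algebra_def)
  qed
  have "symplectic_form_on (P_part g \<sigma>') \<Omega>"
    using g eq_f add scale
    unfolding symplectic_symmetric_triple_def symplectic_form_on_def bilinear_on_def by simp
  moreover have "\<forall>k\<in>K_part g \<sigma>'. \<forall>x\<in>P_part g \<sigma>'. \<forall>y\<in>P_part g \<sigma>'. \<Omega> (br k x) y + \<Omega> x (br k y) = 0"
  proof (intro ballI)
    fix k x y assume kxy: "k \<in> K_part g \<sigma>'" "x \<in> P_part g \<sigma>'" "y \<in> P_part g \<sigma>'"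
    then have "br k x = br' k x" "br k y = br' k y" using sub eq by auto
    then show "\<Omega> (br k x) y + \<Omega> x (br k y) = 0"
      using kxy eq_f kp g by (simp add: symplectic_symmetric_triple_def)
  qed
  ultimately show ?thesis
    using symmetric_couple_cong[OF c eq eq_s] by (simp add: symplectic_symmetric_triple_def KP)
qed

lemma derived_series_cong:
  assumes h: "subspace h" "\<And>x y. x \<in> h \<Longrightarrow> y \<in> h \<Longrightarrow> br x y \<in> h"
    and eq: "\<And>x y. x \<in> h \<Longrightarrow> y \<in> h \<Longrightarrow> br x y = br' x y"
  shows "derived_series h br n = derived_series h br' n \<and> derived_series h br n \<subseteq> h"
proof (induction n)
  case (Suc n)
  let ?D = "derived_series h br n"
  have D: "?D \<subseteq> h" using Suc by blast
  have "{br x y |x y. x \<in> ?D \<and> y \<in> ?D} = {br' x y |x y. x \<in> ?D \<and> y \<in> ?D}"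
    using D eq by (metis (no_types, lifting) subsetD)
  moreover have "span {br x y |x y. x \<in> ?D \<and> y \<in> ?D} \<subseteq> h"
    by (rule span_minimal[OF _ h(1)]) (use D h(2) in blast)
  ultimately show ?case using Suc by (simp add: bracket_span_def)
qed simp

lemma lie_radical_cong:
  assumes eq: "\<And>x y. x \<in> g \<Longrightarrow> y \<in> g \<Longrightarrow> br x y = br' x y"
  shows "lie_radical g br = lie_radical g br'"
proof -
  have "lie_ideal h g br \<and> lie_solvable h br \<longleftrightarrow> lie_ideal h g br' \<and> lie_solvable h br'" for h
  proof -
    have 1: "lie_ideal h g br \<longleftrightarrow> lie_ideal h g br'"
      unfolding lie_ideal_def by (metis (no_types, lifting) eq subsetD)
    have "lie_solvable h br \<longleftrightarrow> lie_solvable h br'" if "lie_ideal h g br"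
    proof -
      have h: "subspace h" "\<And>x y. x \<in> h \<Longrightarrow> y \<in> h \<Longrightarrow> br x y \<in> h" "h \<subseteq> g"
        using that by (auto simp: lie_ideal_def)
      have "br x y = br' x y" if "x \<in> h" "y \<in> h" for x y using that h(3) eq by auto
      then have "derived_series h br n = derived_series h br' n" for n
        using derived_series_cong[OF h(1,2), where br' = br' and n = n] by simp
      then show ?thesis by (simp add: lie_solvable_def)
    qed
    then show ?thesis using 1 by blast
  qed
  then show ?thesis by (simp add: lie_radical_def)
qed

lemma fin_dim_projection:
  assumes "fin_dim_subspace V"
  obtains \<pi> where "linear \<pi>" "\<And>x. \<pi> x \<in> V" "\<And>x. x \<in> V \<Longrightarrow> \<pi> x = x"
proof -
  obtain B where B: "independent B" "span B = V" using finite_basis[OF assms] by metis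
  have l: "linear (construct B (\<lambda>x. x))" by (rule linear_construct[OF B(1)])
  show thesis
  proof (rule that[OF l])
    show "construct B (\<lambda>x. x) x \<in> V" for x using construct_in_span[OF B(1), of "\<lambda>x. x" x] B(2) by simp
    show "construct B (\<lambda>x. x) x = x" if "x \<in> V" for x
      using linear_eq_on[OF l linear_id, of x B] that B by (simp add: construct_basis[OF B(1)])
  qed
qed

lemma lie_bracket_extension:
  assumes la: "lie_algebra g br" and \<pi>: "linear \<pi>" "\<And>x. \<pi> x \<in> g" "\<And>x. x \<in> g \<Longrightarrow> \<pi> x = x"
  shows "lie_bracket (\<lambda>x y. br (\<pi> x) (\<pi> y))"
proof
  have bil: "bilinear_on g br" and cl: "\<And>x y. x \<in> g \<Longrightarrow> y \<in> g \<Longrightarrow> br x y \<in> g"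
    using la by (auto simp: lie_algebra_def)
  fix x y z :: 'a and c
  show "br (\<pi> (x + y)) (\<pi> z) = br (\<pi> x) (\<pi> z) + br (\<pi> y) (\<pi> z)"
    "br (\<pi> z) (\<pi> (x + y)) = br (\<pi> z) (\<pi> x) + br (\<pi> z) (\<pi> y)"
    "br (\<pi> (c *\<^sub>R x)) (\<pi> y) = c *\<^sub>R br (\<pi> x) (\<pi> y)"
    "br (\<pi> x) (\<pi> (c *\<^sub>R y)) = c *\<^sub>R br (\<pi> x) (\<pi> y)"
    using bil \<pi>(2) by (simp_all add: linear_add[OF \<pi>(1)] linear_scale[OF \<pi>(1)] bilinear_on_def)
  show "br (\<pi> x) (\<pi> x) = 0" using la \<pi>(2) by (simp add: lie_algebra_def)
  show "br (\<pi> x) (\<pi> (br (\<pi> y) (\<pi> z))) + br (\<pi> y) (\<pi> (br (\<pi> z) (\<pi> x)))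
      + br (\<pi> z) (\<pi> (br (\<pi> x) (\<pi> y))) = 0"
    using la \<pi>(2) by (simp add: \<pi>(3) cl lie_algebra_def)
qed

context lie_bracket
begin

lemma lie_algebraI:
  assumes g: "fin_dim_subspace g" and closed: "\<And>x y. x \<in> g \<Longrightarrow> y \<in> g \<Longrightarrow> br x y \<in> g"
  shows "lie_algebra g br"
  unfolding lie_algebra_def
proof (intro conjI ballI)
  show "\<exists>B. finite B \<and> span B = g" using finite_basis[OF g] by metis
  show "bilinear_on g br" by (simp add: bilinear_on_def br_simps)
qed (use closed jacobi in auto)

lemma lie_radical_ideal:
  assumes g: "subspace g"
  shows "lie_ideal (lie_radical g br) g br"
proof -
  let ?U = "\<Union>{h. lie_ideal h g br \<and> lie_solvable h br}"
  have "lie_radical g br \<subseteq> g"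
    unfolding lie_radical_def by (rule span_minimal[OF _ g]) (auto simp: lie_ideal_def)
  moreover have "lie_radical g br \<subseteq> {y. br x y \<in> lie_radical g br}" if "x \<in> g" for x
    unfolding lie_radical_def
    by (rule span_minimal[OF _ subspace_br_in[OF subspace_span]])
      (use that in \<open>auto simp: lie_ideal_def intro!: span_base\<close>)
  ultimately show ?thesis by (auto simp: lie_ideal_def lie_radical_def)
qed

text \<open>The image of a solvable ideal under an automorphism is a solvable ideal.\<close>
lemma lie_radical_invariant:
  assumes s: "linear s" and s_in: "\<And>x. x \<in> g \<Longrightarrow> s x \<in> g" and s_s: "\<And>x. x \<in> g \<Longrightarrow> s (s x) = x"
    and s_br: "\<And>x y. x \<in> g \<Longrightarrow> y \<in> g \<Longrightarrow> s (br x y) = br (s x) (s y)"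
    and r: "r \<in> lie_radical g br"
  shows "s r \<in> lie_radical g br"
proof -
  have image: "lie_ideal (s ` h) g br \<and> lie_solvable (s ` h) br" if h: "lie_ideal h g br" "lie_solvable h br" for h
  proof
    have hg: "subspace h" "h \<subseteq> g" "\<And>x y. x \<in> g \<Longrightarrow> y \<in> h \<Longrightarrow> br x y \<in> h"
      using h(1) by (auto simp: lie_ideal_def)
    have "br x (s y) \<in> s ` h" if "x \<in> g" "y \<in> h" for x y
    proof -
      have "br x (s y) = s (br (s x) y)" using that hg(2) by (auto simp: s_br s_in s_s)
      then show ?thesis using hg(3)[OF s_in[OF that(1)] that(2)] by blast
    qed
    then show "lie_ideal (s ` h) g br"
      using linear_subspace_image[OF s hg(1)] hg(2) s_in by (auto simp: lie_ideal_def)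
    have "derived_series (s ` h) br n = s ` derived_series h br n \<and> derived_series h br n \<subseteq> h" for n
    proof (induction n)
      case (Suc n)
      let ?D = "derived_series h br n"
      have D: "?D \<subseteq> h" using Suc by blast
      have sub: "span {br x y |x y. x \<in> ?D \<and> y \<in> ?D} \<subseteq> h"
        by (rule span_minimal[OF _ hg(1)]) (use D hg in blast)
      have "{br x y |x y. x \<in> s ` ?D \<and> y \<in> s ` ?D} = s ` {br x y |x y. x \<in> ?D \<and> y \<in> ?D}"
      proof (intro set_eqI iffI)
        fix u assume "u \<in> {br x y |x y. x \<in> s ` ?D \<and> y \<in> s ` ?D}"
        then obtain x y where xy: "x \<in> ?D" "y \<in> ?D" "u = br (s x) (s y)" by blast
        moreover from this have "x \<in> g" "y \<in> g" using D hg(2) by auto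
        ultimately have "u = s (br x y)" using s_br by simp
        then show "u \<in> s ` {br x y |x y. x \<in> ?D \<and> y \<in> ?D}" using xy by blast
      next
        fix u assume "u \<in> s ` {br x y |x y. x \<in> ?D \<and> y \<in> ?D}"
        then obtain x y where xy: "x \<in> ?D" "y \<in> ?D" "u = s (br x y)" by blast
        moreover from this have "x \<in> g" "y \<in> g" using D hg(2) by auto
        ultimately have "u = br (s x) (s y)" using s_br by simp
        then show "u \<in> {br x y |x y. x \<in> s ` ?D \<and> y \<in> s ` ?D}" using xy by blast
      qed
      then show ?case using Suc sub linear_span_image[OF s] by (simp add: bracket_span_def)
    qed simp
    moreover obtain n where "derived_series h br n = {0}" using h(2) by (auto simp: lie_solvable_def)
    ultimately have "derived_series (s ` h) br n = {0}" using linear_0[OF s] by simp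
    then show "lie_solvable (s ` h) br" unfolding lie_solvable_def by blast
  qed
  have "lie_radical g br \<subseteq> {x. s x \<in> lie_radical g br}"
    unfolding lie_radical_def
  proof (rule span_minimal)
    show "subspace {x. s x \<in> span (\<Union>{h. lie_ideal h g br \<and> lie_solvable h br})}"
      using linear_subspace_vimage[OF s subspace_span] by (simp add: vimage_def)
    show "\<Union>{h. lie_ideal h g br \<and> lie_solvable h br}
        \<subseteq> {x. s x \<in> span (\<Union>{h. lie_ideal h g br \<and> lie_solvable h br})}"
      using image by (auto intro!: span_base)
  qed
  then show ?thesis using r by blast
qed

text \<open>An ideal of \<open>c\<close> is an ideal of \<open>S\<close>, because \<open>S\<close> acts on \<open>c\<close> through elements of \<open>c\<close>.\<close>
lemma lie_semisimple_summand:
  assumes ss: "lie_semisimple S br" and c: "c \<subseteq> S"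
    and act: "\<And>x. x \<in> S \<Longrightarrow> \<exists>x'\<in>c. \<forall>y\<in>c. br x y = br x' y"
  shows "lie_semisimple c br"
proof -
  have "lie_radical c br \<subseteq> {0}"
    unfolding lie_radical_def
  proof (rule span_minimal[OF _ subspace_single_0], clarify)
    fix h y assume h: "lie_ideal h c br" "lie_solvable h br" and y: "y \<in> h"
    have "lie_ideal h S br"
      using h(1) c act unfolding lie_ideal_def by (metis (no_types, lifting) subset_trans subsetD)
    then have "h \<subseteq> lie_radical S br"
      unfolding lie_radical_def using h(2) by (intro subset_trans[OF _ span_superset]) auto
    then show "y = 0" using ss y by (auto simp: lie_semisimple_def)
  qed
  then show ?thesis unfolding lie_semisimple_def lie_radical_def using span_zero by blast
qed

end

section \<open>Splitting off an orthogonal component\<close>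

context symplectic_decomposition
begin

text \<open>The complementary summand is the centraliser of \<open>c\<close>. It contains the other components, and it contains \<open>R\<close> by
\<open>orthogonal_component_commutes_with_radical\<close>; it meets \<open>c\<close> in the centre of \<open>c\<close>, which is zero. Its \<open>P\<close>-part is orthogonal to that of
\<open>c\<close> since \<open>P \<inter> c = [K \<inter> c, P \<inter> c]\<close>, so non-degeneracy passes to both summands.\<close>
lemma orthogonal_component_is_factor:
  assumes c: "c \<in> \<C>" and orth: "\<And>\<rho> y. \<rho> \<in> P \<inter> R \<Longrightarrow> y \<in> P \<inter> c \<Longrightarrow> \<Omega> \<rho> y = 0"
    and couple: "symmetric_couple c br s" and PP: "bracket_span br P P = K"
  shows "semisimple_factor c G br s \<Omega>"
proof -
  interpret couple: semisimple_couple br c "K \<inter> c" "P \<inter> c" s by (rule component[OF c])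
  have cG: "c \<subseteq> G" by (rule component_subset[OF c])
  have sc: "subspace c" by (rule fin_dim_subspaceD[OF couple.V])
  have sG: "subspace G" by (rule fin_dim_subspaceD[OF G])
  define Z where "Z = {x \<in> G. \<forall>y\<in>c. br y x = 0}"
  have ZG: "Z \<subseteq> G" by (auto simp: Z_def)
  have sZ: "subspace Z" using sG by (auto simp: Z_def subspace_def br_simps)
  have clZ: "br x y \<in> Z" if "x \<in> Z" "y \<in> Z" for x y
  proof -
    have "br w (br x y) = 0" if "w \<in> c" for w
      using \<open>x \<in> Z\<close> \<open>y \<in> Z\<close> that by (subst br_br) (simp add: Z_def br_simps)
    then show ?thesis using that closed by (simp add: Z_def)
  qed
  have sinZ: "s x \<in> Z" if "x \<in> Z" for x
  proof -
    have "br y (s x) = 0" if "y \<in> c" for y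
    proof -
      have "br y (s x) = s (br (s y) x)"
        using that \<open>x \<in> Z\<close> cG by (simp add: Z_def s_br s_in s_s subset_iff)
      also have "br (s y) x = 0" using that \<open>x \<in> Z\<close> couple.sV by (simp add: Z_def)
      finally show ?thesis by (simp add: linear_0[OF s])
    qed
    then show ?thesis using that s_in by (simp add: Z_def)
  qed
  have Int: "c \<inter> Z = {0}"
  proof -
    have "x = 0" if "x \<in> c" "x \<in> Z" for x
      by (rule semisimple_centre_trivial[OF couple.V couple.closed couple.ss that(1)])
        (use that br_antisym[of x] in \<open>simp_all add: Z_def\<close>)
    then show ?thesis using subspace_0[OF sc] subspace_0[OF sZ] by blast
  qed
  have RZ: "r \<in> Z" if "r \<in> R" for r
    using orthogonal_component_commutes_with_radical[OF c orth _ that] that R(2) by (auto simp: Z_def)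
  have dZ: "x \<in> Z" if "d \<in> \<C>" "d \<noteq> c" "x \<in> d" for d x
    using that components_commute[OF c that(1)] component_subset[OF that(1)] by (auto simp: Z_def)
  have Psplit: "\<exists>x\<in>P \<inter> c. \<exists>y\<in>P \<inter> Z. p = x + y" if "p \<in> P" for p
    using that
  proof (induction rule: P_induct)
    case (add p p')
    then obtain x y x' y' where "x \<in> P \<inter> c" "y \<in> P \<inter> Z" "p = x + y" "x' \<in> P \<inter> c" "y' \<in> P \<inter> Z" "p' = x' + y'"
      by blast
    then show ?case using subspace_add[OF subspaces(2)] subspace_add[OF sc] subspace_add[OF sZ]
      by (intro bexI[of _ "x + x'"] bexI[of _ "y + y'"]) auto
  next
    case (component d x)
    show ?case
    proof (cases "d = c")
      case True
      then show ?thesis using component subspace_0[OF subspaces(2)] subspace_0[OF sZ]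
        by (intro bexI[of _ x] bexI[of _ 0]) auto
    next
      case False
      then show ?thesis using component dZ subspace_0[OF subspaces(2)] subspace_0[OF sc]
        by (intro bexI[of _ 0] bexI[of _ x]) auto
    qed
  next
    case (radical r)
    then show ?case using RZ subspace_0[OF subspaces(2)] subspace_0[OF sc]
      by (intro bexI[of _ 0] bexI[of _ r]) auto
  qed
  have G_split: "\<exists>x\<in>c. \<exists>y\<in>Z. g = x + y" if g: "g \<in> G" for g
  proof -
    obtain f r where fr: "\<forall>c\<in>\<C>. f c \<in> c" "r \<in> R" "g = (\<Sum>c\<in>\<C>. f c) + r" using G_sum[OF g] by blast
    have "(\<Sum>c\<in>\<C>. f c) = f c + (\<Sum>d\<in>\<C> - {c}. f d)" by (rule sum.remove[OF finite_components c])
    moreover have "(\<Sum>d\<in>\<C> - {c}. f d) + r \<in> Z"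
      using fr dZ RZ by (intro subspace_add[OF sZ] subspace_sum[OF sZ]) auto
    ultimately show ?thesis using fr c by (intro bexI[of _ "f c"] bexI[of _ "(\<Sum>d\<in>\<C> - {c}. f d) + r"]) auto
  qed
  have orthZ: "\<Omega> x y = 0" if x: "x \<in> P \<inter> c" and y: "y \<in> P \<inter> Z" for x y
  proof (rule couple.functional_on_P_vanishes[OF form_linear(2) _ x])
    fix k p assume "k \<in> K \<inter> c" "p \<in> P \<inter> c"
    then show "\<Omega> (br k p) y = 0" using form_inv[of k p y] y by (auto simp: Z_def linear_0[OF form_linear(1)])
  qed
  have parts: "K_part c s = K \<inter> c" "P_part c s = P \<inter> c" "K_part Z s = K \<inter> Z" "P_part Z s = P \<inter> Z"
    using cG ZG by (auto simp: K_part_def P_part_def K P)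
  have comm: "br x y = 0" "br y x = 0" if "x \<in> c" "y \<in> Z" for x y
    using that br_antisym[of y x] by (auto simp: Z_def)
  have ds: "lie_direct_sum G br c Z"
    unfolding lie_direct_sum_def lie_subalgebra_def
  proof (intro conjI ballI sc cG sZ ZG Int)
    show "G = {x + y |x y. x \<in> c \<and> y \<in> Z}"
    proof
      show "G \<subseteq> {x + y |x y. x \<in> c \<and> y \<in> Z}" using G_split by blast
      show "{x + y |x y. x \<in> c \<and> y \<in> Z} \<subseteq> G" using subspace_add[OF sG] cG ZG by blast
    qed
  qed (use couple.closed clZ comm in auto)
  have form: "symplectic_form_on (P \<inter> U) \<Omega>"
    if "\<And>x. x \<in> P \<inter> U \<Longrightarrow> (\<And>y. y \<in> P \<inter> U \<Longrightarrow> \<Omega> x y = 0) \<Longrightarrow> x = 0" for U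
    using that form_alt unfolding symplectic_form_on_def bilinear_on_def
    by (auto simp: linear_add[OF form_linear(1)] linear_add[OF form_linear(2)]
        linear_scale[OF form_linear(1)] linear_scale[OF form_linear(2)])
  have inv: "\<forall>k\<in>K \<inter> U. \<forall>x\<in>P \<inter> U. \<forall>y\<in>P \<inter> U. \<Omega> (br k x) y + \<Omega> x (br k y) = 0" for U
    using form_inv by auto
  have tc: "symplectic_symmetric_triple c br s \<Omega>"
    unfolding symplectic_symmetric_triple_def parts
  proof (intro conjI couple inv form)
    fix x assume x: "x \<in> P \<inter> c" and 0: "\<And>y. y \<in> P \<inter> c \<Longrightarrow> \<Omega> x y = 0"
    show "x = 0"
    proof (rule form_nondeg)
      fix y assume "y \<in> P"
      then obtain u v where "u \<in> P \<inter> c" "v \<in> P \<inter> Z" "y = u + v" using Psplit by blast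
      then show "\<Omega> x y = 0" using 0 orthZ[OF x] by (simp add: linear_add[OF form_linear(1)])
    qed (use x in blast)
  qed
  have coupleZ: "symmetric_couple Z br s"
    unfolding symmetric_couple_def parts
  proof (intro conjI)
    show "lie_algebra Z br"
      by (rule lie_algebraI[OF fin_dim_subspace_subset[OF G sZ ZG] clZ])
    show "involutive_automorphism Z br s"
      unfolding involutive_automorphism_def
      using sinZ s_br[OF subsetD[OF ZG] subsetD[OF ZG]] s_s[OF subsetD[OF ZG]]
      by (simp add: linear_add[OF s] linear_scale[OF s])
    show "\<forall>k\<in>K \<inter> Z. (\<forall>p\<in>P \<inter> Z. br k p = 0) \<longrightarrow> k = 0"
    proof (intro ballI impI)
      fix k assume k: "k \<in> K \<inter> Z" and 0: "\<forall>p\<in>P \<inter> Z. br k p = 0"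
      show "k = 0"
      proof (rule faithful)
        fix p assume "p \<in> P"
        then obtain u v where "u \<in> P \<inter> c" "v \<in> P \<inter> Z" "p = u + v" using Psplit by blast
        then show "br k p = 0" using 0 comm(2)[of u k] k by (simp add: br_simps)
      qed (use k in blast)
    qed
    let ?B = "bracket_span br (P \<inter> Z) (P \<inter> Z)"
    have sK: "subspace (K \<inter> Z)" using subspaces(1) sZ by (rule subspace_inter)
    have BK: "?B \<subseteq> K \<inter> Z"
      unfolding bracket_span_def by (rule span_minimal[OF _ sK]) (use br_P_P clZ in blast)
    \<comment> \<open>Brackets of \<open>P\<close> with itself have no mixed terms, so an element of \<open>K\<close> is a sum of one in \<open>c\<close> and one in \<open>?B\<close>.\<close>
    have "K \<subseteq> {x + y |x y. x \<in> c \<and> y \<in> ?B}"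
      unfolding PP[symmetric] bracket_span_def[of br P P]
    proof (rule span_minimal, clarify)
      fix p p' assume "p \<in> P" "p' \<in> P"
      then obtain u v u' v' where uv: "u \<in> P \<inter> c" "v \<in> P \<inter> Z" "p = u + v" "u' \<in> P \<inter> c" "v' \<in> P \<inter> Z" "p' = u' + v'"
        using Psplit by meson
      have "br p p' = br u u' + br v v'"
        using comm(1)[of u v'] comm(2)[of u' v] uv by (simp add: br_simps)
      moreover have "br v v' \<in> ?B" unfolding bracket_span_def using uv by (intro span_base) blast
      moreover have "br u u' \<in> c" using couple.closed uv by blast
      ultimately show "\<exists>x y. br p p' = x + y \<and> x \<in> c \<and> y \<in> ?B" by blast
    next
      show "subspace {x + y |x y. x \<in> c \<and> y \<in> ?B}"
        by (rule subspace_sums[OF sc]) (simp add: bracket_span_def)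
    qed
    moreover have "x + y \<in> ?B" if "x \<in> c" "y \<in> ?B" "x + y \<in> Z" for x y
    proof -
      have "(x + y) - y \<in> Z" using that BK by (intro subspace_diff[OF sZ]) auto
      then have "x = 0" using that(1) Int by auto
      then show ?thesis using that(2) by simp
    qed
    ultimately have "K \<inter> Z \<subseteq> ?B" by blast
    then show "?B = K \<inter> Z" using BK by blast
  qed
  have tZ: "symplectic_symmetric_triple Z br s \<Omega>"
    unfolding symplectic_symmetric_triple_def parts
  proof (intro conjI coupleZ inv form)
    fix x assume x: "x \<in> P \<inter> Z" and 0: "\<And>y. y \<in> P \<inter> Z \<Longrightarrow> \<Omega> x y = 0"
    show "x = 0"
    proof (rule form_nondeg)
      fix y assume "y \<in> P"
      then obtain u v where "u \<in> P \<inter> c" "v \<in> P \<inter> Z" "y = u + v" using Psplit by blast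
      then show "\<Omega> x y = 0" using 0 orthZ[of u x] x form_skew[of x u] by (auto simp: linear_add[OF form_linear(1)])
    qed (use x in blast)
  qed
  show ?thesis
    unfolding semisimple_factor_def triple_direct_sum_def parts
    using couple.ss ds tc tZ orthZ by (intro conjI exI[of _ Z]) (auto simp: parts)
qed

end

section \<open>The dimension of the isotropic part of the radical\<close>

lemma semisimple_factor_cong:
  assumes f: "semisimple_factor L G br' \<sigma>' \<Omega>'"
    and eq: "\<And>x y. x \<in> G \<Longrightarrow> y \<in> G \<Longrightarrow> br x y = br' x y"
    and eq_s: "\<And>x. x \<in> G \<Longrightarrow> \<sigma> x = \<sigma>' x"
    and eq_f: "\<And>x y. x \<in> P_part G \<sigma>' \<Longrightarrow> y \<in> P_part G \<sigma>' \<Longrightarrow> \<Omega> x y = \<Omega>' x y"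
  shows "semisimple_factor L G br \<sigma> \<Omega>"
proof -
  obtain g1 where ds: "lie_direct_sum G br' L g1"
    and t: "symplectic_symmetric_triple L br' \<sigma>' \<Omega>'" "symplectic_symmetric_triple g1 br' \<sigma>' \<Omega>'"
    and orth: "\<forall>x\<in>P_part L \<sigma>'. \<forall>y\<in>P_part g1 \<sigma>'. \<Omega>' x y = 0"
    and ss: "lie_semisimple L br'"
    using f by (auto simp: semisimple_factor_def triple_direct_sum_def)
  have LG: "L \<subseteq> G" "g1 \<subseteq> G" using ds by (auto simp: lie_direct_sum_def lie_subalgebra_def)
  have sub: "P_part g \<sigma>' \<subseteq> P_part G \<sigma>'" if "g \<subseteq> G" for g using that by (auto simp: P_part_def)
  have part: "P_part g \<sigma> = P_part g \<sigma>'" if "g \<subseteq> G" for g using that eq_s by (auto simp: P_part_def)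
  have tr: "symplectic_symmetric_triple g br \<sigma> \<Omega>" if "symplectic_symmetric_triple g br' \<sigma>' \<Omega>'" "g \<subseteq> G" for g
  proof (rule symplectic_symmetric_triple_cong[OF that(1)])
    show "br x y = br' x y" if "x \<in> g" "y \<in> g" for x y using eq that \<open>g \<subseteq> G\<close> by auto
    show "\<sigma> x = \<sigma>' x" if "x \<in> g" for x using eq_s that \<open>g \<subseteq> G\<close> by auto
    show "\<Omega> x y = \<Omega>' x y" if "x \<in> P_part g \<sigma>'" "y \<in> P_part g \<sigma>'" for x y
      using eq_f that sub[OF \<open>g \<subseteq> G\<close>] by auto
  qed
  have sa: "lie_subalgebra g G br" if "lie_subalgebra g G br'" for g
    using that eq unfolding lie_subalgebra_def by (metis subsetD)
  have "\<forall>x\<in>L. \<forall>y\<in>g1. br x y = 0"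
    using ds LG eq unfolding lie_direct_sum_def by (metis subsetD)
  then have "lie_direct_sum G br L g1" using ds sa unfolding lie_direct_sum_def by blast
  moreover have "\<forall>x\<in>P_part L \<sigma>. \<forall>y\<in>P_part g1 \<sigma>. \<Omega> x y = 0"
  proof (intro ballI)
    fix x y assume "x \<in> P_part L \<sigma>" "y \<in> P_part g1 \<sigma>"
    then have xy: "x \<in> P_part L \<sigma>'" "y \<in> P_part g1 \<sigma>'" using part LG by auto
    then have "x \<in> P_part G \<sigma>'" "y \<in> P_part G \<sigma>'" using sub LG by blast+
    then show "\<Omega> x y = 0" using eq_f orth xy by simp
  qed
  moreover have "lie_radical L br = lie_radical L br'"
    by (rule lie_radical_cong) (use eq LG in auto)
  then have "lie_semisimple L br" using ss by (simp add: lie_semisimple_def)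
  ultimately show ?thesis
    using tr[OF t(1) LG(1)] tr[OF t(2) LG(2)] unfolding semisimple_factor_def triple_direct_sum_def by blast
qed

theorem proposition4p2p11:
  fixes G S P\<^sub>R :: "'a::real_vector set"
    and br :: "'a \<Rightarrow> 'a \<Rightarrow> 'a"
    and \<sigma> :: "'a \<Rightarrow> 'a"
    and \<Omega> :: "'a \<Rightarrow> 'a \<Rightarrow> real"
    and \<C> :: "'a set set"
    and A I :: nat
  assumes triple: "symplectic_symmetric_triple G br \<sigma> \<Omega>"
    and not_solvable: "\<not> lie_solvable G br"
    and not_semisimple: "\<not> lie_semisimple G br"
    and no_semisimple_factor: "\<not> (\<exists>L. L \<noteq> {0} \<and> semisimple_factor L G br \<sigma> \<Omega>)"
    and P\<^sub>R: "P\<^sub>R = P_part G \<sigma> \<inter> lie_radical G br"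
    and isotropic: "isotropic_for \<Omega> P\<^sub>R"
    and levi: "levi_factor S G br"
    and stable: "\<sigma> ` S \<subseteq> S"
    and decomposition: "couple_decomposition S br \<sigma> \<C>"
    and A: "A = card {c \<in> \<C>. lie_centre (K_part c \<sigma>) br = {0}}"
    and I: "I = card {c \<in> \<C>. lie_centre (K_part c \<sigma>) br \<noteq> {0}}"
  shows "dim P\<^sub>R \<ge> 2 * A + I \<and> I \<noteq> dim P\<^sub>R"
proof -
  define K where "K = K_part G \<sigma>"
  define P where "P = P_part G \<sigma>"
  define R where "R = lie_radical G br"
  have couple: "symmetric_couple G br \<sigma>" and form: "symplectic_form_on P \<Omega>"
    and inv: "\<And>k x y. k \<in> K \<Longrightarrow> x \<in> P \<Longrightarrow> y \<in> P \<Longrightarrow> \<Omega> (br k x) y + \<Omega> x (br k y) = 0"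
    using triple by (auto simp: symplectic_symmetric_triple_def K_def P_def)
  have la: "lie_algebra G br" and aut: "involutive_automorphism G br \<sigma>"
    and PP: "bracket_span br P P = K"
    and faithful: "\<And>k. k \<in> K \<Longrightarrow> (\<And>p. p \<in> P \<Longrightarrow> br k p = 0) \<Longrightarrow> k = 0"
    using couple by (auto simp: symmetric_couple_def K_def P_def)
  have fG: "fin_dim_subspace G" by (rule lie_algebra_fin_dim[OF la])
  have sG: "subspace G" by (rule fin_dim_subspaceD[OF fG])
  \<comment> \<open>Projections onto \<open>G\<close> and \<open>P\<close> extend the bracket, the involution and the form to the whole space.\<close>
  obtain \<pi> where \<pi>: "linear \<pi>" "\<And>x. \<pi> x \<in> G" "\<And>x. x \<in> G \<Longrightarrow> \<pi> x = x"
    by (rule fin_dim_projection[OF fG]) blast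
  define br' where "br' = (\<lambda>x y. br (\<pi> x) (\<pi> y))"
  define s where "s = (\<lambda>x. \<sigma> (\<pi> x))"
  have eq: "br' x y = br x y" if "x \<in> G" "y \<in> G" for x y using that by (simp add: br'_def \<pi>(3))
  have eq_s: "s x = \<sigma> x" if "x \<in> G" for x using that by (simp add: s_def \<pi>(3))
  interpret lie_bracket br'
    unfolding br'_def by (rule lie_bracket_extension[OF la \<pi>])
  have ls: "linear s"
    using aut \<pi>(2) by (auto intro!: linearI simp: s_def linear_add[OF \<pi>(1)] linear_scale[OF \<pi>(1)] involutive_automorphism_def)
  have s_in: "s x \<in> G" if "x \<in> G" for x using aut that by (simp add: eq_s involutive_automorphism_def)
  have s_s: "s (s x) = x" if "x \<in> G" for x
    using aut that s_in[OF that] by (simp add: eq_s involutive_automorphism_def)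
  have closed: "br' x y \<in> G" if "x \<in> G" "y \<in> G" for x y using la that by (simp add: eq lie_algebra_def)
  have s_br: "s (br' x y) = br' (s x) (s y)" if "x \<in> G" "y \<in> G" for x y
    using aut that closed[OF that] s_in[OF that(1)] s_in[OF that(2)]
    by (simp add: eq eq_s involutive_automorphism_def)
  have Keq: "K = {x \<in> G. s x = x}" and Peq: "P = {x \<in> G. s x = - x}"
    by (auto simp: K_def P_def K_part_def P_part_def eq_s)
  have KG: "K \<subseteq> G" and PG: "P \<subseteq> G" by (auto simp: Keq Peq)
  have sP: "subspace P"
    using sG by (auto simp: Peq subspace_def linear_0[OF ls] linear_add[OF ls] linear_scale[OF ls])
  obtain \<pi>' where \<pi>': "linear \<pi>'" "\<And>x. \<pi>' x \<in> P" "\<And>x. x \<in> P \<Longrightarrow> \<pi>' x = x"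
    by (rule fin_dim_projection[OF fin_dim_subspace_subset[OF fG sP PG]]) blast
  define \<Omega>' where "\<Omega>' = (\<lambda>x y. \<Omega> (\<pi>' x) (\<pi>' y))"
  have eq_f: "\<Omega>' x y = \<Omega> x y" if "x \<in> P" "y \<in> P" for x y using that by (simp add: \<Omega>'_def \<pi>'(3))
  have lf: "linear (\<Omega>' x)" "linear (\<lambda>x. \<Omega>' x y)" for x y
    using form \<pi>'(2) by (auto intro!: linearI simp: \<Omega>'_def linear_add[OF \<pi>'(1)] linear_scale[OF \<pi>'(1)]
        symplectic_form_on_def bilinear_on_def)
  have brKP: "br' k x \<in> P" if "k \<in> K" "x \<in> P" for k x
    using that closed s_br by (auto simp: Keq Peq br_simps)
  have R': "R = lie_radical G br'" unfolding R_def by (rule lie_radical_cong) (simp add: eq)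
  have Rideal: "lie_ideal R G br'" unfolding R' by (rule lie_radical_ideal[OF sG])
  have sub: "lie_subalgebra S G br" and ssS: "lie_semisimple S br"
    and GSR: "G = {x + y |x y. x \<in> S \<and> y \<in> R}"
    using levi by (auto simp: levi_factor_def R_def)
  have SG: "S \<subseteq> G" using sub by (simp add: lie_subalgebra_def)
  have ssS': "lie_semisimple S br'"
  proof -
    have "lie_radical S br' = lie_radical S br" by (rule lie_radical_cong) (use eq SG in auto)
    then show ?thesis using ssS by (simp add: lie_semisimple_def)
  qed
  have fin: "finite \<C>" and comps: "\<And>c. c \<in> \<C> \<Longrightarrow> c \<noteq> {0} \<and> symmetric_couple c br \<sigma>"
    and Ssum: "S = {\<Sum>c\<in>\<C>. f c |f. \<forall>c\<in>\<C>. f c \<in> c}"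
    and comm: "\<And>c d x y. c \<in> \<C> \<Longrightarrow> d \<in> \<C> \<Longrightarrow> c \<noteq> d \<Longrightarrow> x \<in> c \<Longrightarrow> y \<in> d \<Longrightarrow> br x y = 0"
    using decomposition by (auto simp: couple_decomposition_def indecomposable_couple_def)
  have fc: "fin_dim_subspace c" if "c \<in> \<C>" for c
    using comps[OF that] lie_algebra_fin_dim by (auto simp: symmetric_couple_def)
  have cS: "c \<subseteq> S" if c: "c \<in> \<C>" for c
  proof
    fix x assume x: "x \<in> c"
    have "x = (\<Sum>d\<in>\<C>. if d = c then x else 0)" using fin c by simp
    moreover have "\<forall>d\<in>\<C>. (if d = c then x else 0) \<in> d"
      using x fc subspace_0[OF fin_dim_subspaceD] by auto
    ultimately show "x \<in> S" unfolding Ssum by (smt (verit, best) mem_Collect_eq)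
  qed
  have cG: "c \<subseteq> G" if "c \<in> \<C>" for c using cS[OF that] SG by blast
  have couple': "symmetric_couple c br' s" if c: "c \<in> \<C>" for c
    by (rule symmetric_couple_cong[where br' = br and \<sigma>' = \<sigma>])
      (use comps[OF c] eq eq_s cG[OF c] in auto)
  have comm': "br' x y = 0" if "c \<in> \<C>" "d \<in> \<C>" "c \<noteq> d" "x \<in> c" "y \<in> d" for c d x y
    using comm[OF that] eq[of x y] cG that by auto
  have component: "semisimple_couple br' c (K \<inter> c) (P \<inter> c) s" if c: "c \<in> \<C>" for c
  proof (intro semisimple_couple.intro semisimple_couple_axioms.intro lie_bracket_axioms)
    show "fin_dim_subspace c" by (rule fc[OF c])
    show "linear s" by (rule ls)
    show "K \<inter> c = {x \<in> c. s x = x}" "P \<inter> c = {x \<in> c. s x = - x}" using cG[OF c] by (auto simp: Keq Peq)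
    have c': "lie_algebra c br'" "involutive_automorphism c br' s"
      using couple'[OF c] by (auto simp: symmetric_couple_def)
    show "s x \<in> c" "s (s x) = x" if "x \<in> c" for x
      using c'(2) that by (auto simp: involutive_automorphism_def)
    show "br' x y \<in> c" "s (br' x y) = br' (s x) (s y)" if "x \<in> c" "y \<in> c" for x y
      using c' that by (auto simp: involutive_automorphism_def lie_algebra_def)
    show "lie_semisimple c br'"
    proof (rule lie_semisimple_summand[OF ssS' cS[OF c]])
      fix x assume "x \<in> S"
      then obtain f where f: "x = (\<Sum>d\<in>\<C>. f d)" "\<forall>d\<in>\<C>. f d \<in> d" unfolding Ssum by blast
      have "br' x y = br' (f c) y" if y: "y \<in> c" for y
      proof -
        have "br' x y = (\<Sum>d\<in>\<C>. br' (f d) y)" unfolding f(1) by (rule linear_sum[OF linear_br_left])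
        also have "\<dots> = (\<Sum>d\<in>\<C>. if d = c then br' (f c) y else 0)"
          by (rule sum.cong) (use comm'[OF _ c] f(2) y in auto)
        finally show ?thesis using fin c by simp
      qed
      then show "\<exists>x'\<in>c. \<forall>y\<in>c. br' x y = br' x' y" using f(2) c by blast
    qed
  qed
  have pR: "P\<^sub>R = P \<inter> R" by (simp add: P\<^sub>R P_def R_def)
  interpret D: symplectic_decomposition br' G K P R s \<Omega>' \<C>
  proof (intro symplectic_decomposition.intro symplectic_decomposition_axioms.intro lie_bracket_axioms)
    show "k = 0" if "k \<in> K" "\<And>p. p \<in> P \<Longrightarrow> br' k p = 0" for k
      by (rule faithful[OF that(1)]) (metis that KG PG eq subsetD)
    show "\<Omega>' x x = 0" if "x \<in> P" for x using form that by (simp add: eq_f symplectic_form_on_def)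
    show "x = 0" if "x \<in> P" "\<And>y. y \<in> P \<Longrightarrow> \<Omega>' x y = 0" for x
      using form that by (simp add: eq_f symplectic_form_on_def)
    show "\<Omega>' (br' k x) y = - \<Omega>' x (br' k y)" if "k \<in> K" "x \<in> P" "y \<in> P" for k x y
    proof -
      have "br' k x = br k x" "br' k y = br k y" using eq that KG PG by blast+
      then show ?thesis using inv[OF that] brKP[OF that(1,2)] brKP[OF that(1,3)] that
        by (simp add: eq_f eq_neg_iff_add_eq_0)
    qed
    show "subspace R" "R \<subseteq> G" using Rideal by (auto simp: lie_ideal_def)
    show "br' x r \<in> R" if "x \<in> G" "r \<in> R" for x r using Rideal that by (simp add: lie_ideal_def)
    show "s r \<in> R" if "r \<in> R" for r
      using lie_radical_invariant[OF ls s_in s_s s_br] that unfolding R' by blast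
    show "\<Omega>' x y = 0" if "x \<in> P \<inter> R" "y \<in> P \<inter> R" for x y
      using isotropic that by (simp add: eq_f isotropic_for_def pR)
    show "\<exists>f r. (\<forall>c\<in>\<C>. f c \<in> c) \<and> r \<in> R \<and> x = (\<Sum>c\<in>\<C>. f c) + r" if xG: "x \<in> G" for x
    proof -
      obtain u r where ur: "u \<in> S" "r \<in> R" "x = u + r" using xG unfolding GSR by blast
      moreover obtain f where "u = (\<Sum>c\<in>\<C>. f c)" "\<forall>c\<in>\<C>. f c \<in> c" using ur(1) unfolding Ssum by blast
      ultimately show ?thesis by blast
    qed
  qed (use fG closed ls s_in s_s s_br Keq Peq lf fin component cG comm' in auto)
  have PP': "bracket_span br' P P = K"
  proof -
    have "symmetric_couple G br' s"
      by (rule symmetric_couple_cong[OF couple]) (simp_all add: eq eq_s)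
    moreover have "P_part G s = P" "K_part G s = K" by (auto simp: P_part_def K_part_def Keq Peq)
    ultimately show ?thesis by (simp add: symmetric_couple_def)
  qed
  interpret N: symplectic_no_factor br' G K P R s \<Omega>' \<C>
  proof unfold_locales
    fix c assume c: "c \<in> \<C>"
    show "\<exists>\<rho>\<in>P \<inter> R. \<exists>y\<in>P \<inter> c. \<Omega>' \<rho> y \<noteq> 0"
    proof (rule ccontr)
      assume "\<not> ?thesis"
      then have "semisimple_factor c G br' s \<Omega>'"
        by (intro D.orthogonal_component_is_factor[OF c _ couple'[OF c] PP']) blast
      then have "semisimple_factor c G br \<sigma> \<Omega>"
      proof (rule semisimple_factor_cong)
        have "P_part G s = P" by (auto simp: P_part_def Peq)
        then show "\<Omega> x y = \<Omega>' x y" if "x \<in> P_part G s" "y \<in> P_part G s" for x y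
          using that eq_f by simp
      qed (simp_all add: eq eq_s)
      then show False using no_semisimple_factor comps[OF c] by blast
    qed
  qed
  have "lie_centre (K_part c \<sigma>) br = {0} \<longleftrightarrow> N.centreless c" if c: "c \<in> \<C>" for c
  proof -
    have Kc: "K_part c \<sigma> = K \<inter> c" using cG[OF c] by (auto simp: K_def K_part_def)
    have "br x y = br' x y" if "x \<in> K \<inter> c" "y \<in> K \<inter> c" for x y
      by (rule eq[symmetric]) (use that KG in auto)
    then have "lie_centre (K_part c \<sigma>) br = {x \<in> K \<inter> c. \<forall>y\<in>K \<inter> c. br' x y = 0}"
      unfolding lie_centre_def Kc by auto
    moreover have "0 \<in> {x \<in> K \<inter> c. \<forall>y\<in>K \<inter> c. br' x y = 0}"
      using subspace_0[OF D.subspaces(1)] subspace_0[OF fin_dim_subspaceD[OF fc[OF c]]] by (simp add: br_simps)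
    ultimately show ?thesis unfolding N.centreless_def by blast
  qed
  then have AI: "A = card {c \<in> \<C>. N.centreless c}" "I = card {c \<in> \<C>. \<not> N.centreless c}"
    unfolding A I by (auto intro!: arg_cong[where f = card])
  have "R \<noteq> {0}" using not_semisimple by (simp add: lie_semisimple_def R_def)
  from N.dim_bounds[OF this] show ?thesis unfolding AI pR by blast
qed

end
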